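(* Let $N\ge 2$, let $\Omega\subset\mathbb{R}^N$ be a bounded radially symmetric domain, and let $f:\mathbb{R}\to\mathbb{R}$ satisfy $f\in W^{1,1}_{\mathrm{loc}}(\mathbb{R})$. For $\alpha\ge0$ consider radial weak solutions $u=u_\alpha\in H^1_0(\Omega)$ to $$-\Delta u=|x|^\alpha f(u)\ \text{ in }\Omega,\qquad u=0\ \text{ on }\partial\Omega,$$ with $m\ge 2$ nodal zones and such that $f'(u_\alpha)\in L^\infty(\Omega)$. Then the Morse index of $u_\alpha$ goes to infinity as $\alpha\to+\infty$; that is, for every sequence $\alpha_n\to+\infty$ and every choice of such solutions $u_{\alpha_n}$ one has $m(u_{\alpha_n})\to+\infty$.
   Context: A bounded radially symmetric domain of $\mathbb{R}^N$ is a ball centered at the origin or an annulus $\{a<|x|<b\}$ with $0<a<b<\infty$. $f'$ is the (weak) derivative of $f$. A weak solution is $u\in H^1_0(\Omega)$ with $\int_\Omega\nabla u\cdot\nabla\varphi\,dx=\int_\Omega|x|^\alpha f(u)\varphi\,dx$ for all $\varphi\in C^1_0(\Omega)$ ($C^1$ functions with compact support in $\Omega$). The nodal zones of $u$ are the connected components of $\{x\in\Omega: u(x)\ne 0\}$. The Morse index $m(u)$ is the maximal dimension of a subspace of $H^1_0(\Omega)$ on which the quadratic form $\mathcal Q_u(\psi)=\int_\Omega(|\nabla\psi|^2-|x|^\alpha f'(u)\psi^2)\,dx$ is negative definite. *)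

theory Defs
  imports "HOL-Analysis.Analysis" "HOL-Library.Function_Algebras" "HOL-Library.Extended_Nat"
begin

definition bounded_radial_domain :: "'a::euclidean_space set \<Rightarrow> bool" where
  "bounded_radial_domain \<Omega> \<longleftrightarrow>
     (\<exists>R>0. \<Omega> = ball 0 R) \<or> (\<exists>a b. 0 < a \<and> a < b \<and> \<Omega> = {x. a < norm x \<and> norm x < b})"

definition grad :: "('a::euclidean_space \<Rightarrow> real) \<Rightarrow> 'a \<Rightarrow> 'a" where
  "grad \<phi> x = (\<Sum>b\<in>Basis. frechet_derivative \<phi> (at x) b *\<^sub>R b)"

text \<open>Test functions are extended by zero to the whole space.\<close>

definition C1_0 :: "'a::euclidean_space set \<Rightarrow> ('a \<Rightarrow> real) set" where
  "C1_0 \<Omega> = {\<phi>. (\<forall>x. \<phi> differentiable at x) \<and> continuous_on UNIV (grad \<phi>) \<and>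
                 compact (closure {x. \<phi> x \<noteq> 0}) \<and> closure {x. \<phi> x \<noteq> 0} \<subseteq> \<Omega>}"

definition locally_integrable ::
    "'a::euclidean_space set \<Rightarrow> ('a \<Rightarrow> 'b::euclidean_space) \<Rightarrow> bool" where
  "locally_integrable \<Omega> v \<longleftrightarrow> (\<forall>K. compact K \<and> K \<subseteq> \<Omega> \<longrightarrow> integrable (lebesgue_on K) v)"

text \<open>On the real line the gradient is the derivative, so there the following predicate with
  \<open>\<Omega> = UNIV\<close> says that \<open>u\<close> is in $W^{1,1}_{loc}$ with weak derivative (represented by) \<open>g\<close>.\<close>

definition has_weak_gradient ::
    "'a::euclidean_space set \<Rightarrow> ('a \<Rightarrow> real) \<Rightarrow> ('a \<Rightarrow> 'a) \<Rightarrow> bool" where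
  "has_weak_gradient \<Omega> u g \<longleftrightarrow> locally_integrable \<Omega> u \<and> locally_integrable \<Omega> g \<and>
     (\<forall>\<phi>\<in>C1_0 \<Omega>. (LINT x|lebesgue_on \<Omega>. u x *\<^sub>R grad \<phi> x) = - (LINT x|lebesgue_on \<Omega>. \<phi> x *\<^sub>R g x))"

text \<open>The weak gradient is unique up to null sets; the choice made here is irrelevant since it is
  only used under integrals.\<close>

definition wgrad :: "'a::euclidean_space set \<Rightarrow> ('a \<Rightarrow> real) \<Rightarrow> 'a \<Rightarrow> 'a" where
  "wgrad \<Omega> u = (SOME g. has_weak_gradient \<Omega> u g)"

definition in_L2 :: "'a::euclidean_space set \<Rightarrow> ('a \<Rightarrow> 'b::euclidean_space) \<Rightarrow> bool" where
  "in_L2 \<Omega> v \<longleftrightarrow> v \<in> borel_measurable (lebesgue_on \<Omega>) \<and>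
                integrable (lebesgue_on \<Omega>) (\<lambda>x. (norm (v x))\<^sup>2)"

definition in_Linfty :: "'a::euclidean_space set \<Rightarrow> ('a \<Rightarrow> real) \<Rightarrow> bool" where
  "in_Linfty \<Omega> v \<longleftrightarrow> v \<in> borel_measurable (lebesgue_on \<Omega>) \<and>
                    (\<exists>K. AE x in lebesgue_on \<Omega>. \<bar>v x\<bar> \<le> K)"

text \<open>Elements of the Sobolev spaces are represented by functions on the whole space whose values
  outside \<open>\<Omega>\<close> are irrelevant; two representatives of the same element agree a.e. on \<open>\<Omega>\<close>.\<close>

definition H1 :: "'a::euclidean_space set \<Rightarrow> ('a \<Rightarrow> real) set" where
  "H1 \<Omega> = {u. in_L2 \<Omega> u \<and> (\<exists>g. has_weak_gradient \<Omega> u g) \<and> in_L2 \<Omega> (wgrad \<Omega> u)}"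

definition H1_norm :: "'a::euclidean_space set \<Rightarrow> ('a \<Rightarrow> real) \<Rightarrow> real" where
  "H1_norm \<Omega> u = sqrt (LINT x|lebesgue_on \<Omega>. (u x)\<^sup>2 + (norm (wgrad \<Omega> u x))\<^sup>2)"

definition H1_0 :: "'a::euclidean_space set \<Rightarrow> ('a \<Rightarrow> real) set" where
  "H1_0 \<Omega> = {u \<in> H1 \<Omega>. \<forall>\<epsilon>>0. \<exists>\<phi>\<in>C1_0 \<Omega>. H1_norm \<Omega> (\<lambda>x. u x - \<phi> x) < \<epsilon>}"

text \<open>\<open>0 powr 0 = 0\<close>, so for \<open>\<alpha> = 0\<close> the weight \<open>norm x powr \<alpha>\<close> differs from
  $|x|^\alpha = 1$ at the origin; it only occurs under integrals.\<close>

definition weak_solution ::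
    "'a::euclidean_space set \<Rightarrow> real \<Rightarrow> (real \<Rightarrow> real) \<Rightarrow> ('a \<Rightarrow> real) \<Rightarrow> bool" where
  "weak_solution \<Omega> \<alpha> f u \<longleftrightarrow> u \<in> H1_0 \<Omega> \<and>
     (\<forall>\<phi>\<in>C1_0 \<Omega>. integrable (lebesgue_on \<Omega>) (\<lambda>x. norm x powr \<alpha> * f (u x) * \<phi> x) \<and>
        (LINT x|lebesgue_on \<Omega>. wgrad \<Omega> u x \<bullet> grad \<phi> x) =
        (LINT x|lebesgue_on \<Omega>. norm x powr \<alpha> * f (u x) * \<phi> x))"

text \<open>For solutions, the pointwise notions below are applied to the continuous representative.\<close>

definition radial_on :: "'a::euclidean_space set \<Rightarrow> ('a \<Rightarrow> real) \<Rightarrow> bool" where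
  "radial_on \<Omega> u \<longleftrightarrow> (\<forall>x\<in>\<Omega>. \<forall>y\<in>\<Omega>. norm x = norm y \<longrightarrow> u x = u y)"

definition nodal_zones :: "'a::euclidean_space set \<Rightarrow> ('a \<Rightarrow> real) \<Rightarrow> 'a set set" where
  "nodal_zones \<Omega> u = components {x \<in> \<Omega>. u x \<noteq> 0}"

definition Qform ::
    "'a::euclidean_space set \<Rightarrow> real \<Rightarrow> (real \<Rightarrow> real) \<Rightarrow> ('a \<Rightarrow> real) \<Rightarrow> ('a \<Rightarrow> real) \<Rightarrow> real" where
  "Qform \<Omega> \<alpha> f' u \<psi> =
     (LINT x|lebesgue_on \<Omega>. (norm (wgrad \<Omega> \<psi> x))\<^sup>2 - norm x powr \<alpha> * f' (u x) * (\<psi> x)\<^sup>2)"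

definition fun_scale :: "real \<Rightarrow> ('a \<Rightarrow> real) \<Rightarrow> 'a \<Rightarrow> real" where
  "fun_scale c \<psi> = (\<lambda>x. c * \<psi> x)"

global_interpretation fun_vs: vector_space "fun_scale :: real \<Rightarrow> ('a \<Rightarrow> real) \<Rightarrow> 'a \<Rightarrow> real"
  by standard (auto simp: fun_scale_def algebra_simps)

text \<open>Subspaces are taken among representatives rather than a.e.-classes. This gives the same
  dimensions: a \<open>\<psi>\<close> vanishing a.e. on \<open>\<Omega>\<close> has \<open>Qform \<Omega> \<alpha> f' u \<psi> = 0\<close>, so a space \<open>W\<close> as below
  contains no such \<open>\<psi> \<noteq> 0\<close> and embeds into the space of classes; conversely, a finite-dimensional
  space of classes is lifted by choosing representatives of a basis. An infinite-dimensional
  negative definite subspace yields the value \<open>\<infinity>\<close> through its finite-dimensional subspaces.\<close>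

definition morse_index ::
    "'a::euclidean_space set \<Rightarrow> real \<Rightarrow> (real \<Rightarrow> real) \<Rightarrow> ('a \<Rightarrow> real) \<Rightarrow> enat" where
  "morse_index \<Omega> \<alpha> f' u =
     Sup {enat (fun_vs.dim W) |W. fun_vs.subspace W \<and> (\<exists>B. finite B \<and> fun_vs.span B = W) \<and>
            W \<subseteq> H1_0 \<Omega> \<and> (\<forall>\<psi>\<in>W. \<psi> \<noteq> 0 \<longrightarrow> Qform \<Omega> \<alpha> f' u \<psi> < 0)}"

end

theory Submission
  imports Defs "HOL-Real_Asymp.Real_Asymp"
begin

text \<open>Write \<open>u(x) = U(|x|)\<close>. The function \<open>\<zeta>(r) = r\<^sup>-\<^sup>\<alpha>\<^sup>/\<^sup>2 U'(r)\<close> solves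
  \<open>-(r\<^sup>N\<^sup>-\<^sup>1 \<zeta>')' + \<lambda> r\<^sup>N\<^sup>-\<^sup>3 \<zeta> = r\<^sup>N\<^sup>-\<^sup>1\<^sup>+\<^sup>\<alpha> f'(U) \<zeta>\<close> with
  \<open>\<lambda> = (\<alpha>/2 + 1)(\<alpha>/2 + N - 1)\<close>: this is the derivative of the equation after the substitution
  \<open>t = r\<^sup>1\<^sup>+\<^sup>\<alpha>\<^sup>/\<^sup>2\<close>, which makes it autonomous. Since \<open>u\<close> changes sign, \<open>U'\<close> has two
  consecutive zeros (the first one possibly at the centre of the ball). Cutting \<open>\<zeta>\<close> off
  between them and multiplying by a function \<open>Y\<close> on the sphere gives
  \<open>Q(\<zeta> Y) \<approx> (\<integral>|\<nabla>Y|\<^sup>2 - \<lambda> \<integral>Y\<^sup>2) \<integral>r\<^sup>N\<^sup>-\<^sup>3 \<zeta>\<^sup>2\<close>. Fix \<open>k\<close> functions \<open>Y\<close> with disjoint supports,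
  independent of \<open>\<alpha>\<close>; as \<open>\<lambda> \<rightarrow> \<infinity>\<close>, the form is negative on their span once \<open>\<alpha>\<close> is large.\<close>

section \<open>Functions of class \<open>C\<^sup>1\<close>\<close>

text \<open>\<open>u\<close> is only a weak solution and \<open>f'\<close> only a weak derivative,
  so the linear equation for \<zeta> is never written down pointwise. Instead \<open>picone\<close>
  computes the energy of \<open>zeta * g\<close> exactly, and its one integral with f'(U) is reduced
  to the definition of the weak derivative by the substitution y = U(r). That substitution needs U
  to be injective, which is why the test functions live between consecutive zeros of U'. With I the
  integral of (\<zeta> g)^2 r^(N-3) and J that of (\<zeta> g')^2 r^(N-1), the radial energy is
  exactly J - \<lambda> I. The cut-off \<open>g\<close> is affordable because \<zeta> vanishes at
  least linearly at both ends: J tends to 0 while I stays away from 0. What is extracted from the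
  nodal zones is a zero of U with nonzero values on both sides. The boundary condition, or the
  vanishing flux at the centre of a ball, then supplies a critical point on each side of that zero.
  As Y, functions of the angle to one fixed axis suffice; spherical harmonics are avoided.\<close>

definition is_C1 :: "('a::euclidean_space \<Rightarrow> real) \<Rightarrow> ('a \<Rightarrow> 'a) \<Rightarrow> bool" where
  "is_C1 \<phi> G \<longleftrightarrow> (\<forall>x. GDERIV \<phi> x :> G x) \<and> continuous_on UNIV G"

lemma is_C1_continuous: "is_C1 \<phi> G \<Longrightarrow> continuous_on S \<phi>"
  unfolding is_C1_def gderiv_def
  by (rule has_derivative_continuous_on[where f'="\<lambda>x h. inner h (G x)"]) (simp add: has_derivative_at_withinI)

lemma is_C1_continuous_grad: "is_C1 \<phi> G \<Longrightarrow> continuous_on S G"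
  unfolding is_C1_def by (rule continuous_on_subset) auto

lemma is_C1_const: "is_C1 (\<lambda>x. c) (\<lambda>x. 0)"
  by (simp add: is_C1_def GDERIV_const)

lemma is_C1_inner: "is_C1 (\<lambda>x. inner x b) (\<lambda>x. b)"
  by (auto simp: is_C1_def gderiv_def intro!: derivative_eq_intros)

lemma is_C1_mult:
  assumes "is_C1 f F" "is_C1 g G"
  shows "is_C1 (\<lambda>x. f x * g x) (\<lambda>x. f x *\<^sub>R G x + g x *\<^sub>R F x)"
  using assms is_C1_continuous[OF assms(1), of UNIV] is_C1_continuous[OF assms(2), of UNIV]
  unfolding is_C1_def by (auto intro!: GDERIV_mult continuous_intros)

lemma is_C1_compose:
  assumes "is_C1 f F" "\<And>x. (h has_real_derivative h' (f x)) (at (f x))" "continuous_on (range f) h'"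
  shows "is_C1 (\<lambda>x. h (f x)) (\<lambda>x. h' (f x) *\<^sub>R F x)"
proof -
  have "continuous_on UNIV (\<lambda>x. h' (f x))"
    using continuous_on_compose2[OF assms(3) is_C1_continuous[OF assms(1)]] by auto
  then show ?thesis
    using assms unfolding is_C1_def by (auto intro!: GDERIV_DERIV_compose[where g=h] continuous_intros)
qed

lemma GDERIV_cong_open:
  assumes "GDERIV f x :> D" "open S" "x \<in> S" "\<And>y. y \<in> S \<Longrightarrow> f y = g y"
  shows "GDERIV g x :> D"
  using assms has_derivative_transform_within_open unfolding gderiv_def by blast

lemma GDERIV_imp_grad: "GDERIV \<phi> x :> D \<Longrightarrow> grad \<phi> x = D"
  unfolding grad_def gderiv_def
  by (subst frechet_derivative_at[symmetric], assumption) (simp add: inner_commute[of _ D] euclidean_representation)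

lemma GDERIV_grad:
  assumes "\<phi> differentiable at x"
  shows "GDERIV \<phi> x :> grad \<phi> x"
proof -
  let ?D = "frechet_derivative \<phi> (at x)"
  have D: "(\<phi> has_derivative ?D) (at x)" using assms by (simp add: frechet_derivative_works)
  then have lin: "linear ?D" by (rule has_derivative_linear)
  have "?D = (\<lambda>h. inner h (grad \<phi> x))"
  proof
    fix h
    have "?D h = ?D (\<Sum>b\<in>Basis. (h \<bullet> b) *\<^sub>R b)" by (simp add: euclidean_representation)
    also have "\<dots> = (\<Sum>b\<in>Basis. (h \<bullet> b) * ?D b)"
      using lin by (simp add: linear_sum linear_scale)
    finally show "?D h = inner h (grad \<phi> x)" by (simp add: grad_def inner_sum_right mult.commute)
  qed
  then show ?thesis using D by (simp add: gderiv_def)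
qed

lemma is_C1_imp_grad: "is_C1 \<phi> G \<Longrightarrow> grad \<phi> = G"
  by (auto simp: is_C1_def intro!: GDERIV_imp_grad)

lemma C1_0_D:
  assumes "\<phi> \<in> C1_0 \<Omega>"
  shows "is_C1 \<phi> (grad \<phi>)" "compact (closure {x. \<phi> x \<noteq> 0})" "closure {x. \<phi> x \<noteq> 0} \<subseteq> \<Omega>"
  using assms by (auto simp: C1_0_def is_C1_def GDERIV_grad)

lemma C1_0_I:
  assumes "is_C1 \<phi> G" "compact K" "K \<subseteq> \<Omega>" "\<And>x. x \<notin> K \<Longrightarrow> \<phi> x = 0"
  shows "\<phi> \<in> C1_0 \<Omega>"
proof -
  have "closure {x. \<phi> x \<noteq> 0} \<subseteq> K"
    using assms by (intro closure_minimal) (auto simp: compact_imp_closed)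
  moreover have "compact (closure {x. \<phi> x \<noteq> 0})"
    using calculation assms(2) by (meson bounded_subset closed_closure compact_eq_bounded_closed)
  moreover have "\<phi> differentiable at x" for x
    using assms(1) by (auto simp: is_C1_def gderiv_def differentiable_def)
  ultimately show ?thesis
    using assms is_C1_imp_grad[OF assms(1)] by (auto simp: C1_0_def is_C1_def)
qed

lemma zero_outside_support:
  assumes "x \<notin> closure {x. \<phi> x \<noteq> 0}"
  shows "\<phi> x = 0"
  using assms subsetD[OF closure_subset, of x "{x. \<phi> x \<noteq> 0}"] by (simp only: mem_Collect_eq) argo

lemma grad_zero_outside:
  assumes "x \<notin> closure {x. \<phi> x \<noteq> 0}"
  shows "grad \<phi> x = 0"
proof -
  have "GDERIV \<phi> x :> 0"
  proof (rule GDERIV_cong_open[OF GDERIV_const[of 0 x]])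
    show "x \<in> - closure {x. \<phi> x \<noteq> 0}" using assms by simp
    show "0 = \<phi> y" if "y \<in> - closure {x. \<phi> x \<noteq> 0}" for y
      using zero_outside_support[of y \<phi>] that by simp
  qed auto
  then show ?thesis by (rule GDERIV_imp_grad)
qed

lemma C1_0_mult:
  assumes "\<phi> \<in> C1_0 \<Omega>" "is_C1 \<psi> G"
  shows "(\<lambda>x. \<phi> x * \<psi> x) \<in> C1_0 \<Omega>"
proof (rule C1_0_I[OF is_C1_mult[OF C1_0_D(1)[OF assms(1)] assms(2)] C1_0_D(2)[OF assms(1)] C1_0_D(3)[OF assms(1)]])
  fix x assume "x \<notin> closure {x. \<phi> x \<noteq> 0}"
  then have "\<phi> x = 0" by (rule zero_outside_support)
  then show "\<phi> x * \<psi> x = 0" by simp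
qed

section \<open>Integrals of gradients of test functions, and integration by parts\<close>

lemma lborel_integral_translate:
  fixes f :: "'a::euclidean_space \<Rightarrow> 'b::{banach, second_countable_topology}"
  assumes [measurable]: "f \<in> borel_measurable borel"
  shows "(LINT x|lborel. f (c + x)) = (LINT x|lborel. f x)"
proof -
  have "(LINT x|lborel. f x) = (LINT x|distr lborel borel ((+) c). f x)"
    by (simp add: lborel_distr_plus)
  also have "\<dots> = (LINT x|lborel. f (c + x))"
    by (rule integral_distr) auto
  finally show ?thesis by simp
qed

lemma lborel_integrable_translate:
  fixes f :: "'a::euclidean_space \<Rightarrow> 'b::{banach, second_countable_topology}"
  assumes "integrable lborel f"
  shows "integrable lborel (\<lambda>x. f (c + x))"
proof -
  have [measurable]: "f \<in> borel_measurable borel" using assms by auto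
  have "integrable (distr lborel borel ((+) c)) f" using assms by (simp add: lborel_distr_plus)
  then show ?thesis by (subst (asm) integrable_distr_eq) auto
qed

lemma integrable_continuous_compact_support:
  fixes f :: "'a::euclidean_space \<Rightarrow> 'b::{banach, second_countable_topology}"
  assumes "continuous_on UNIV f" "compact K" "\<And>x. x \<notin> K \<Longrightarrow> f x = 0"
  shows "integrable lborel f"
proof -
  have "(\<lambda>x. indicator K x *\<^sub>R f x) = f" using assms(3) by (auto simp: indicator_def)
  then show ?thesis
    using borel_integrable_compact[OF assms(2) continuous_on_subset[OF assms(1)]] by simp
qed

lemma integrable_C1_0:
  assumes "\<phi> \<in> C1_0 \<Omega>"
  shows "integrable lborel \<phi>" "integrable lborel (grad \<phi>)"
proof -
  note D = C1_0_D[OF assms]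
  show "integrable lborel \<phi>"
    by (rule integrable_continuous_compact_support[OF is_C1_continuous[OF D(1)] D(2)])
      (rule zero_outside_support)
  show "integrable lborel (grad \<phi>)"
    by (rule integrable_continuous_compact_support[OF is_C1_continuous_grad[OF D(1)] D(2)])
      (rule grad_zero_outside)
qed

text \<open>The integral of a difference quotient vanishes by translation invariance.\<close>

lemma integral_grad_C1_0:
  assumes "\<phi> \<in> C1_0 \<Omega>"
  shows "(LINT x|lborel. grad \<phi> x) = 0"
proof -
  note D = C1_0_D[OF assms]
  note int = integrable_C1_0[OF assms]
  define K where "K = closure {x. \<phi> x \<noteq> 0}"
  have K: "compact K" "\<And>x. x \<notin> K \<Longrightarrow> \<phi> x = 0" "\<And>x. x \<notin> K \<Longrightarrow> grad \<phi> x = 0"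
    unfolding K_def by (rule D(2), erule zero_outside_support, erule grad_zero_outside)
  have cg: "continuous_on UNIV (grad \<phi>)" by (rule is_C1_continuous_grad[OF D(1)])
  have "bounded (grad \<phi> ` K)"
    by (rule compact_imp_bounded[OF compact_continuous_image[OF continuous_on_subset[OF cg] K(1)]]) auto
  then obtain M where "M > 0" and M: "\<And>x. x \<in> K \<Longrightarrow> norm (grad \<phi> x) \<le> M"
    by (auto simp: bounded_pos)
  then have M': "norm (grad \<phi> x) \<le> M" for x using K(3)[of x] by (cases "x \<in> K") auto
  \<comment> \<open>The mean value bound on the difference quotients gives the constant majorant
    \<open>M\<close> for dominated convergence.\<close>
  have lip: "\<bar>\<phi> y - \<phi> x\<bar> \<le> M * norm (y - x)" for x y
  proof -
    have "norm (\<phi> y - \<phi> x) \<le> M * norm (y - x)"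
    proof (rule differentiable_bound[where S=UNIV])
      show "(\<phi> has_derivative (\<lambda>h. h \<bullet> grad \<phi> z)) (at z within UNIV)" for z
        using D(1) by (auto simp: is_C1_def gderiv_def)
      show "onorm (\<lambda>h. h \<bullet> grad \<phi> z) \<le> M" for z
        by (rule onorm_bound)
          (use \<open>M > 0\<close> M' in \<open>auto intro!: order_trans[OF Cauchy_Schwarz_ineq2] mult_left_mono simp: mult.commute[of M]\<close>)
    qed auto
    then show ?thesis by simp
  qed
  have comp: "(LINT x|lborel. grad \<phi> x \<bullet> b) = 0" if b: "b \<in> Basis" for b
  proof -
    \<comment> \<open>All shifts have length at most 1, so every difference quotient is supported in
      the unit neighbourhood \<open>K1\<close> of the support.\<close>
    define K1 where "K1 = {x + y |x y. x \<in> K \<and> y \<in> cball 0 (1::real)}"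
    have K1: "compact K1"
      unfolding K1_def by (rule compact_sums[OF K(1) compact_cball])
    define h where "h n = inverse (real (Suc n))" for n
    define s where "s n x = (\<phi> (h n *\<^sub>R b + x) - \<phi> x) / h n" for n x
    have h: "h n > 0" "h n \<le> 1" for n by (auto simp: h_def field_simps)
    have h0: "h \<longlonglongrightarrow> 0" unfolding h_def by (rule LIMSEQ_inverse_real_of_nat)
    have cont: "continuous_on UNIV \<phi>" by (rule is_C1_continuous[OF D(1)])
    have [measurable]: "\<phi> \<in> borel_measurable borel" "grad \<phi> \<in> borel_measurable borel"
      using cont cg by (auto intro: borel_measurable_continuous_onI)
    have "(\<lambda>n. LINT x|lborel. s n x) \<longlonglongrightarrow> (LINT x|lborel. grad \<phi> x \<bullet> b)"
    proof (rule integral_dominated_convergence[where w="\<lambda>x. indicator K1 x * M"])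
      show "integrable lborel (\<lambda>x. indicator K1 x * M)"
        using borel_integrable_compact[OF K1, of "\<lambda>x. M"] by simp
      show "AE x in lborel. (\<lambda>n. s n x) \<longlonglongrightarrow> grad \<phi> x \<bullet> b"
      proof (rule AE_I2)
        fix x
        have "(\<phi> has_derivative (\<lambda>h. h \<bullet> grad \<phi> x)) (at x)"
          using D(1) by (auto simp: is_C1_def gderiv_def)
        moreover have "((\<lambda>t. t *\<^sub>R b + x) has_derivative (\<lambda>t. t *\<^sub>R b)) (at 0)"
          by (auto intro!: derivative_eq_intros)
        ultimately have "((\<lambda>t. \<phi> (t *\<^sub>R b + x)) has_derivative (\<lambda>t. (t *\<^sub>R b) \<bullet> grad \<phi> x)) (at 0)"
          using has_derivative_compose[of "\<lambda>t. t *\<^sub>R b + x" "\<lambda>t. t *\<^sub>R b" 0 UNIV \<phi> "\<lambda>h. h \<bullet> grad \<phi> x"] by simp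
        then have "((\<lambda>t. \<phi> (t *\<^sub>R b + x)) has_real_derivative (grad \<phi> x \<bullet> b)) (at 0)"
          by (simp add: has_field_derivative_def inner_commute mult.commute[of _ "b \<bullet> _"])
        then have "((\<lambda>t. (\<phi> (t *\<^sub>R b + x) - \<phi> x) / t) \<longlongrightarrow> grad \<phi> x \<bullet> b) (at 0)"
          by (simp add: DERIV_def)
        moreover have "filterlim h (at 0) sequentially"
          using h0 h(1) by (intro filterlim_atI) (auto simp: less_imp_neq[symmetric] intro!: always_eventually) 
        ultimately show "(\<lambda>n. s n x) \<longlonglongrightarrow> grad \<phi> x \<bullet> b"
          unfolding s_def by (rule filterlim_compose)
      qed
      show "AE x in lborel. norm (s n x) \<le> indicator K1 x * M" for n
      proof (rule AE_I2)
        fix x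
        show "norm (s n x) \<le> indicator K1 x * M"
        proof (cases "x \<in> K1")
          case True
          have "\<bar>\<phi> (h n *\<^sub>R b + x) - \<phi> x\<bar> \<le> M * h n"
            using lip[of "h n *\<^sub>R b + x" x] h[of n] b by simp
          then show ?thesis using True h[of n] by (simp add: s_def field_simps)
        next
          case False
          have "x \<notin> K" using False by (force simp: K1_def)
          moreover have "h n *\<^sub>R b + x \<notin> K"
          proof
            assume "h n *\<^sub>R b + x \<in> K"
            moreover have "- (h n *\<^sub>R b) \<in> cball 0 1" using h[of n] b by simp
            moreover have "x = (h n *\<^sub>R b + x) + - (h n *\<^sub>R b)" by simp
            ultimately have "x \<in> K1" unfolding K1_def by blast
            then show False using False by simp
          qed
          ultimately show ?thesis using False K(2) by (simp add: s_def)
        qed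
      qed
    qed (auto simp: s_def)
    moreover have "(LINT x|lborel. s n x) = 0" for n
    proof -
      have "(LINT x|lborel. s n x) = (LINT x|lborel. \<phi> (h n *\<^sub>R b + x) - \<phi> x) / h n"
        by (simp add: s_def)
      also have "(LINT x|lborel. \<phi> (h n *\<^sub>R b + x) - \<phi> x) = 0"
        using lborel_integrable_translate[OF int(1), of "h n *\<^sub>R b"] int(1)
        by (simp add: lborel_integral_translate)
      finally show ?thesis by simp
    qed
    ultimately show ?thesis by (simp add: LIMSEQ_const_iff)
  qed
  show ?thesis
  proof (rule euclidean_eqI)
    fix b :: 'a assume b: "b \<in> Basis"
    show "(LINT x|lborel. grad \<phi> x) \<bullet> b = 0 \<bullet> b"
      using comp[OF b] int(2) by simp
  qed
qed

text \<open>Bridges two measures: the definitions integrate against completed Lebesgue measure on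
  \<Omega>, the translation argument against \<open>lborel\<close>.\<close>

lemma lebesgue_on_eq_lborel:
  fixes f :: "'a::euclidean_space \<Rightarrow> 'b::{banach, second_countable_topology}"
  assumes "\<Omega> \<in> sets lebesgue" "f \<in> borel_measurable borel" "\<And>x. x \<notin> \<Omega> \<Longrightarrow> f x = 0"
  shows "(LINT x|lebesgue_on \<Omega>. f x) = (LINT x|lborel. f x)"
    "integrable (lebesgue_on \<Omega>) f \<longleftrightarrow> integrable lborel f"
proof -
  have *: "(\<lambda>x. indicator \<Omega> x *\<^sub>R f x) = f" using assms(3) by (auto simp: indicator_def)
  show "(LINT x|lebesgue_on \<Omega>. f x) = (LINT x|lborel. f x)"
    using assms(1,2) by (subst integral_restrict_space) (auto simp: * integral_completion)
  show "integrable (lebesgue_on \<Omega>) f \<longleftrightarrow> integrable lborel f"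
    using assms(1,2) by (subst integrable_restrict_space) (auto simp: * integrable_completion)
qed

text \<open>The product of a test function with any C^1 function is again a test function, so the
  integral of its gradient vanishes; the product rule does the rest. \<open>\<psi>\<close> may be
  nonzero at the boundary, which \<open>H1_0_integration_by_parts\<close> relies on.\<close>

lemma C1_0_integration_by_parts:
  assumes \<phi>: "\<phi> \<in> C1_0 \<Omega>" and \<psi>: "is_C1 \<psi> G" and \<Omega>: "\<Omega> \<in> sets lebesgue"
  shows "integrable (lebesgue_on \<Omega>) (\<lambda>x. \<phi> x *\<^sub>R G x)"
    "integrable (lebesgue_on \<Omega>) (\<lambda>x. \<psi> x *\<^sub>R grad \<phi> x)"
    "(LINT x|lebesgue_on \<Omega>. \<phi> x *\<^sub>R G x) = - (LINT x|lebesgue_on \<Omega>. \<psi> x *\<^sub>R grad \<phi> x)"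
proof -
  note D = C1_0_D[OF \<phi>]
  have z: "\<phi> x = 0" "grad \<phi> x = 0" if "x \<notin> closure {x. \<phi> x \<noteq> 0}" for x
    using that by (auto intro: zero_outside_support grad_zero_outside)
  have c: "continuous_on UNIV \<phi>" "continuous_on UNIV (grad \<phi>)" "continuous_on UNIV \<psi>" "continuous_on UNIV G"
    using D(1) \<psi> is_C1_continuous is_C1_continuous_grad by auto
  have i1: "integrable lborel (\<lambda>x. \<phi> x *\<^sub>R G x)"
    by (rule integrable_continuous_compact_support[OF _ D(2)]) (intro continuous_on_scaleR c, drule z(1), simp)
  have i2: "integrable lborel (\<lambda>x. \<psi> x *\<^sub>R grad \<phi> x)"
    by (rule integrable_continuous_compact_support[OF _ D(2)]) (intro continuous_on_scaleR c, drule z(2), simp)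
  have z': "\<phi> x = 0" "grad \<phi> x = 0" if "x \<notin> \<Omega>" for x using z[of x] that D(3) by blast+
  note m = borel_measurable_integrable[OF i1, simplified] borel_measurable_integrable[OF i2, simplified]
  show "integrable (lebesgue_on \<Omega>) (\<lambda>x. \<phi> x *\<^sub>R G x)"
    using i1 by (subst lebesgue_on_eq_lborel(2)[OF \<Omega> m(1)]) (auto simp: z')
  show "integrable (lebesgue_on \<Omega>) (\<lambda>x. \<psi> x *\<^sub>R grad \<phi> x)"
    using i2 by (subst lebesgue_on_eq_lborel(2)[OF \<Omega> m(2)]) (auto simp: z')
  have "0 = (LINT x|lborel. grad (\<lambda>x. \<phi> x * \<psi> x) x)"
    using integral_grad_C1_0[OF C1_0_mult[OF \<phi> \<psi>]] by simp
  also have "\<dots> = (LINT x|lborel. \<phi> x *\<^sub>R G x + \<psi> x *\<^sub>R grad \<phi> x)"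
    by (simp add: is_C1_imp_grad[OF is_C1_mult[OF D(1) \<psi>]])
  also have "\<dots> = (LINT x|lborel. \<phi> x *\<^sub>R G x) + (LINT x|lborel. \<psi> x *\<^sub>R grad \<phi> x)"
    using i1 i2 by simp
  also have "\<dots> = (LINT x|lebesgue_on \<Omega>. \<phi> x *\<^sub>R G x) + (LINT x|lebesgue_on \<Omega>. \<psi> x *\<^sub>R grad \<phi> x)"
    using lebesgue_on_eq_lborel(1)[OF \<Omega> m(1)] lebesgue_on_eq_lborel(1)[OF \<Omega> m(2)] by (simp add: z')
  finally show "(LINT x|lebesgue_on \<Omega>. \<phi> x *\<^sub>R G x) = - (LINT x|lebesgue_on \<Omega>. \<psi> x *\<^sub>R grad \<phi> x)"
    by (simp add: eq_neg_iff_add_eq_0)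
qed

lemma locally_integrable_continuous:
  assumes "continuous_on UNIV f" shows "locally_integrable \<Omega> f"
  unfolding locally_integrable_def
proof (intro allI impI)
  fix K assume K: "compact K \<and> K \<subseteq> \<Omega>"
  have "integrable lborel (\<lambda>x. indicator K x *\<^sub>R f x)"
    using K continuous_on_subset[OF assms] by (intro borel_integrable_compact) auto
  then have "integrable lebesgue (\<lambda>x. indicator K x *\<^sub>R f x)"
    by (subst integrable_completion) auto
  then show "integrable (lebesgue_on K) f"
    using K by (subst integrable_restrict_space) (auto simp: compact_imp_closed)
qed

lemma C1_0_has_weak_gradient:
  assumes "\<phi> \<in> C1_0 \<Omega>" "\<Omega> \<in> sets lebesgue"
  shows "has_weak_gradient \<Omega> \<phi> (grad \<phi>)"
  unfolding has_weak_gradient_def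
  using C1_0_D(1)[OF assms(1)] C1_0_integration_by_parts(3)[OF assms(1) C1_0_D(1) assms(2)]
  by (auto intro!: locally_integrable_continuous is_C1_continuous is_C1_continuous_grad)

section \<open>Weak gradients\<close>

text \<open>The squared positive part is the elementary C^1 cut-off: ball bumps, boundary layers,
  \<open>smooth_step\<close> and the angular bumps are all built from it.\<close>

lemma DERIV_pospart_square: "((\<lambda>t::real. (max 0 t)\<^sup>2) has_real_derivative 2 * max 0 t) (at t)"
proof -
  consider "t < 0" | "t > 0" | "t = 0" by linarith
  then show ?thesis
  proof cases
    case 1
    have "((\<lambda>t. 0) has_real_derivative 2 * max 0 t) (at t)" using 1 by simp
    then show ?thesis
      by (rule has_field_derivative_transform_within_open[of _ _ _ "{..<0}"]) (use 1 in auto)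
  next
    case 2
    have "((\<lambda>t. t\<^sup>2) has_real_derivative 2 * max 0 t) (at t)" using 2 by (auto intro!: derivative_eq_intros)
    then show ?thesis
      by (rule has_field_derivative_transform_within_open[of _ _ _ "{0<..}"]) (use 2 in auto)
  next
    case 3
    have "((\<lambda>h::real. \<bar>h\<bar>) \<longlongrightarrow> 0) (at 0)" by (auto intro!: tendsto_eq_intros)
    then have "((\<lambda>h::real. (max 0 h)\<^sup>2 / h) \<longlongrightarrow> 0) (at 0)"
      by (rule Lim_null_comparison[rotated]) (auto intro!: always_eventually simp: max_def power2_eq_square)
    then show ?thesis using 3 by (simp add: DERIV_def)
  qed
qed

lemma is_C1_ball_bump:
  "is_C1 (\<lambda>x. (max 0 (R\<^sup>2 - (norm (x - c))\<^sup>2))\<^sup>2) (\<lambda>x. (2 * max 0 (R\<^sup>2 - (norm (x - c))\<^sup>2)) *\<^sub>R (- 2 *\<^sub>R (x - c)))"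
proof (rule is_C1_compose[where h="\<lambda>t. (max 0 t)\<^sup>2" and h'="\<lambda>t. 2 * max 0 t"])
  show "is_C1 (\<lambda>x. R\<^sup>2 - (norm (x - c))\<^sup>2) (\<lambda>x. - 2 *\<^sub>R (x - c))"
    unfolding is_C1_def gderiv_def power2_norm_eq_inner
    by (auto intro!: derivative_eq_intros continuous_intros simp: inner_commute algebra_simps)
  show "((\<lambda>t. (max 0 t)\<^sup>2) has_real_derivative 2 * max 0 t) (at t)" for t :: real
    by (rule DERIV_pospart_square)
qed (auto intro!: continuous_intros)

lemma ball_bump_pos_iff:
  assumes "R > 0"
  shows "0 < (max 0 (R\<^sup>2 - (norm (x - c))\<^sup>2))\<^sup>2 \<longleftrightarrow> x \<in> ball c R"
proof -
  have "norm (x - c) < R \<longleftrightarrow> (norm (x - c))\<^sup>2 < R\<^sup>2"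
    using assms power2_less_imp_less[of "norm (x - c)" R] power_strict_mono[of "norm (x - c)" R 2] by auto
  then show ?thesis by (auto simp: dist_norm norm_minus_commute max_def)
qed

text \<open>Holds because Lebesgue measure is complete. It is needed since \<open>wgrad\<close> is
  an arbitrary choice, known only up to null sets.\<close>

lemma borel_measurable_lebesgue_on_AE:
  fixes f :: "'a::euclidean_space \<Rightarrow> 'b::euclidean_space"
  assumes "f \<in> borel_measurable (lebesgue_on \<Omega>)" "AE x in lebesgue_on \<Omega>. f x = g x" "\<Omega> \<in> sets lebesgue"
  shows "g \<in> borel_measurable (lebesgue_on \<Omega>)"
proof -
  have "(\<lambda>x. indicator \<Omega> x *\<^sub>R f x) \<in> borel_measurable lebesgue"
    using assms by (subst (asm) borel_measurable_restrict_space_iff) auto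
  moreover have "AE x in lebesgue. indicator \<Omega> x *\<^sub>R f x = indicator \<Omega> x *\<^sub>R g x"
    using assms(2,3) by (subst (asm) AE_restrict_space_iff) (auto simp: indicator_def)
  ultimately have "(\<lambda>x. indicator \<Omega> x *\<^sub>R g x) \<in> borel_measurable lebesgue"
    by (rule borel_measurable_AE)
  then show ?thesis
    using assms(3) by (subst borel_measurable_restrict_space_iff) auto
qed

section \<open>Test functions determine locally integrable functions\<close>

lemma integrable_C0_scaleR:
  fixes k :: "'a::euclidean_space \<Rightarrow> real" and v :: "'a \<Rightarrow> 'b::euclidean_space"
  assumes "locally_integrable \<Omega> v" "\<Omega> \<in> sets lebesgue" "continuous_on UNIV k"
    "compact K" "K \<subseteq> \<Omega>" "\<And>x. x \<notin> K \<Longrightarrow> k x = 0"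
  shows "integrable (lebesgue_on \<Omega>) (\<lambda>x. k x *\<^sub>R v x)"
proof -
  have K: "K \<in> sets lebesgue" using assms(4) by (auto simp: compact_imp_closed)
  have "integrable (lebesgue_on K) v" using assms unfolding locally_integrable_def by auto
  then have i: "integrable lebesgue (\<lambda>x. indicator K x *\<^sub>R v x)"
    using K by (subst (asm) integrable_restrict_space) auto
  obtain C where C: "\<And>x. x \<in> K \<Longrightarrow> norm (k x) \<le> C"
    using compact_imp_bounded[OF compact_continuous_image[OF continuous_on_subset[OF assms(3)] assms(4)]]
    by (auto simp: bounded_iff)
  have k: "k \<in> borel_measurable lebesgue"
    using borel_measurable_continuous_onI[OF assms(3)] by (intro measurable_completion) simp
  have "integrable lebesgue (\<lambda>x. k x *\<^sub>R (indicator K x *\<^sub>R v x))"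
  proof (rule Bochner_Integration.integrable_bound)
    show "integrable lebesgue (\<lambda>x. C *\<^sub>R norm (indicator K x *\<^sub>R v x))"
      using i by (intro integrable_scaleR_right integrable_norm)
    show "(\<lambda>x. k x *\<^sub>R indicator K x *\<^sub>R v x) \<in> borel_measurable lebesgue"
      by (rule borel_measurable_scaleR[OF k borel_measurable_integrable[OF i]])
    have "\<bar>k x\<bar> * norm (v x) \<le> \<bar>C\<bar> * norm (v x)" if "x \<in> K" for x
      using C[OF that] by (intro mult_right_mono) auto
    then show "AE x in lebesgue. norm (k x *\<^sub>R indicator K x *\<^sub>R v x) \<le> norm (C *\<^sub>R norm (indicator K x *\<^sub>R v x))"
      by (intro AE_I2) (auto simp: indicator_def abs_mult)
  qed
  moreover have "(\<lambda>x. k x *\<^sub>R (indicator K x *\<^sub>R v x)) = (\<lambda>x. indicator \<Omega> x *\<^sub>R (k x *\<^sub>R v x))"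
    using assms(5,6) by (auto simp: indicator_def fun_eq_iff)
  ultimately show ?thesis using assms(2) by (subst integrable_restrict_space) auto
qed

lemma integrable_scaleR_C0:
  fixes k :: "'a::euclidean_space \<Rightarrow> 'b::euclidean_space" and v :: "'a \<Rightarrow> real"
  assumes "locally_integrable \<Omega> v" "\<Omega> \<in> sets lebesgue" "continuous_on UNIV k"
    "compact K" "K \<subseteq> \<Omega>" "\<And>x. x \<notin> K \<Longrightarrow> k x = 0"
  shows "integrable (lebesgue_on \<Omega>) (\<lambda>x. v x *\<^sub>R k x)"
proof -
  have "integrable (lebesgue_on \<Omega>) (\<lambda>x. \<Sum>b\<in>Basis. ((k x \<bullet> b) *\<^sub>R v x) *\<^sub>R b)"
    using assms by (intro Bochner_Integration.integrable_sum integrable_scaleR_left integrable_C0_scaleR[where K=K])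
      (auto intro!: continuous_intros)
  moreover have "(\<Sum>b\<in>Basis. ((k x \<bullet> b) *\<^sub>R v x) *\<^sub>R b) = v x *\<^sub>R k x" for x
  proof -
    have "v x *\<^sub>R k x = v x *\<^sub>R (\<Sum>b\<in>Basis. (k x \<bullet> b) *\<^sub>R b)" by (simp add: euclidean_representation)
    then show ?thesis by (simp add: scaleR_sum_right mult.commute)
  qed
  ultimately show ?thesis by simp
qed

lemma integrable_C1_0_local:
  assumes "\<phi> \<in> C1_0 \<Omega>" "\<Omega> \<in> sets lebesgue"
  shows "locally_integrable \<Omega> v \<Longrightarrow> integrable (lebesgue_on \<Omega>) (\<lambda>x. \<phi> x *\<^sub>R (v x :: 'b::euclidean_space))"
    "locally_integrable \<Omega> u \<Longrightarrow> integrable (lebesgue_on \<Omega>) (\<lambda>x. u x *\<^sub>R grad \<phi> x)"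
  by (rule integrable_C0_scaleR integrable_scaleR_C0;
      (rule assms C1_0_D[OF assms(1)] is_C1_continuous[OF C1_0_D(1)[OF assms(1)]]
        is_C1_continuous_grad[OF C1_0_D(1)[OF assms(1)]] | assumption |
       erule zero_outside_support grad_zero_outside))+

text \<open>A generator of the Borel sets tailored to test functions: the indicator of such a set is
  an increasing limit of C^1 functions, and products of the \<open>q\<close> make the family closed
  under intersection.\<close>

definition C1_positivity_sets :: "'a::euclidean_space set set" where
  "C1_positivity_sets = {{x. 0 < q x} |q. (\<forall>x. 0 \<le> q x) \<and> (\<exists>Q. is_C1 q Q)}"

text \<open>Balls are positivity sets of bumps, and by Lindelof every open set is a countable union
  of balls.\<close>

lemma sigma_sets_C1_positivity_sets:
  "sigma_sets UNIV C1_positivity_sets = sets (borel :: 'a::euclidean_space measure)"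
proof
  have ball: "ball c R \<in> C1_positivity_sets" if "R > 0" for c :: 'a and R
  proof -
    have "ball c R = {x. 0 < (max 0 (R\<^sup>2 - (norm (x - c))\<^sup>2))\<^sup>2}"
      using ball_bump_pos_iff[OF that] by blast
    then show ?thesis unfolding C1_positivity_sets_def
      using is_C1_ball_bump[of R c]
      by (intro CollectI exI[of _ "\<lambda>x. (max 0 (R\<^sup>2 - (norm (x - c))\<^sup>2))\<^sup>2"]) (blast intro: zero_le_power2)
  qed
  have op: "S \<in> sigma_sets UNIV C1_positivity_sets" if "open S" for S :: "'a set"
  proof -
    let ?F = "{ball c R |c R. R > 0 \<and> ball c R \<subseteq> S}"
    obtain F' where F': "F' \<subseteq> ?F" "countable F'" "\<Union>F' = \<Union>?F"
      by (rule Lindelof[of ?F]) auto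
    have "\<Union>?F = S"
    proof
      show "S \<subseteq> \<Union>?F"
      proof
        fix x assume "x \<in> S"
        then obtain R where "R > 0" "ball x R \<subseteq> S" using \<open>open S\<close> open_contains_ball by blast
        then show "x \<in> \<Union>?F" by (intro UnionI[of "ball x R"]) auto
      qed
    qed auto
    moreover have "\<Union>F' \<in> sigma_sets UNIV C1_positivity_sets"
      using F' ball by (intro sigma_sets_UNION) (auto intro: sigma_sets.Basic)
    ultimately show ?thesis using F' by simp
  qed
  show "sets borel \<subseteq> sigma_sets UNIV (C1_positivity_sets :: 'a set set)"
    unfolding borel_def using op by (subst sets_measure_of) (auto intro!: sigma_sets_mono)
  show "sigma_sets UNIV C1_positivity_sets \<subseteq> sets (borel :: 'a measure)"
  proof -
    have "{x. 0 < q x} \<in> sets borel" if "is_C1 q Q" for q :: "'a \<Rightarrow> real" and Q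
      using is_C1_continuous[OF that, of UNIV] by (intro borel_open open_Collect_less) auto
    then have "C1_positivity_sets \<subseteq> sets (borel :: 'a measure)" by (auto simp: C1_positivity_sets_def)
    then show ?thesis using sets.sigma_sets_subset[of C1_positivity_sets "borel :: 'a measure"] by simp
  qed
qed

lemma Int_stable_C1_positivity_sets: "Int_stable (C1_positivity_sets :: 'a::euclidean_space set set)"
proof (rule Int_stableI)
  fix A B :: "'a set" assume "A \<in> C1_positivity_sets" "B \<in> C1_positivity_sets"
  then obtain p P q Q where "A = {x. 0 < p x}" "B = {x. 0 < q x}" "is_C1 p P" "is_C1 q Q"
    "\<And>x. 0 \<le> p x" "\<And>x. 0 \<le> q x" by (auto simp: C1_positivity_sets_def)
  then have "A \<inter> B = {x. 0 < p x * q x}" "is_C1 (\<lambda>x. p x * q x) (\<lambda>x. p x *\<^sub>R Q x + q x *\<^sub>R P x)"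
    "\<And>x. 0 \<le> p x * q x"
    by (auto simp: is_C1_mult) (metis less_eq_real_def mult_zero_left mult_zero_right zero_less_mult_iff)+
  then show "A \<inter> B \<in> C1_positivity_sets" unfolding C1_positivity_sets_def
    by (intro CollectI exI[of _ "\<lambda>x. p x * q x"]) auto
qed

text \<open>The indicator of \<open>{q > 0}\<close> is the limit of the test functions \<open>k q / (1 + k q)\<close>.\<close>

lemma AE_zero_ball:
  fixes w :: "'a::euclidean_space \<Rightarrow> real"
  assumes \<Omega>: "\<Omega> \<in> sets lebesgue" and w: "locally_integrable \<Omega> w"
    and test: "\<And>\<phi>. \<phi> \<in> C1_0 \<Omega> \<Longrightarrow> (LINT x|lebesgue_on \<Omega>. \<phi> x * w x) = 0"
    and sub: "cball c R \<subseteq> \<Omega>" and R: "R > 0"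
  shows "AE x in lebesgue. x \<in> ball c R \<longrightarrow> w x = 0"
proof -
  let ?B = "ball c R"
  define b where "b x = (max 0 (R\<^sup>2 - (norm (x - c))\<^sup>2))\<^sup>2" for x
  have b: "is_C1 b (\<lambda>x. (2 * max 0 (R\<^sup>2 - (norm (x - c))\<^sup>2)) *\<^sub>R (- 2 *\<^sub>R (x - c)))"
    unfolding b_def by (rule is_C1_ball_bump)
  have bpos: "0 < b x \<longleftrightarrow> x \<in> ?B" "0 \<le> b x" for x
    unfolding b_def by (rule ball_bump_pos_iff[OF R]) simp
  have bs: "dist c x < R \<Longrightarrow> x \<in> \<Omega>" for x using sub by (auto simp: subset_eq)
  have b0: "b x = 0" if "x \<notin> ?B" for x using bpos[of x] that by auto
  have "integrable (lebesgue_on (cball c R)) w" using w sub unfolding locally_integrable_def by auto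
  then have "integrable lebesgue (\<lambda>x. indicator (cball c R) x *\<^sub>R w x)"
    by (subst (asm) integrable_restrict_space) auto
  then have "integrable lebesgue (\<lambda>x. indicator ?B x *\<^sub>R (indicator (cball c R) x *\<^sub>R w x))"
    by (rule integrable_mult_indicator[rotated]) auto
  moreover have "(\<lambda>x. indicator ?B x *\<^sub>R (indicator (cball c R) x *\<^sub>R w x)) = (\<lambda>x. indicator ?B x * w x)"
    by (auto simp: indicator_def)
  ultimately have h: "integrable lebesgue (\<lambda>x. indicator ?B x * w x)" by simp
  obtain g0 where g0m[measurable]: "g0 \<in> borel_measurable borel" and g0: "AE x in lborel. indicator ?B x * w x = g0 x"
    using completion_ex_borel_measurable_real[OF borel_measurable_integrable[OF h]] by auto
  \<comment> \<open>A Borel representative of \<open>w\<close> on the ball, extended by zero; from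
    here on the argument runs in \<open>lborel\<close>.\<close>
  define g where "g x = indicator ?B x * g0 x" for x
  have [measurable]: "g \<in> borel_measurable borel" unfolding g_def[abs_def] by (intro borel_measurable_times borel_measurable_indicator) auto
  have g: "AE x in lebesgue. indicator ?B x * w x = g x"
    using AE_completion[OF g0] by eventually_elim (auto simp: g_def indicator_def)
  have gl: "g \<in> borel_measurable lebesgue" by (rule measurable_completion) simp
  have "integrable lebesgue g"
    using h by (subst integrable_cong_AE[where g="\<lambda>x. indicator ?B x * w x"])
      (use g gl in \<open>auto simp: eq_commute\<close>)
  then have gi: "integrable lborel g" by (subst (asm) integrable_completion) auto
  have pos: "(LINT x|lborel. indicator {x. 0 < q x} x * g x) = 0" if q: "is_C1 q Q" and q0: "\<And>x. 0 \<le> q x" for q Q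
  proof -
    \<comment> \<open>The factor \<open>b\<close> is positive exactly on the ball, so the
      approximants built from \<open>p\<close> are supported in its closure, while inside the ball
      \<open>p\<close> and \<open>q\<close> are positive at the same points.\<close>
    define p where "p x = q x * b x" for x
    have p: "is_C1 p (\<lambda>x. q x *\<^sub>R ((2 * max 0 (R\<^sup>2 - (norm (x - c))\<^sup>2)) *\<^sub>R (- 2 *\<^sub>R (x - c))) + b x *\<^sub>R Q x)"
      unfolding p_def by (rule is_C1_mult[OF q b])
    have p0: "0 \<le> p x" for x using q0 bpos by (simp add: p_def)
    have [measurable]: "p \<in> borel_measurable borel" "q \<in> borel_measurable borel"
      using is_C1_continuous[OF p] is_C1_continuous[OF q] by (auto intro: borel_measurable_continuous_onI)
    define \<phi> where "\<phi> k x = real k * p x / (1 + real k * p x)" for k x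
    have den: "1 + real k * p x > 0" for k x using p0[of x] by (simp add: add_pos_nonneg)
    have \<phi>: "\<phi> k \<in> C1_0 \<Omega>" for k
    proof (rule C1_0_I[where K="cball c R"])
      have "is_C1 (\<lambda>x. (\<lambda>t. real k * t / (1 + real k * t)) (p x))
          (\<lambda>x. (\<lambda>t. real k / (1 + real k * t)\<^sup>2) (p x) *\<^sub>R (q x *\<^sub>R ((2 * max 0 (R\<^sup>2 - (norm (x - c))\<^sup>2)) *\<^sub>R (- 2 *\<^sub>R (x - c))) + b x *\<^sub>R Q x))"
      proof (rule is_C1_compose[OF p])
        show "((\<lambda>t. real k * t / (1 + real k * t)) has_real_derivative real k / (1 + real k * p x)\<^sup>2) (at (p x))" for x
          using den[of k x] by (auto intro!: derivative_eq_intros simp: power2_eq_square algebra_simps)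
        show "continuous_on (range p) (\<lambda>t. real k / (1 + real k * t)\<^sup>2)"
          using den by (auto intro!: continuous_intros simp: less_imp_neq[symmetric])
      qed
      then show "is_C1 (\<phi> k) (\<lambda>x. (\<lambda>t. real k / (1 + real k * t)\<^sup>2) (p x) *\<^sub>R (q x *\<^sub>R ((2 * max 0 (R\<^sup>2 - (norm (x - c))\<^sup>2)) *\<^sub>R (- 2 *\<^sub>R (x - c))) + b x *\<^sub>R Q x))"
        by (simp add: \<phi>_def[abs_def])
      show "\<phi> k x = 0" if "x \<notin> cball c R" for x using that b0[of x] by (simp add: \<phi>_def p_def)
    qed (use sub in auto)
    have [measurable]: "\<phi> k \<in> borel_measurable borel" for k unfolding \<phi>_def[abs_def] by measurable
    have z: "(LINT x|lborel. \<phi> k x * g x) = 0" for k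
    proof -
      have "0 = (LINT x|lebesgue. indicator \<Omega> x *\<^sub>R (\<phi> k x * w x))"
        using test[OF \<phi>[of k]] \<Omega> by (subst (asm) integral_restrict_space) auto
      also have "\<dots> = (LINT x|lebesgue. \<phi> k x * (indicator ?B x * w x))"
      proof (rule Bochner_Integration.integral_cong)
        fix x show "indicator \<Omega> x *\<^sub>R (\<phi> k x * w x) = \<phi> k x * (indicator ?B x * w x)"
          using b0[of x] bs[of x] by (cases "x \<in> ?B") (auto simp: \<phi>_def p_def indicator_def)
      qed simp
      also have "\<dots> = (LINT x|lebesgue. \<phi> k x * g x)"
      proof (rule integral_cong_AE)
        show "(\<lambda>x. \<phi> k x * (indicator ?B x * w x)) \<in> borel_measurable lebesgue"
          by (rule borel_measurable_times[OF _ borel_measurable_integrable[OF h]], rule measurable_completion) simp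
        show "(\<lambda>x. \<phi> k x * g x) \<in> borel_measurable lebesgue"
          by (intro borel_measurable_times measurable_completion) auto
        show "AE x in lebesgue. \<phi> k x * (indicator ?B x * w x) = \<phi> k x * g x"
          using g by eventually_elim simp
      qed
      also have "\<dots> = (LINT x|lborel. \<phi> k x * g x)"
        by (rule integral_completion) auto
      finally show ?thesis by simp
    qed
    have "(\<lambda>k. LINT x|lborel. \<phi> k x * g x) \<longlonglongrightarrow> (LINT x|lborel. indicator {x. 0 < q x} x * g x)"
    proof (rule integral_dominated_convergence[where w="\<lambda>x. norm (g x)"])
      show "integrable lborel (\<lambda>x. norm (g x))" using gi by simp
      show "AE x in lborel. norm (\<phi> k x * g x) \<le> norm (g x)" for k
      proof (rule AE_I2)
        fix x
        have "\<bar>\<phi> k x\<bar> \<le> 1" using p0[of x] den[of k x] by (simp add: \<phi>_def abs_mult)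
        then show "norm (\<phi> k x * g x) \<le> norm (g x)"
          by (simp add: abs_mult mult_left_le_one_le)
      qed
      show "AE x in lborel. (\<lambda>k. \<phi> k x * g x) \<longlonglongrightarrow> indicator {x. 0 < q x} x * g x"
      proof (rule AE_I2)
        fix x
        show "(\<lambda>k. \<phi> k x * g x) \<longlonglongrightarrow> indicator {x. 0 < q x} x * g x"
        proof (cases "x \<in> ?B \<and> q x > 0")
          case True
          then have px: "p x > 0" using bpos(1)[of x] by (simp add: p_def)
          have "(\<lambda>k. inverse (1 + real k * p x)) \<longlonglongrightarrow> 0"
            by (rule tendsto_inverse_0_at_top)
              (intro filterlim_tendsto_add_at_top[OF tendsto_const]
                 filterlim_at_top_mult_tendsto_pos[OF tendsto_const px] filterlim_real_sequentially)
          then have "(\<lambda>k. 1 - inverse (1 + real k * p x)) \<longlonglongrightarrow> 1"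
            using tendsto_diff[OF tendsto_const[of 1]] by fastforce
          moreover have "1 - inverse (1 + real k * p x) = \<phi> k x" for k
            using den[of k x] by (simp add: \<phi>_def field_simps)
          ultimately have "(\<lambda>k. \<phi> k x) \<longlonglongrightarrow> 1" by simp
          then show ?thesis using True by (auto intro!: tendsto_eq_intros)
        next
          case False
          have "\<phi> k x * g x = 0" for k
            using False q0[of x] by (auto simp: \<phi>_def p_def g_def indicator_def less_le)
          moreover have "indicator {x. 0 < q x} x * g x = 0"
            using False by (auto simp: g_def indicator_def)
          ultimately show ?thesis by (simp only: tendsto_const)
        qed
      qed
    qed measurable
    then show ?thesis using z by (simp add: LIMSEQ_const_iff)
  qed
  \<comment> \<open>The integral of \<open>g\<close> vanishes over the sets of an
    intersection-stable generator. Sets with this property are closed under complements and disjoint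
    countable unions, so all Borel sets have it.\<close>
  have dynkin: "(LINT x:A|lborel. g x) = 0" if "A \<in> sigma_sets UNIV C1_positivity_sets" for A
    using Int_stable_C1_positivity_sets Pow_UNIV[THEN equalityD2, THEN order_trans[OF subset_UNIV]] that
  proof (induction A rule: sigma_sets_induct_disjoint)
    case (basic A)
    then show ?case using pos by (auto simp: C1_positivity_sets_def set_lebesgue_integral_def)
  next
    case (compl A)
    have one: "(LINT x|lborel. g x) = 0"
      using pos[OF is_C1_const[of 1]] by simp
    have A: "A \<in> sets lborel" using compl by (simp add: sigma_sets_C1_positivity_sets)
    have "(LINT x:UNIV - A|lborel. g x) = (LINT x|lborel. g x - indicator A x *\<^sub>R g x)"
      unfolding set_lebesgue_integral_def by (rule Bochner_Integration.integral_cong) (auto simp: indicator_def)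
    also have "\<dots> = (LINT x|lborel. g x) - (LINT x:A|lborel. g x)"
      unfolding set_lebesgue_integral_def
      using gi integrable_mult_indicator[OF A gi] by simp
    finally show ?case using one compl by simp
  next
    case (union A)
    have A: "A i \<in> sets lborel" for i using union by (auto simp: sigma_sets_C1_positivity_sets)
    have "(LINT x:(\<Union>i. A i)|lborel. g x) = (\<Sum>i. (LINT x:(A i)|lborel. g x))"
      using A union(1) gi unfolding disjoint_family_on_def
      by (intro lebesgue_integral_countable_add) (auto simp: set_integrable_def intro!: integrable_mult_indicator[of _ _ g, simplified])
    then show ?case using union by simp
  qed (auto simp: set_lebesgue_integral_def)
  have "AE x in lborel. g x = 0"
    using density_unique_real[OF gi, of "\<lambda>x. 0"] dynkin sigma_sets_C1_positivity_sets by (auto simp: set_lebesgue_integral_def)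
  from AE_completion[OF this] g show ?thesis
    by eventually_elim (auto simp: indicator_def split: if_splits)
qed

text \<open>Fundamental lemma of the calculus of variations: the local statement on balls is glued
  along a countable subcover of \<Omega>.\<close>

lemma AE_zero_test:
  fixes w :: "'a::euclidean_space \<Rightarrow> real"
  assumes \<Omega>: "open \<Omega>" and w: "locally_integrable \<Omega> w"
    and test: "\<And>\<phi>. \<phi> \<in> C1_0 \<Omega> \<Longrightarrow> (LINT x|lebesgue_on \<Omega>. \<phi> x * w x) = 0"
  shows "AE x in lebesgue_on \<Omega>. w x = 0"
proof -
  have \<Omega>l: "\<Omega> \<in> sets lebesgue" using \<Omega> by (simp add: borel_open)
  let ?F = "{ball c R |c R. R > 0 \<and> cball c R \<subseteq> \<Omega>}"
  obtain F' where F': "F' \<subseteq> ?F" "countable F'" "\<Union>F' = \<Union>?F"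
    by (rule Lindelof[of ?F]) auto
  have "\<Omega> \<subseteq> \<Union>?F"
  proof
    fix x assume "x \<in> \<Omega>"
    then obtain R where "R > 0" "cball x R \<subseteq> \<Omega>" using \<Omega> open_contains_cball by blast
    then show "x \<in> \<Union>?F" by (intro UnionI[of "ball x R"]) auto
  qed
  then have cov: "\<Omega> \<subseteq> \<Union>F'" using F' by simp
  have "AE x in lebesgue. \<forall>B\<in>F'. x \<in> B \<longrightarrow> w x = 0"
  proof (rule AE_ball_countable'[OF _ F'(2)])
    fix B assume "B \<in> F'"
    then obtain c R where "B = ball c R" "R > 0" "cball c R \<subseteq> \<Omega>" using F'(1) by blast
    then show "AE x in lebesgue. x \<in> B \<longrightarrow> w x = 0" using AE_zero_ball[OF \<Omega>l w test] by simp
  qed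
  then have "AE x in lebesgue. x \<in> \<Omega> \<longrightarrow> w x = 0" by eventually_elim (use cov in auto)
  then show ?thesis using \<Omega>l by (subst AE_restrict_space_iff) auto
qed

lemma locally_integrable_diff:
  "locally_integrable \<Omega> f \<Longrightarrow> locally_integrable \<Omega> g \<Longrightarrow> locally_integrable \<Omega> (\<lambda>x. f x - g x)"
  unfolding locally_integrable_def by auto

lemma locally_integrable_inner:
  "locally_integrable \<Omega> f \<Longrightarrow> locally_integrable \<Omega> (\<lambda>x. f x \<bullet> b)"
  unfolding locally_integrable_def by auto

text \<open>Each component of the difference of two weak gradients is orthogonal to all test
  functions.\<close>

lemma has_weak_gradient_unique:
  assumes "has_weak_gradient \<Omega> u g" "has_weak_gradient \<Omega> u g'" and \<Omega>: "open \<Omega>"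
  shows "AE x in lebesgue_on \<Omega>. g x = g' x"
proof -
  have \<Omega>l: "\<Omega> \<in> sets lebesgue" using \<Omega> by (simp add: borel_open)
  have l: "locally_integrable \<Omega> g" "locally_integrable \<Omega> g'"
    using assms by (auto simp: has_weak_gradient_def)
  have "AE x in lebesgue_on \<Omega>. \<forall>b\<in>Basis. (g x - g' x) \<bullet> b = 0"
  proof (rule AE_ball_countable')
    fix b :: 'a assume "b \<in> Basis"
    show "AE x in lebesgue_on \<Omega>. (g x - g' x) \<bullet> b = 0"
    proof (rule AE_zero_test[OF \<Omega>])
      show "locally_integrable \<Omega> (\<lambda>x. (g x - g' x) \<bullet> b)"
        by (intro locally_integrable_inner locally_integrable_diff l)
      fix \<phi> assume \<phi>: "\<phi> \<in> C1_0 \<Omega>"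
      note i = integrable_C1_0_local(1)[OF \<phi> \<Omega>l l(1)] integrable_C1_0_local(1)[OF \<phi> \<Omega>l l(2)]
      have "(LINT x|lebesgue_on \<Omega>. \<phi> x * ((g x - g' x) \<bullet> b)) =
          (LINT x|lebesgue_on \<Omega>. (\<phi> x *\<^sub>R g x - \<phi> x *\<^sub>R g' x) \<bullet> b)"
        by (simp add: inner_diff_left right_diff_distrib)
      also have "\<dots> = ((LINT x|lebesgue_on \<Omega>. \<phi> x *\<^sub>R g x) - (LINT x|lebesgue_on \<Omega>. \<phi> x *\<^sub>R g' x)) \<bullet> b"
        using i by (subst integral_inner_left) auto
      also have "(LINT x|lebesgue_on \<Omega>. \<phi> x *\<^sub>R g x) = (LINT x|lebesgue_on \<Omega>. \<phi> x *\<^sub>R g' x)"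
        using assms(1,2) \<phi> unfolding has_weak_gradient_def by (metis neg_equal_iff_equal)
      finally show "(LINT x|lebesgue_on \<Omega>. \<phi> x * ((g x - g' x) \<bullet> b)) = 0" by simp
    qed
  qed (rule countable_finite[OF finite_Basis])
  then show ?thesis
  proof eventually_elim
    case (elim x)
    show ?case by (rule euclidean_eqI) (use elim in \<open>auto simp: inner_diff_left\<close>)
  qed
qed

section \<open>Sobolev functions with zero boundary values\<close>

lemma has_weak_gradient_diff_C1_0:
  assumes "has_weak_gradient \<Omega> u g" "\<phi> \<in> C1_0 \<Omega>" "open \<Omega>"
  shows "has_weak_gradient \<Omega> (\<lambda>x. u x - \<phi> x) (\<lambda>x. g x - grad \<phi> x)"
proof -
  have \<Omega>l: "\<Omega> \<in> sets lebesgue" using assms by (simp add: borel_open)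
  note w = assms(1) C1_0_has_weak_gradient[OF assms(2) \<Omega>l]
  have l: "locally_integrable \<Omega> u" "locally_integrable \<Omega> g" "locally_integrable \<Omega> \<phi>" "locally_integrable \<Omega> (grad \<phi>)"
    using w unfolding has_weak_gradient_def by auto
  show ?thesis unfolding has_weak_gradient_def
  proof (intro conjI ballI locally_integrable_diff l)
    fix \<psi> assume \<psi>: "\<psi> \<in> C1_0 \<Omega>"
    have "(LINT x|lebesgue_on \<Omega>. (u x - \<phi> x) *\<^sub>R grad \<psi> x) =
      (LINT x|lebesgue_on \<Omega>. u x *\<^sub>R grad \<psi> x) - (LINT x|lebesgue_on \<Omega>. \<phi> x *\<^sub>R grad \<psi> x)"
      using integrable_C1_0_local(2)[OF \<psi> \<Omega>l] l by (simp add: scaleR_diff_left)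
    also have "\<dots> = - (LINT x|lebesgue_on \<Omega>. \<psi> x *\<^sub>R g x) + (LINT x|lebesgue_on \<Omega>. \<psi> x *\<^sub>R grad \<phi> x)"
      using w \<psi> unfolding has_weak_gradient_def by simp
    also have "\<dots> = - (LINT x|lebesgue_on \<Omega>. \<psi> x *\<^sub>R (g x - grad \<phi> x))"
      using integrable_C1_0_local(1)[OF \<psi> \<Omega>l l(2)] integrable_C1_0_local(1)[OF \<psi> \<Omega>l l(4)]
      by (simp add: scaleR_diff_right)
    finally show "(LINT x|lebesgue_on \<Omega>. (u x - \<phi> x) *\<^sub>R grad \<psi> x) = - (LINT x|lebesgue_on \<Omega>. \<psi> x *\<^sub>R (g x - grad \<phi> x))" .
  qed
qed

lemma has_weak_gradient_wgrad: "has_weak_gradient \<Omega> u g \<Longrightarrow> has_weak_gradient \<Omega> u (wgrad \<Omega> u)"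
  using someI[of "has_weak_gradient \<Omega> u" g] by (simp add: wgrad_def)

lemma wgrad_AE:
  assumes "has_weak_gradient \<Omega> u g" "open \<Omega>"
  shows "AE x in lebesgue_on \<Omega>. wgrad \<Omega> u x = g x"
  by (rule has_weak_gradient_unique[OF has_weak_gradient_wgrad[OF assms(1)] assms])

lemma wgrad_C1_0_AE:
  assumes "\<phi> \<in> C1_0 \<Omega>" "open \<Omega>"
  shows "AE x in lebesgue_on \<Omega>. wgrad \<Omega> \<phi> x = grad \<phi> x"
  using assms by (intro wgrad_AE C1_0_has_weak_gradient) (auto simp: borel_open)

lemma in_L2_AE_cong:
  fixes f g :: "'a::euclidean_space \<Rightarrow> 'b::euclidean_space"
  assumes "in_L2 \<Omega> f" "AE x in lebesgue_on \<Omega>. f x = g x" "\<Omega> \<in> sets lebesgue"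
  shows "in_L2 \<Omega> g"
proof -
  have m: "f \<in> borel_measurable (lebesgue_on \<Omega>)" using assms(1) by (simp add: in_L2_def)
  have g: "g \<in> borel_measurable (lebesgue_on \<Omega>)"
    by (rule borel_measurable_lebesgue_on_AE[OF m assms(2,3)])
  have "AE x in lebesgue_on \<Omega>. (norm (f x))\<^sup>2 = (norm (g x))\<^sup>2"
    using assms(2) by eventually_elim simp
  then have "integrable (lebesgue_on \<Omega>) (\<lambda>x. (norm (g x))\<^sup>2)"
    using assms(1) m g by (subst integrable_cong_AE[where g="\<lambda>x. (norm (f x))\<^sup>2"])
      (auto simp: in_L2_def eq_commute)
  then show ?thesis using g by (simp add: in_L2_def)
qed

lemma in_L2_C0:
  fixes f :: "'a::euclidean_space \<Rightarrow> 'b::euclidean_space"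
  assumes "continuous_on UNIV f" "compact K" "K \<subseteq> \<Omega>" "\<And>x. x \<notin> K \<Longrightarrow> f x = 0" "\<Omega> \<in> sets lebesgue"
  shows "in_L2 \<Omega> f"
proof -
  have [measurable]: "f \<in> borel_measurable borel" using assms(1) by (rule borel_measurable_continuous_onI)
  have "integrable lborel (\<lambda>x. (norm (f x))\<^sup>2)"
    by (rule integrable_continuous_compact_support[OF _ assms(2)]) (use assms(1,4) in \<open>auto intro!: continuous_intros\<close>)
  then have "integrable (lebesgue_on \<Omega>) (\<lambda>x. (norm (f x))\<^sup>2)"
    using assms by (subst lebesgue_on_eq_lborel(2)) auto
  moreover have "f \<in> borel_measurable (lebesgue_on \<Omega>)"
    using measurable_completion[of f lborel borel] by (auto intro: measurable_restrict_space1)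
  ultimately show ?thesis by (simp add: in_L2_def)
qed

lemma in_L2_C1_0:
  assumes "\<phi> \<in> C1_0 \<Omega>" "\<Omega> \<in> sets lebesgue"
  shows "in_L2 \<Omega> \<phi>" "in_L2 \<Omega> (grad \<phi>)"
proof -
  note D = C1_0_D[OF assms(1)]
  show "in_L2 \<Omega> \<phi>"
    by (rule in_L2_C0[OF is_C1_continuous[OF D(1)] D(2,3) zero_outside_support[of _ \<phi>] assms(2)])
  show "in_L2 \<Omega> (grad \<phi>)"
    by (rule in_L2_C0[OF is_C1_continuous_grad[OF D(1)] D(2,3) grad_zero_outside[of _ \<phi>] assms(2)])
qed

text \<open>A test function approximates itself. That the distance is 0 still requires the chosen
  weak gradient of the zero function to vanish a.e.\<close>

lemma C1_0_subset_H1_0: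
  assumes "\<phi> \<in> C1_0 \<Omega>" "open \<Omega>"
  shows "\<phi> \<in> H1_0 \<Omega>"
proof -
  have \<Omega>l: "\<Omega> \<in> sets lebesgue" using assms by (simp add: borel_open)
  have "in_L2 \<Omega> (wgrad \<Omega> \<phi>)"
    by (rule in_L2_AE_cong[OF in_L2_C1_0(2)[OF assms(1) \<Omega>l] _ \<Omega>l])
      (use wgrad_C1_0_AE[OF assms] in \<open>auto simp: eq_commute\<close>)
  then have H1: "\<phi> \<in> H1 \<Omega>"
    using in_L2_C1_0(1)[OF assms(1) \<Omega>l] C1_0_has_weak_gradient[OF assms(1) \<Omega>l] by (auto simp: H1_def)
  have "(\<lambda>x. 0) \<in> C1_0 \<Omega>"
    by (rule C1_0_I[OF is_C1_const[of 0], of "{}"]) auto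
  from wgrad_C1_0_AE[OF this assms(2)]
  have "AE x in lebesgue_on \<Omega>. wgrad \<Omega> (\<lambda>x. 0) x = 0"
    by (simp add: is_C1_imp_grad[OF is_C1_const])
  then have "AE x in lebesgue_on \<Omega>. 0\<^sup>2 + (norm (wgrad \<Omega> (\<lambda>x. 0) x))\<^sup>2 = 0"
    by eventually_elim simp
  then have "H1_norm \<Omega> (\<lambda>x. \<phi> x - \<phi> x) = 0"
    unfolding H1_norm_def by (simp add: integral_eq_zero_AE)
  then show ?thesis using H1 assms(1) unfolding H1_0_def by (auto intro!: bexI[of _ \<phi>])
qed

lemma integrable_const_lebesgue_on:
  assumes "bounded \<Omega>" "\<Omega> \<in> sets lebesgue"
  shows "integrable (lebesgue_on \<Omega>) (\<lambda>x. c)"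
proof -
  have "\<Omega> \<in> lmeasurable" using assms by (rule bounded_set_imp_lmeasurable)
  then have "emeasure (lebesgue_on \<Omega>) \<Omega> < \<infinity>"
    using assms by (simp add: emeasure_restrict_space fmeasurable_def)
  then show ?thesis by (intro finite_measure.integrable_const finite_measureI) auto
qed

lemma in_L2_integrable:
  fixes v :: "'a::euclidean_space \<Rightarrow> 'b::euclidean_space"
  assumes "in_L2 \<Omega> v" "bounded \<Omega>" "\<Omega> \<in> sets lebesgue"
  shows "integrable (lebesgue_on \<Omega>) v"
proof (rule Bochner_Integration.integrable_bound)
  show "integrable (lebesgue_on \<Omega>) (\<lambda>x. 1 + (norm (v x))\<^sup>2)"
    using assms integrable_const_lebesgue_on[OF assms(2,3), of "1::real"] by (auto simp: in_L2_def)
  show "v \<in> borel_measurable (lebesgue_on \<Omega>)" using assms by (simp add: in_L2_def)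
  have "norm (v x) \<le> 1 + (norm (v x))\<^sup>2" for x
    using zero_le_power2[of "norm (v x) - 1"] norm_ge_zero[of "v x"]
    unfolding power2_diff one_power2 mult_1_right by linarith
  then show "AE x in lebesgue_on \<Omega>. norm (v x) \<le> norm (1 + (norm (v x))\<^sup>2)"
    by (intro AE_I2) simp
qed

lemma in_L2_diff:
  fixes f g :: "'a::euclidean_space \<Rightarrow> 'b::euclidean_space"
  assumes "in_L2 \<Omega> f" "in_L2 \<Omega> g"
  shows "in_L2 \<Omega> (\<lambda>x. f x - g x)"
proof -
  have m: "f \<in> borel_measurable (lebesgue_on \<Omega>)" "g \<in> borel_measurable (lebesgue_on \<Omega>)"
    using assms by (auto simp: in_L2_def)
  have "integrable (lebesgue_on \<Omega>) (\<lambda>x. (norm (f x - g x))\<^sup>2)"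
  proof (rule Bochner_Integration.integrable_bound)
    show "integrable (lebesgue_on \<Omega>) (\<lambda>x. 2 * (norm (f x))\<^sup>2 + 2 * (norm (g x))\<^sup>2)"
      using assms by (auto simp: in_L2_def)
    have "(norm (f x - g x))\<^sup>2 \<le> 2 * (norm (f x))\<^sup>2 + 2 * (norm (g x))\<^sup>2" for x
    proof -
      have "(norm (f x - g x))\<^sup>2 \<le> (norm (f x) + norm (g x))\<^sup>2"
        by (intro power_mono norm_triangle_ineq4) auto
      also have "\<dots> \<le> 2 * (norm (f x))\<^sup>2 + 2 * (norm (g x))\<^sup>2"
        using zero_le_power2[of "norm (f x) - norm (g x)"] by (simp add: power2_eq_square algebra_simps)
      finally show ?thesis .
    qed
    then show "AE x in lebesgue_on \<Omega>. norm ((norm (f x - g x))\<^sup>2) \<le> norm (2 * (norm (f x))\<^sup>2 + 2 * (norm (g x))\<^sup>2)"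
      by (intro AE_I2) simp
  qed (use m in measurable)
  then show ?thesis using m by (simp add: in_L2_def borel_measurable_diff)
qed

lemma borel_measurable_lebesgue_on_continuous:
  fixes k :: "'a::euclidean_space \<Rightarrow> 'b::euclidean_space"
  assumes "continuous_on UNIV k" shows "k \<in> borel_measurable (lebesgue_on \<Omega>)"
  using measurable_completion[of k lborel borel] borel_measurable_continuous_onI[OF assms]
  by (auto intro: measurable_restrict_space1)

lemma continuous_bounded_on:
  fixes k :: "'a::euclidean_space \<Rightarrow> 'b::euclidean_space"
  assumes "continuous_on UNIV k" "bounded \<Omega>"
  obtains C where "C > 0" "\<And>x. x \<in> \<Omega> \<Longrightarrow> norm (k x) \<le> C"
proof -
  have "compact (k ` closure \<Omega>)"
    using assms by (intro compact_continuous_image continuous_on_subset[OF assms(1)]) (auto simp: compact_closure)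
  then obtain C where "C > 0" "\<And>x. x \<in> k ` closure \<Omega> \<Longrightarrow> norm x \<le> C"
    using compact_imp_bounded bounded_pos by metis
  then show ?thesis using that[of C] closure_subset by blast
qed

lemma integrable_continuous_scaleR:
  fixes v :: "'a::euclidean_space \<Rightarrow> 'b::euclidean_space"
  assumes "integrable (lebesgue_on \<Omega>) v" "continuous_on UNIV k" "bounded \<Omega>"
  shows "integrable (lebesgue_on \<Omega>) (\<lambda>x. k x *\<^sub>R v x)"
proof -
  obtain C where C: "C > 0" "\<And>x. x \<in> \<Omega> \<Longrightarrow> norm (k x) \<le> C"
    by (rule continuous_bounded_on[OF assms(2,3)]) blast
  show ?thesis
  proof (rule Bochner_Integration.integrable_bound)
    show "integrable (lebesgue_on \<Omega>) (\<lambda>x. C * norm (v x))" using assms(1) by simp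
    show "(\<lambda>x. k x *\<^sub>R v x) \<in> borel_measurable (lebesgue_on \<Omega>)"
      by (intro borel_measurable_scaleR borel_measurable_lebesgue_on_continuous assms borel_measurable_integrable)
    show "AE x in lebesgue_on \<Omega>. norm (k x *\<^sub>R v x) \<le> norm (C * norm (v x))"
      using C by (intro AE_I2) (auto simp: abs_mult intro!: mult_right_mono)
  qed
qed

lemma integrable_scaleR_continuous:
  fixes k :: "'a::euclidean_space \<Rightarrow> 'b::euclidean_space"
  assumes "integrable (lebesgue_on \<Omega>) v" "continuous_on UNIV k" "bounded \<Omega>"
  shows "integrable (lebesgue_on \<Omega>) (\<lambda>x. v x *\<^sub>R k x)"
proof -
  obtain C where C: "C > 0" "\<And>x. x \<in> \<Omega> \<Longrightarrow> norm (k x) \<le> C"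
    by (rule continuous_bounded_on[OF assms(2,3)]) blast
  show ?thesis
  proof (rule Bochner_Integration.integrable_bound)
    show "integrable (lebesgue_on \<Omega>) (\<lambda>x. norm (v x) * C)" using assms(1) by simp
    show "(\<lambda>x. v x *\<^sub>R k x) \<in> borel_measurable (lebesgue_on \<Omega>)"
      by (intro borel_measurable_scaleR borel_measurable_lebesgue_on_continuous assms borel_measurable_integrable)
    show "AE x in lebesgue_on \<Omega>. norm (v x *\<^sub>R k x) \<le> norm (norm (v x) * C)"
      using C by (intro AE_I2) (auto simp: abs_mult intro!: mult_left_mono)
  qed
qed

text \<open>Unlike in the definition of the weak gradient, \<open>\<psi>\<close> need not vanish near the boundary:
  this is where the boundary condition on \<open>u\<close> enters.\<close>

lemma H1_0_integration_by_parts: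
  assumes u: "u \<in> H1_0 \<Omega>" and \<Omega>: "open \<Omega>" "bounded \<Omega>" and \<psi>: "is_C1 \<psi> G"
  shows "integrable (lebesgue_on \<Omega>) (\<lambda>x. u x *\<^sub>R G x)"
    "integrable (lebesgue_on \<Omega>) (\<lambda>x. \<psi> x *\<^sub>R wgrad \<Omega> u x)"
    "(LINT x|lebesgue_on \<Omega>. u x *\<^sub>R G x) = - (LINT x|lebesgue_on \<Omega>. \<psi> x *\<^sub>R wgrad \<Omega> u x)"
proof -
  have \<Omega>l: "\<Omega> \<in> sets lebesgue" using \<Omega> by (simp add: borel_open)
  have uL: "in_L2 \<Omega> u" "in_L2 \<Omega> (wgrad \<Omega> u)" and "\<exists>g. has_weak_gradient \<Omega> u g"
    using u by (auto simp: H1_0_def H1_def)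
  then have uw: "has_weak_gradient \<Omega> u (wgrad \<Omega> u)" using has_weak_gradient_wgrad by blast
  have ui: "integrable (lebesgue_on \<Omega>) u" "integrable (lebesgue_on \<Omega>) (wgrad \<Omega> u)"
    by (rule in_L2_integrable[OF uL(1) \<Omega>(2) \<Omega>l] in_L2_integrable[OF uL(2) \<Omega>(2) \<Omega>l])+
  note c = is_C1_continuous[OF \<psi>, of UNIV] is_C1_continuous_grad[OF \<psi>, of UNIV]
  show i1: "integrable (lebesgue_on \<Omega>) (\<lambda>x. u x *\<^sub>R G x)"
    by (rule integrable_scaleR_continuous[OF ui(1) c(2) \<Omega>(2)])
  show i2: "integrable (lebesgue_on \<Omega>) (\<lambda>x. \<psi> x *\<^sub>R wgrad \<Omega> u x)"
    by (rule integrable_continuous_scaleR[OF ui(2) c(1) \<Omega>(2)])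
  obtain C1 where C1: "C1 > 0" "\<And>x. x \<in> \<Omega> \<Longrightarrow> norm (\<psi> x) \<le> C1"
    by (rule continuous_bounded_on[OF c(1) \<Omega>(2)]) blast
  obtain C2 where C2: "C2 > 0" "\<And>x. x \<in> \<Omega> \<Longrightarrow> norm (G x) \<le> C2"
    by (rule continuous_bounded_on[OF c(2) \<Omega>(2)]) blast
  define C where "C = max C1 C2"
  have C: "C > 0" "\<And>x. x \<in> \<Omega> \<Longrightarrow> norm (\<psi> x) \<le> C" "\<And>x. x \<in> \<Omega> \<Longrightarrow> norm (G x) \<le> C"
    using C1 C2 by (auto simp: C_def le_max_iff_disj)
  define m where "m = (LINT x|lebesgue_on \<Omega>. (1::real))"
  have m: "m \<ge> 0" unfolding m_def by simp
  \<comment> \<open>\<open>L\<close> is the defect of the identity. It is linear in \<open>u\<close>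
    and vanishes on test functions, so it is controlled by the distance of \<open>u\<close> to
    them.\<close>
  define L where "L = (LINT x|lebesgue_on \<Omega>. u x *\<^sub>R G x) + (LINT x|lebesgue_on \<Omega>. \<psi> x *\<^sub>R wgrad \<Omega> u x)"
  have bound: "norm L \<le> C * (m + 1) * \<epsilon>" if \<epsilon>: "\<epsilon> > 0" for \<epsilon> :: real
  proof -
    obtain \<phi> where \<phi>: "\<phi> \<in> C1_0 \<Omega>" and n: "H1_norm \<Omega> (\<lambda>x. u x - \<phi> x) < \<epsilon>"
      using u \<epsilon> by (auto simp: H1_0_def)
    define w where "w x = u x - \<phi> x" for x
    define W where "W x = wgrad \<Omega> u x - grad \<phi> x" for x
    have wL: "in_L2 \<Omega> w" "in_L2 \<Omega> W"
      unfolding w_def[abs_def] W_def[abs_def] by (rule in_L2_diff uL in_L2_C1_0[OF \<phi> \<Omega>l])+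
    have wi: "integrable (lebesgue_on \<Omega>) w" "integrable (lebesgue_on \<Omega>) W"
      by (rule in_L2_integrable[OF wL(1) \<Omega>(2) \<Omega>l] in_L2_integrable[OF wL(2) \<Omega>(2) \<Omega>l])+
    have j: "integrable (lebesgue_on \<Omega>) (\<lambda>x. w x *\<^sub>R G x)" "integrable (lebesgue_on \<Omega>) (\<lambda>x. \<psi> x *\<^sub>R W x)"
      by (rule integrable_scaleR_continuous[OF wi(1) c(2) \<Omega>(2)] integrable_continuous_scaleR[OF wi(2) c(1) \<Omega>(2)])+
    have sq: "integrable (lebesgue_on \<Omega>) (\<lambda>x. (w x)\<^sup>2)" "integrable (lebesgue_on \<Omega>) (\<lambda>x. (norm (W x))\<^sup>2)"
      using wL by (auto simp: in_L2_def)
    have "AE x in lebesgue_on \<Omega>. wgrad \<Omega> w x = W x"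
      unfolding w_def[abs_def] W_def[abs_def]
      by (rule wgrad_AE[OF has_weak_gradient_diff_C1_0[OF uw \<phi> \<Omega>(1)] \<Omega>(1)])
    then have ae: "AE x in lebesgue_on \<Omega>. W x = wgrad \<Omega> w x" by eventually_elim simp
    have Wm: "W \<in> borel_measurable (lebesgue_on \<Omega>)" using wL by (simp add: in_L2_def)
    have "(LINT x|lebesgue_on \<Omega>. (w x)\<^sup>2 + (norm (wgrad \<Omega> w x))\<^sup>2) = (LINT x|lebesgue_on \<Omega>. (w x)\<^sup>2 + (norm (W x))\<^sup>2)"
    proof (rule integral_cong_AE)
      have "wgrad \<Omega> w \<in> borel_measurable (lebesgue_on \<Omega>)"
        by (rule borel_measurable_lebesgue_on_AE[OF Wm ae \<Omega>l])
      then show "(\<lambda>x. (w x)\<^sup>2 + (norm (wgrad \<Omega> w x))\<^sup>2) \<in> borel_measurable (lebesgue_on \<Omega>)"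
        using wi by measurable
      show "AE x in lebesgue_on \<Omega>. (w x)\<^sup>2 + (norm (wgrad \<Omega> w x))\<^sup>2 = (w x)\<^sup>2 + (norm (W x))\<^sup>2"
        using ae by eventually_elim simp
    qed (use wi in measurable)
    then have "sqrt (LINT x|lebesgue_on \<Omega>. (w x)\<^sup>2 + (norm (W x))\<^sup>2) < \<epsilon>"
      using n by (simp add: H1_norm_def w_def[abs_def])
    then have "(sqrt (LINT x|lebesgue_on \<Omega>. (w x)\<^sup>2 + (norm (W x))\<^sup>2))\<^sup>2 \<le> \<epsilon>\<^sup>2"
      by (intro power_mono) auto
    then have I: "(LINT x|lebesgue_on \<Omega>. (w x)\<^sup>2 + (norm (W x))\<^sup>2) \<le> \<epsilon>\<^sup>2" by simp
    have "L = (LINT x|lebesgue_on \<Omega>. w x *\<^sub>R G x) + (LINT x|lebesgue_on \<Omega>. \<psi> x *\<^sub>R W x)"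
      using C1_0_integration_by_parts[OF \<phi> \<psi> \<Omega>l] i1 i2
      unfolding L_def w_def W_def by (simp add: scaleR_diff_left scaleR_diff_right)
    also have "\<dots> = (LINT x|lebesgue_on \<Omega>. w x *\<^sub>R G x + \<psi> x *\<^sub>R W x)" using j by simp
    finally have "norm L \<le> (LINT x|lebesgue_on \<Omega>. norm (w x *\<^sub>R G x + \<psi> x *\<^sub>R W x))" by simp
    also have "\<dots> \<le> (LINT x|lebesgue_on \<Omega>. C * (\<epsilon> + ((w x)\<^sup>2 + (norm (W x))\<^sup>2) / (2 * \<epsilon>)))"
    proof (rule integral_mono)
      show "integrable (lebesgue_on \<Omega>) (\<lambda>x. norm (w x *\<^sub>R G x + \<psi> x *\<^sub>R W x))" using j by simp
      show "integrable (lebesgue_on \<Omega>) (\<lambda>x. C * (\<epsilon> + ((w x)\<^sup>2 + (norm (W x))\<^sup>2) / (2 * \<epsilon>)))"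
        using sq integrable_const_lebesgue_on[OF \<Omega>(2) \<Omega>l]
        by (intro Bochner_Integration.integrable_add integrable_mult_right integrable_divide) auto
      fix x assume "x \<in> space (lebesgue_on \<Omega>)"
      then have x: "x \<in> \<Omega>" by simp
      \<comment> \<open>This weighted inequality takes the place of Cauchy-Schwarz for integrals: it
        turns the squared norm of \<open>u - \<phi>\<close>, at most \<epsilon>^2, into a bound of
        order \<epsilon>.\<close>
      have amgm: "t \<le> (\<epsilon> + t\<^sup>2 / \<epsilon>) / 2" for t :: real
        using zero_le_power2[of "t - \<epsilon>"] \<epsilon> by (simp add: field_simps power2_eq_square)
      have "norm (w x *\<^sub>R G x + \<psi> x *\<^sub>R W x) \<le> \<bar>w x\<bar> * norm (G x) + \<bar>\<psi> x\<bar> * norm (W x)"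
        by (rule order_trans[OF norm_triangle_ineq]) simp
      also have "\<dots> \<le> \<bar>w x\<bar> * C + C * norm (W x)"
        using C(2,3)[OF x] by (intro add_mono mult_left_mono mult_right_mono) auto
      also have "\<dots> = C * (\<bar>w x\<bar> + norm (W x))" by (simp add: algebra_simps)
      also have "\<dots> \<le> C * (\<epsilon> + ((w x)\<^sup>2 + (norm (W x))\<^sup>2) / (2 * \<epsilon>))"
        using amgm[of "\<bar>w x\<bar>"] amgm[of "norm (W x)"] C(1) \<epsilon>
        by (intro mult_left_mono) (auto simp: field_simps)
      finally show "norm (w x *\<^sub>R G x + \<psi> x *\<^sub>R W x) \<le> C * (\<epsilon> + ((w x)\<^sup>2 + (norm (W x))\<^sup>2) / (2 * \<epsilon>))" .
    qed
    also have "\<dots> = C * (\<epsilon> * m + (LINT x|lebesgue_on \<Omega>. (w x)\<^sup>2 + (norm (W x))\<^sup>2) / (2 * \<epsilon>))"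
    proof -
      have "(LINT x|lebesgue_on \<Omega>. \<epsilon>) = \<epsilon> * m" unfolding m_def by simp
      then show ?thesis using sq integrable_const_lebesgue_on[OF \<Omega>(2) \<Omega>l, of \<epsilon>] by simp
    qed
    also have "\<dots> \<le> C * (\<epsilon> * m + \<epsilon>\<^sup>2 / (2 * \<epsilon>))"
      using I C(1) \<epsilon> by (intro mult_left_mono add_left_mono divide_right_mono) auto
    also have "\<dots> \<le> C * (m + 1) * \<epsilon>" using \<epsilon> C(1) by (simp add: field_simps power2_eq_square)
    finally show ?thesis .
  qed
  have "L = 0"
  proof (rule ccontr)
    assume "L \<noteq> 0"
    define D where "D = C * (m + 1)"
    define \<epsilon> where "\<epsilon> = norm L / (2 * D)"
    have "D > 0" using C(1) m by (simp add: D_def)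
    then have "\<epsilon> > 0" "D * \<epsilon> = norm L / 2" using \<open>L \<noteq> 0\<close> by (auto simp: \<epsilon>_def)
    moreover have "norm L > 0" using \<open>L \<noteq> 0\<close> by simp
    ultimately show False using bound[of \<epsilon>] unfolding D_def[symmetric] by linarith
  qed
  then show "(LINT x|lebesgue_on \<Omega>. u x *\<^sub>R G x) = - (LINT x|lebesgue_on \<Omega>. \<psi> x *\<^sub>R wgrad \<Omega> u x)"
    unfolding L_def by (simp add: eq_neg_iff_add_eq_0)
qed

section \<open>Polar coordinates\<close>

text \<open>For 0-homogeneous \<open>A\<close> this is the integral over the unit sphere.\<close>

definition angular_mass :: "('a::euclidean_space \<Rightarrow> real) \<Rightarrow> real" where
  "angular_mass A = real DIM('a) * (LINT x|lborel. indicator (cball 0 1) x * A x)"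

lemma nn_integral_lborel_scale:
  fixes f :: "'a::euclidean_space \<Rightarrow> ennreal"
  assumes [measurable]: "f \<in> borel_measurable borel" and "r > 0"
  shows "(\<integral>\<^sup>+x. f x \<partial>lborel) = ennreal (r ^ DIM('a)) * (\<integral>\<^sup>+x. f (r *\<^sub>R x) \<partial>lborel)"
  using assms(2)
  by (subst lborel_affine[of r 0]) (simp_all add: nn_integral_density nn_integral_distr nn_integral_cmult ennreal_power)

text \<open>A bounded nonnegative function on the sphere, encoded by its 0-homogeneous extension.
  Integrating over the unit ball then replaces a surface measure.\<close>

locale angular =
  fixes A :: "'a::euclidean_space \<Rightarrow> real" and C :: real
  assumes A_borel [measurable]: "A \<in> borel_measurable borel"
    and A_nonneg: "0 \<le> A x" and A_le: "A x \<le> C"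
    and A_hom: "t > 0 \<Longrightarrow> A (t *\<^sub>R x) = A x"
begin

lemma cball_borel [measurable]: "cball (c::'a) r \<in> sets borel"
  by (simp add: borel_closed)

lemma integrable_unit_ball: "integrable lborel (\<lambda>x. indicator (cball 0 1) x * A x)"
proof (rule Bochner_Integration.integrable_bound)
  show "integrable lborel (\<lambda>x::'a. indicator (cball 0 1) x *\<^sub>R C)"
    by (rule borel_integrable_compact) auto
  have "A x \<le> \<bar>C\<bar>" for x using A_le[of x] by linarith
  then show "AE x in lborel. norm (indicator (cball 0 1) x * A x) \<le> norm (indicator (cball 0 1) x *\<^sub>R C)"
    using A_nonneg by (intro AE_I2) (auto simp: indicator_def)
qed simp

lemma mass_nonneg: "0 \<le> angular_mass A"
  unfolding angular_mass_def using A_nonneg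
  by (intro mult_nonneg_nonneg Bochner_Integration.integral_nonneg) auto

text \<open>By homogeneity the integral scales like volume, so only the unit ball has to be
  known.\<close>

lemma nn_integral_ball:
  assumes "r > 0"
  shows "(\<integral>\<^sup>+x. ennreal (A x) * indicator (cball 0 r) x \<partial>lborel)
    = ennreal (r ^ DIM('a) * angular_mass A / DIM('a))"
proof -
  have "(\<integral>\<^sup>+x. ennreal (A x) * indicator (cball 0 r) x \<partial>lborel)
      = ennreal (r ^ DIM('a)) * (\<integral>\<^sup>+x. ennreal (A (r *\<^sub>R x)) * indicator (cball 0 r) (r *\<^sub>R x) \<partial>lborel)"
    by (rule nn_integral_lborel_scale[OF _ assms]) simp
  also have "(\<integral>\<^sup>+x. ennreal (A (r *\<^sub>R x)) * indicator (cball 0 r) (r *\<^sub>R x) \<partial>lborel)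
      = (\<integral>\<^sup>+x. ennreal (indicator (cball 0 1) x * A x) \<partial>lborel)"
    using assms by (intro nn_integral_cong) (auto simp: A_hom indicator_def)
  also have "\<dots> = ennreal (LINT x|lborel. indicator (cball 0 1) x * A x)"
    using A_nonneg by (intro nn_integral_eq_integral integrable_unit_ball) auto
  finally show ?thesis using assms
    by (simp add: angular_mass_def ennreal_mult[symmetric] A_nonneg)
qed

text \<open>Polar coordinates as a statement about the image of the measure A dx under the norm.
  Both sides give the half-line up to r \<ge> 0 the mass r^N / N times the angular mass, and
  half-lines are an intersection-stable generator.\<close>

lemma distr_norm:
  "distr (density lborel (\<lambda>x. ennreal (A x))) borel norm
    = density lborel (\<lambda>r. ennreal (angular_mass A * r ^ (DIM('a) - 1)) * indicator {0..} r)" (is "?M = ?N")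
proof (rule measure_eqI_generator_eq[where E="range (\<lambda>r::real. {..r})" and \<Omega>=UNIV and A="\<lambda>n. {..real n}"])
  have M: "emeasure ?M {..r} = ennreal (r ^ DIM('a) * angular_mass A / DIM('a)) * indicator {0..} r" for r :: real
  proof -
    have "emeasure ?M {..r} = (\<integral>\<^sup>+x. ennreal (A x) * indicator {x. norm x \<le> r} x \<partial>lborel)"
      by (simp add: emeasure_distr emeasure_density vimage_def)
    also have "\<dots> = ennreal (r ^ DIM('a) * angular_mass A / DIM('a)) * indicator {0..} r"
    proof -
      consider "r < 0" | "r = 0" | "r > 0" by linarith
      then show ?thesis
      proof cases
        case 1
        then have "{x::'a. norm x \<le> r} = {}" using norm_ge_zero by (auto simp: not_le intro: less_le_trans)
        then show ?thesis using 1 by simp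
      next
        case 2
        have "(\<integral>\<^sup>+x. ennreal (A x) * indicator {x. norm x \<le> r} x \<partial>lborel) = 0"
          using AE_lborel_singleton[of "0::'a"] 2
          by (subst nn_integral_0_iff_AE) (auto elim!: eventually_mono)
        then show ?thesis using 2 by (simp add: power_0_left)
      next
        case 3
        have "{x::'a. norm x \<le> r} = cball 0 r" by auto
        then show ?thesis using 3 nn_integral_ball[OF 3] by simp
      qed
    qed
    finally show ?thesis .
  qed
  have N: "emeasure ?N {..r} = ennreal (r ^ DIM('a) * angular_mass A / DIM('a)) * indicator {0..} r" for r :: real
  proof -
    have "emeasure ?N {..r} = (\<integral>\<^sup>+s. ennreal (angular_mass A * s ^ (DIM('a) - 1)) * indicator {0..r} s \<partial>lborel)"
      by (simp add: emeasure_density) (rule nn_integral_cong, simp add: indicator_def)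
    also have "\<dots> = ennreal (r ^ DIM('a) * angular_mass A / DIM('a)) * indicator {0..} r"
    proof (cases "0 \<le> r")
      case True
      have "(\<integral>\<^sup>+s. ennreal (angular_mass A * s ^ (DIM('a) - 1)) * indicator {0..r} s \<partial>lborel)
          = ennreal (r ^ DIM('a) * angular_mass A / DIM('a) - 0 ^ DIM('a) * angular_mass A / DIM('a))"
      proof (rule nn_integral_FTC_Icc)
        fix s :: real assume s: "s \<in> {0..r}"
        show "((\<lambda>s. s ^ DIM('a) * angular_mass A / DIM('a)) has_real_derivative angular_mass A * s ^ (DIM('a) - 1)) (at s)"
          by (auto intro!: derivative_eq_intros)
        show "0 \<le> angular_mass A * s ^ (DIM('a) - 1)"
          using s mass_nonneg by simp
      qed (use True in auto)
      then show ?thesis using True by (simp add: power_0_left)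
    qed (simp add: indicator_def)
    finally show ?thesis .
  qed
  show "Int_stable (range (\<lambda>r::real. {..r}))"
    by (auto simp: Int_stable_def)
  show "sets ?M = sigma_sets UNIV (range (\<lambda>r::real. {..r}))" "sets ?N = sigma_sets UNIV (range (\<lambda>r::real. {..r}))"
    by (simp_all add: borel_eq_atMost)
  show "emeasure ?M X = emeasure ?N X" if "X \<in> range (\<lambda>r::real. {..r})" for X
    using that M N by auto
  show "emeasure ?M {..real n} \<noteq> \<infinity>" for n
    unfolding M by (simp add: indicator_def)
  show "(\<Union>n. {..real n}) = UNIV" using real_arch_simple by auto
qed auto

lemma polar_borel:
  fixes F :: "real \<Rightarrow> real"
  assumes [measurable]: "F \<in> borel_measurable borel"
    and int: "integrable lborel (\<lambda>r. indicator {0..} r * (F r * r ^ (DIM('a) - 1)))"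
  shows "integrable lborel (\<lambda>x. F (norm x) * A x)"
    "(LINT x|lborel. F (norm x) * A x) = angular_mass A * (LINT r|lborel. indicator {0..} r * (F r * r ^ (DIM('a) - 1)))"
proof -
  define k where "k r = angular_mass A * r ^ (DIM('a) - 1) * indicator {0..} r" for r :: real
  have k: "0 \<le> k r" for r using mass_nonneg by (auto simp: k_def indicator_def)
  have [measurable]: "k \<in> borel_measurable borel" unfolding k_def[abs_def] by measurable
  have "(\<lambda>r. ennreal (angular_mass A * r ^ (DIM('a) - 1)) * indicator {0..} r) = (\<lambda>r. ennreal (k r))"
    by (auto simp: k_def indicator_def)
  then have d: "distr (density lborel (\<lambda>x. ennreal (A x))) borel norm = density lborel (\<lambda>r. ennreal (k r))"
    using distr_norm by simp
  have kF: "k r *\<^sub>R F r = angular_mass A * (indicator {0..} r * (F r * r ^ (DIM('a) - 1)))" for r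
    by (simp add: k_def)
  have "integrable (density lborel (\<lambda>r. ennreal (k r))) F"
    using int k by (subst integrable_density) (auto simp: kF simp del: real_scaleR_def)
  then have "integrable (density lborel (\<lambda>x. ennreal (A x))) (\<lambda>x. F (norm x))"
    unfolding d[symmetric] by (subst (asm) integrable_distr_eq) auto
  then show "integrable lborel (\<lambda>x. F (norm x) * A x)"
    using A_nonneg by (subst (asm) integrable_density) (auto simp: mult.commute)
  have "(LINT x|lborel. F (norm x) * A x) = (LINT x|density lborel (\<lambda>x. ennreal (A x)). F (norm x))"
    using A_nonneg by (subst integral_density) (auto simp: mult.commute)
  also have "\<dots> = (LINT r|density lborel (\<lambda>r. ennreal (k r)). F r)"
    unfolding d[symmetric] by (subst integral_distr) auto
  also have "\<dots> = angular_mass A * (LINT r|lborel. indicator {0..} r * (F r * r ^ (DIM('a) - 1)))"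
    using k by (subst integral_density) (auto simp: kF simp del: real_scaleR_def)
  finally show "(LINT x|lborel. F (norm x) * A x) = angular_mass A * (LINT r|lborel. indicator {0..} r * (F r * r ^ (DIM('a) - 1)))" .
qed

end

interpretation angular_one: angular "\<lambda>x. 1" 1
  by unfold_locales auto

text \<open>The image of Lebesgue measure under the norm has a density, so null sets of radii have
  null preimages.\<close>

lemma AE_norm:
  assumes "AE r in lborel. P r"
  shows "AE x in lborel. P (norm (x::'a::euclidean_space))"
proof -
  have "AE r in density lborel (\<lambda>r. ennreal (angular_mass (\<lambda>x::'a. 1) * r ^ (DIM('a) - 1)) * indicator {0..} r). P r"
    using assms by (subst AE_density) (auto elim: eventually_mono)
  then have "AE r in distr (density lborel (\<lambda>x::'a. ennreal 1)) borel norm. P r"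
    by (simp only: angular_one.distr_norm)
  then have "AE r in distr (lborel::'a measure) borel norm. P r"
    by (simp only: ennreal_1 density_1)
  then show ?thesis by (rule AE_distrD[rotated]) simp
qed

context angular
begin

text \<open>Extends \<open>polar_borel\<close> to radial factors that are only Lebesgue measurable,
  such as those containing f'(U). \<Omega> has to match \<open>S\<close> only away from the origin,
  so ball and annulus are both covered.\<close>

lemma polar:
  fixes F :: "real \<Rightarrow> real"
  assumes S: "S \<subseteq> {0<..}"
    and int: "(\<lambda>r. F r * r ^ (DIM('a) - 1)) absolutely_integrable_on S"
    and \<Omega>: "\<And>x::'a. x \<noteq> 0 \<Longrightarrow> x \<in> \<Omega> \<longleftrightarrow> norm x \<in> S" and \<Omega>l: "\<Omega> \<in> sets lebesgue"
  shows "integrable (lebesgue_on \<Omega>) (\<lambda>x. F (norm x) * A x)"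
    "(LINT x|lebesgue_on \<Omega>. F (norm x) * A x) = angular_mass A * integral S (\<lambda>r. F r * r ^ (DIM('a) - 1))"
proof -
  define h where "h r = indicator S r *\<^sub>R (F r * r ^ (DIM('a) - 1))" for r
  have h: "integrable lebesgue h"
    using int by (simp add: h_def[abs_def] set_integrable_def)
  \<comment> \<open>Dividing the weight out again shows that \<open>F\<close> itself is measurable
    on \<open>S\<close>, so it has a Borel version \<open>g\<close>.\<close>
  define H where "H r = h r * inverse (r ^ (DIM('a) - 1))" for r
  have H: "H r = indicator S r * F r" for r
    using S by (auto simp: H_def h_def indicator_def)
  have "(\<lambda>r::real. inverse (r ^ (DIM('a) - 1))) \<in> borel_measurable lebesgue"
    by (rule measurable_completion) simp
  then have "H \<in> borel_measurable lebesgue"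
    unfolding H_def[abs_def] by (rule borel_measurable_times[OF borel_measurable_integrable[OF h]])
  then obtain g where [measurable]: "g \<in> borel_measurable borel" and g: "AE r in lborel. H r = g r"
    using completion_ex_borel_measurable_real by fastforce
  let ?k = "\<lambda>r. indicator {0..} r * (g r * r ^ (DIM('a) - 1))"
  have "AE r in lborel. r \<noteq> 0" by (rule AE_lborel_singleton)
  with g have "AE r in lborel. h r = ?k r"
  proof eventually_elim
    case (elim r)
    have "h r = 0" if "r \<le> 0" proof -
      have "r \<notin> S" using S that by auto
      then show ?thesis by (simp add: h_def)
    qed
    moreover have "H r * r ^ (DIM('a) - 1) = h r" if "r > 0" using that by (simp add: H_def)
    ultimately show ?case using elim by (cases "r > 0") (auto simp: indicator_def)
  qed
  then have hk: "AE r in lebesgue. h r = ?k r" by (rule AE_completion)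
  have km: "?k \<in> borel_measurable lebesgue" by (rule measurable_completion) simp
  have "integrable lebesgue ?k"
    using h by (subst integrable_cong_AE[OF km borel_measurable_integrable[OF h]]) (use hk in \<open>auto elim: eventually_mono\<close>)
  then have ki: "integrable lborel ?k" by (subst (asm) integrable_completion) auto
  have "(LINT r|lborel. ?k r) = (LINT r|lebesgue. ?k r)" by (rule integral_completion[symmetric]) simp
  also have "\<dots> = (LINT r|lebesgue. h r)"
    by (rule integral_cong_AE[OF km borel_measurable_integrable[OF h]]) (use hk in \<open>auto elim: eventually_mono\<close>)
  also have "\<dots> = integral S (\<lambda>r. F r * r ^ (DIM('a) - 1))"
    using set_lebesgue_integral_eq_integral(2)[OF int] by (simp add: h_def[abs_def] set_lebesgue_integral_def)
  finally have kint: "(LINT r|lborel. ?k r) = integral S (\<lambda>r. F r * r ^ (DIM('a) - 1))" .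
  note P = polar_borel[OF _ ki]
  have gm: "(\<lambda>x. g (norm x) * A x) \<in> borel_measurable lebesgue" by (rule measurable_completion) simp
  have "AE x in lborel. g (norm x) * A x = indicator \<Omega> x *\<^sub>R (F (norm x) * A x)"
    using AE_norm[OF g] AE_lborel_singleton[of "0::'a"]
  proof eventually_elim
    case (elim x)
    then show ?case using \<Omega>[of x] by (auto simp: H indicator_def)
  qed
  then have ae: "AE x in lebesgue. g (norm x) * A x = indicator \<Omega> x *\<^sub>R (F (norm x) * A x)"
    by (rule AE_completion)
  have fm: "(\<lambda>x. indicator \<Omega> x *\<^sub>R (F (norm x) * A x)) \<in> borel_measurable lebesgue"
    by (rule borel_measurable_AE[OF gm ae])
  have gi: "integrable lebesgue (\<lambda>x. g (norm x) * A x)"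
    using P(1) by (subst integrable_completion) auto
  have "integrable lebesgue (\<lambda>x. indicator \<Omega> x *\<^sub>R (F (norm x) * A x))"
    using iffD1[OF integrable_cong_AE[OF gm fm ae] gi] .
  then show "integrable (lebesgue_on \<Omega>) (\<lambda>x. F (norm x) * A x)"
    using \<Omega>l by (subst integrable_restrict_space) simp_all
  have "(LINT x|lebesgue_on \<Omega>. F (norm x) * A x) = (LINT x|lebesgue. indicator \<Omega> x *\<^sub>R (F (norm x) * A x))"
    using \<Omega>l by (subst integral_restrict_space) auto
  also have "\<dots> = (LINT x|lebesgue. g (norm x) * A x)"
    by (rule integral_cong_AE[OF gm fm ae, symmetric])
  also have "\<dots> = (LINT x|lborel. g (norm x) * A x)"
    by (rule integral_completion) simp
  also have "\<dots> = angular_mass A * integral S (\<lambda>r. F r * r ^ (DIM('a) - 1))"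
    using P(2) kint by simp
  finally show "(LINT x|lebesgue_on \<Omega>. F (norm x) * A x) = angular_mass A * integral S (\<lambda>r. F r * r ^ (DIM('a) - 1))" .
qed

end

section \<open>The radial equation\<close>

text \<open>Test profiles are continuous on [c,d] and vanish elsewhere. The negligible difference
  allows \<open>S\<close> to miss end points, for instance the radius 0 of a ball.\<close>

lemma absolutely_integrable_continuous_extend_zero:
  fixes g :: "real \<Rightarrow> real"
  assumes "continuous_on {c..d} g" "\<And>r. r \<in> S \<Longrightarrow> r \<notin> {c..d} \<Longrightarrow> g r = 0" "negligible ({c..d} - S)"
  shows "g absolutely_integrable_on S" "integral S g = integral {c..d} g"
proof -
  let ?h = "\<lambda>r. if r \<in> {c..d} then g r else 0" and ?k = "\<lambda>r. if r \<in> S then g r else 0"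
  have "?h absolutely_integrable_on UNIV"
    using absolutely_integrable_continuous_real[OF assms(1)] by (simp only: absolutely_integrable_restrict_UNIV)
  then have "?k absolutely_integrable_on UNIV"
    by (rule absolutely_integrable_spike[OF _ assms(3)]) (use assms(2) in auto)
  then show "g absolutely_integrable_on S" by (simp only: absolutely_integrable_restrict_UNIV)
  have "integral UNIV ?h = integral UNIV ?k"
    by (rule integral_spike[OF assms(3)]) (use assms(2) in auto)
  then show "integral S g = integral {c..d} g" by (simp only: integral_restrict_UNIV)
qed

text \<open>The primitives used below are differentiated only inside the interval, hence the
  interior form of the fundamental theorem.\<close>

lemma integral_by_parts_real:
  fixes f g :: "real \<Rightarrow> real"
  assumes "a \<le> b" and c: "continuous_on {a..b} f" "continuous_on {a..b} g"
    and d: "\<And>x. x \<in> {a<..<b} \<Longrightarrow> (f has_real_derivative f' x) (at x)"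
      "\<And>x. x \<in> {a<..<b} \<Longrightarrow> (g has_real_derivative g' x) (at x)"
    and i: "(\<lambda>x. f' x * g x) integrable_on {a..b}"
  shows "(\<lambda>x. f x * g' x) integrable_on {a..b}"
    "integral {a..b} (\<lambda>x. f x * g' x) = f b * g b - f a * g a - integral {a..b} (\<lambda>x. f' x * g x)"
proof -
  have "((\<lambda>x. f' x * g x + f x * g' x) has_integral f b * g b - f a * g a) {a..b}"
    using d by (intro fundamental_theorem_of_calculus_interior continuous_intros c assms(1))
      (auto simp: has_real_derivative_iff_has_vector_derivative[symmetric] intro!: derivative_eq_intros)
  from has_integral_diff[OF this integrable_integral[OF i]]
  have "((\<lambda>x. f x * g' x) has_integral f b * g b - f a * g a - integral {a..b} (\<lambda>x. f' x * g x)) {a..b}"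
    by simp
  then show "(\<lambda>x. f x * g' x) integrable_on {a..b}"
    "integral {a..b} (\<lambda>x. f x * g' x) = f b * g b - f a * g a - integral {a..b} (\<lambda>x. f' x * g x)"
    by (auto simp: integral_unique)
qed

lemma DERIV_eq_0_of_locally_0:
  fixes q :: "real \<Rightarrow> real"
  assumes "(q has_real_derivative D) (at r)" "open S" "r \<in> S" "\<And>x. x \<in> S \<Longrightarrow> q x = 0"
  shows "D = 0"
proof -
  have "((\<lambda>r. 0) has_real_derivative D) (at r)"
    by (rule has_field_derivative_transform_within_open[OF assms(1-3)]) (simp add: assms(4))
  then show ?thesis by (rule DERIV_unique[OF _ DERIV_const])
qed

lemma integral_has_real_derivative_interior:
  fixes g :: "real \<Rightarrow> real"
  assumes "continuous_on {c..d} g" "c < r" "r < d"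
  shows "((\<lambda>x. integral {c..x} g) has_real_derivative g r) (at r)"
proof -
  have "((\<lambda>x. integral {c..x} g) has_real_derivative g r) (at r within {c..d})"
    by (rule integral_has_real_derivative[OF assms(1)]) (use assms(2,3) in auto)
  then show ?thesis using assms(2,3) by (subst (asm) at_within_interior) auto
qed

text \<open>The integral over \<open>{m..x}\<close> is not oriented: for x < m the set is empty and
  the value 0. This is still the right primitive because \<beta> vanishes there.\<close>

lemma integral_DERIV_zero_left:
  fixes \<beta> :: "real \<Rightarrow> real"
  assumes c: "continuous_on UNIV \<beta>" and z: "\<And>r. r \<le> m \<Longrightarrow> \<beta> r = 0"
  shows "((\<lambda>x. integral {m..x} \<beta>) has_real_derivative \<beta> x) (at x)"
proof (cases "x < m")
  case True
  have "((\<lambda>x. 0) has_real_derivative \<beta> x) (at x)" using z[of x] True by simp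
  then show ?thesis
    by (rule has_field_derivative_transform_within_open[of _ _ _ "{..<m}"]) (use True in auto)
next
  case False
  have "((\<lambda>u. integral {m - 1..u} \<beta>) has_real_derivative \<beta> x) (at x)"
    by (rule integral_has_real_derivative_interior[where d="x + 1"]) (use False continuous_on_subset[OF c] in auto)
  then show ?thesis
  proof (rule has_field_derivative_transform_within_open[of _ _ _ "{m - 1<..}"])
    fix u assume u: "u \<in> {m - 1<..}"
    show "integral {m - 1..u} \<beta> = integral {m..u} \<beta>"
    proof (cases "u < m")
      case True
      then have "integral {m - 1..u} \<beta> = integral {m - 1..u} (\<lambda>x. 0)"
        using z by (intro integral_cong) auto
      then show ?thesis using True by simp
    next
      case False
      have "integral {m - 1..u} \<beta> = integral {m - 1..m} \<beta> + integral {m..u} \<beta>"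
        by (rule Henstock_Kurzweil_Integration.integral_combine[symmetric, OF _ _ integrable_continuous_real[OF continuous_on_subset[OF c]]])
          (use False in auto)
      moreover have "integral {m - 1..m} \<beta> = integral {m - 1..m} (\<lambda>x. 0)"
        using z by (intro integral_cong) auto
      ultimately show ?thesis by simp
    qed
  qed (use False in auto)
qed

lemma continuous_on_UNIV_zero_left:
  fixes f :: "real \<Rightarrow> real"
  assumes "\<delta> > 0" "\<And>r. r \<le> \<delta> \<Longrightarrow> f r = 0" "continuous_on {0<..} f"
  shows "continuous_on UNIV f"
proof -
  have "continuous_on {..<\<delta>} (\<lambda>r. 0 :: real)" by simp
  then have "continuous_on {..<\<delta>} f"
    by (rule continuous_on_cong[THEN iffD1, rotated 2]) (use assms(2) in auto)
  then have "continuous_on ({..<\<delta>} \<union> {0<..}) f"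
    using assms(3) by (intro continuous_on_open_Un) auto
  moreover have "{..<\<delta>} \<union> {0<..} = UNIV" using assms(1) by auto
  ultimately show ?thesis by simp
qed

lemma DERIV_mult_zero_left:
  fixes q g :: "real \<Rightarrow> real"
  assumes q: "\<And>r. (q has_real_derivative q' r) (at r)" and z: "\<And>r. r \<le> \<delta> \<Longrightarrow> q r = 0" "\<And>r. r \<le> \<delta> \<Longrightarrow> q' r = 0"
    and "\<delta> > 0" and g: "\<And>r. r > 0 \<Longrightarrow> (g has_real_derivative g' r) (at r)"
  shows "((\<lambda>r. q r * g r) has_real_derivative q' r * g r + q r * g' r) (at r)"
proof (cases "r > 0")
  case True
  then show ?thesis using q[of r] g[OF True] by (auto intro!: derivative_eq_intros)
next
  case False
  then have "((\<lambda>r. 0) has_real_derivative q' r * g r + q r * g' r) (at r)" using z[of r] \<open>\<delta> > 0\<close> by simp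
  then show ?thesis
    by (rule has_field_derivative_transform_within_open[of _ _ _ "{..<\<delta>}"]) (use False z \<open>\<delta> > 0\<close> in auto)
qed

text \<open>The norm is not differentiable at 0, but a profile that is constant near 0 hides this.
  Replacing \<open>norm x\<close> by \<open>max (norm x) \<delta>\<close> in the denominator then
  shows that the gradient is continuous.\<close>

lemma is_C1_radial:
  fixes K K' :: "real \<Rightarrow> real"
  assumes K: "\<And>r. (K has_real_derivative K' r) (at r)" and c: "continuous_on UNIV K'"
    and z: "\<And>r. r \<le> \<delta> \<Longrightarrow> K' r = 0" and "\<delta> > 0"
  shows "is_C1 (\<lambda>x::'a::euclidean_space. K (norm x)) (\<lambda>x. (K' (norm x) / norm x) *\<^sub>R x)"
  unfolding is_C1_def
proof (intro conjI allI)
  fix x :: 'a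
  show "GDERIV (\<lambda>x. K (norm x)) x :> (K' (norm x) / norm x) *\<^sub>R x"
  proof (cases "x = 0")
    case False
    from GDERIV_DERIV_compose[OF GDERIV_norm[OF False] K[of "norm x"]]
    show ?thesis by (simp add: sgn_div_norm divide_inverse)
  next
    case True
    have "K r = K 0" if "\<bar>r\<bar> < \<delta>" for r
    proof (rule has_field_derivative_zero_constant[of "{-\<delta><..<\<delta>}" K, THEN exE])
      show "(K has_real_derivative 0) (at x within {-\<delta><..<\<delta>})" if "x \<in> {-\<delta><..<\<delta>}" for x
        using K[of x] z[of x] that by (auto intro: has_field_derivative_at_within)
      show "K r = K 0" if "\<forall>x\<in>{-\<delta><..<\<delta>}. K x = k" for k
        using that \<open>\<bar>r\<bar> < \<delta>\<close> \<open>\<delta> > 0\<close> by (auto simp: abs_less_iff)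
    qed auto
    then have Kc: "K 0 = K (norm y)" if "y \<in> ball 0 \<delta>" for y :: 'a using that by (simp add: dist_norm)
    have "GDERIV (\<lambda>x::'a. K (norm x)) x :> 0"
      by (rule GDERIV_cong_open[OF GDERIV_const[of "K 0"] open_ball[of 0 \<delta>] _ Kc]) (use \<open>\<delta> > 0\<close> True in auto)
    then show ?thesis using True by simp
  qed
next
  have "(K' (norm x) / norm x) *\<^sub>R x = (K' (norm x) / max (norm x) \<delta>) *\<^sub>R x" for x :: 'a
    using z[of "norm x"] by (cases "norm x \<le> \<delta>") (auto simp: max_def)
  moreover have "continuous_on UNIV (\<lambda>x::'a. (K' (norm x) / max (norm x) \<delta>) *\<^sub>R x)"
    using \<open>\<delta> > 0\<close> by (intro continuous_intros continuous_on_compose2[OF c]) (auto simp: max_def)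
  ultimately show "continuous_on UNIV (\<lambda>x::'a. (K' (norm x) / norm x) *\<^sub>R x)" by (simp only:)
qed

lemma sum_inner_Basis_square: "(\<Sum>b\<in>Basis. (x \<bullet> b) * (x \<bullet> b)) = (norm x)\<^sup>2"
  by (simp add: power2_norm_eq_inner euclidean_inner[of x x])

text \<open>Integration by parts with the vector field \<open>q(|x|) |x|\<^sup>-\<^sup>N x\<close>, whose divergence is
  \<open>q'(|x|) |x|\<^sup>1\<^sup>-\<^sup>N\<close>.\<close>

lemma H1_0_radial_flux:
  fixes \<Omega> :: "'a::euclidean_space set"
  assumes u: "u \<in> H1_0 \<Omega>" and \<Omega>: "open \<Omega>" "bounded \<Omega>"
    and q: "\<And>r. (q has_real_derivative q' r) (at r)" and c: "continuous_on UNIV q'"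
    and z: "\<And>r. r \<le> \<delta> \<Longrightarrow> q r = 0" and "\<delta> > 0"
  shows "(LINT x|lebesgue_on \<Omega>. u x * (q' (norm x) / norm x ^ (DIM('a) - 1)))
      = - (LINT x|lebesgue_on \<Omega>. q (norm x) / norm x ^ DIM('a) * (x \<bullet> wgrad \<Omega> u x))"
proof -
  let ?N = "DIM('a)"
  \<comment> \<open>Half of \<delta>: every point up to \<open>d\<close> has a neighbourhood on
    which \<open>q\<close> vanishes, so \<open>q'\<close> vanishes there too.\<close>
  define d where "d = \<delta> / 2"
  have d: "d > 0" using \<open>\<delta> > 0\<close> by (simp add: d_def)
  have z': "q' r = 0" if "r \<le> d" for r
    by (rule DERIV_eq_0_of_locally_0[OF q[of r], of "{..<\<delta>}"]) (use that z d in \<open>auto simp: d_def\<close>)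
  have zd: "q r = 0" if "r \<le> d" for r using that z \<open>\<delta> > 0\<close> by (auto simp: d_def)
  define R where "R r = q r * inverse (r ^ ?N)" for r
  define R' where "R' r = q' r * inverse (r ^ ?N) + q r * (- real ?N * inverse (r ^ Suc ?N))" for r
  have R: "(R has_real_derivative R' r) (at r)" for r
    unfolding R_def[abs_def] R'_def
  proof (rule DERIV_mult_zero_left[OF q zd z' d])
    fix r :: real assume r: "r > 0"
    have "r ^ (?N - Suc 0) * (inverse (r ^ ?N) * inverse (r ^ ?N)) = inverse (r ^ Suc ?N)"
    proof -
      have "r ^ ?N = r * r ^ (?N - Suc 0)" using DIM_positive[where 'a='a] by (metis Suc_pred power_Suc One_nat_def)
      then show ?thesis using r by (simp add: field_simps)
    qed
    then show "((\<lambda>r. inverse (r ^ ?N)) has_real_derivative - real ?N * inverse (r ^ Suc ?N)) (at r)"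
      using r by (auto intro!: derivative_eq_intros simp del: power_Suc) (simp add: mult.assoc)
  qed
  have cR': "continuous_on UNIV R'"
  proof (rule continuous_on_UNIV_zero_left[OF d])
    show "R' r = 0" if "r \<le> d" for r using that z' zd by (simp add: R'_def)
    have "continuous_on {0<..} q" by (rule DERIV_continuous_on[OF has_field_derivative_at_within[OF q]])
    then show "continuous_on {0<..} R'"
      unfolding R'_def[abs_def] by (intro continuous_intros continuous_on_subset[OF c]) auto
  qed
  have R'z: "R' r = 0" if "r \<le> d" for r using that z' zd by (simp add: R'_def)
  \<comment> \<open>Gradient of the component along \<open>b\<close> of the vector field. Summing
    the integrations by parts over the basis produces its divergence.\<close>
  define G where "G b x = R (norm x) *\<^sub>R b + (x \<bullet> b) *\<^sub>R ((R' (norm x) / norm x) *\<^sub>R x)" for b x :: 'a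
  have G: "is_C1 (\<lambda>x. R (norm x) * (x \<bullet> b)) (G b)" for b :: 'a
    unfolding G_def by (rule is_C1_mult[OF is_C1_radial[OF R cR' R'z d] is_C1_inner])
  note P = H1_0_integration_by_parts[OF u \<Omega> G]
  have div: "(\<Sum>b\<in>Basis. G b x \<bullet> b) = q' (norm x) / norm x ^ (?N - 1)" for x :: 'a
  proof (cases "norm x \<le> d")
    case True
    then have "q' (norm x) = 0" "R' (norm x) = 0" "R (norm x) = 0" using z' R'z zd by (auto simp: R_def)
    then show ?thesis by (simp add: G_def)
  next
    case False
    then have x: "norm x > 0" using d by linarith
    have "(\<Sum>b\<in>Basis. G b x \<bullet> b) = (\<Sum>b\<in>Basis. R (norm x) + (R' (norm x) / norm x) * ((x \<bullet> b) * (x \<bullet> b)))"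
      by (rule sum.cong) (auto simp: G_def inner_add_left)
    also have "\<dots> = real ?N * R (norm x) + R' (norm x) / norm x * (norm x)\<^sup>2"
      unfolding sum.distrib sum_distrib_left[symmetric] sum_inner_Basis_square by simp
    also have "\<dots> = real ?N * R (norm x) + R' (norm x) * norm x"
      using x by (simp add: power2_eq_square)
    also have "\<dots> = q' (norm x) * inverse (norm x ^ ?N) * norm x"
      using x by (simp add: R_def R'_def field_simps)
    also have "norm x ^ ?N = norm x * norm x ^ (?N - 1)"
      using DIM_positive[where 'a='a] by (metis Suc_pred power_Suc One_nat_def)
    finally show ?thesis using x by (simp add: field_simps)
  qed
  have "(LINT x|lebesgue_on \<Omega>. u x * (q' (norm x) / norm x ^ (?N - 1)))
      = (LINT x|lebesgue_on \<Omega>. (\<Sum>b\<in>Basis. (u x *\<^sub>R G b x) \<bullet> b))"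
    by (simp only: div[symmetric] sum_distrib_left inner_scaleR_left)
  also have "\<dots> = (\<Sum>b\<in>Basis. (LINT x|lebesgue_on \<Omega>. u x *\<^sub>R G b x) \<bullet> b)"
  proof -
    have "(\<Sum>b\<in>Basis. (LINT x|lebesgue_on \<Omega>. u x *\<^sub>R G b x) \<bullet> b)
      = (\<Sum>b\<in>Basis. (LINT x|lebesgue_on \<Omega>. (u x *\<^sub>R G b x) \<bullet> b))"
      by (intro sum.cong refl integral_inner_left[symmetric] P(1))
    also have "\<dots> = (LINT x|lebesgue_on \<Omega>. (\<Sum>b\<in>Basis. (u x *\<^sub>R G b x) \<bullet> b))"
      by (intro Bochner_Integration.integral_sum[symmetric] integrable_inner_left P(1))
    finally show ?thesis by simp
  qed
  also have "\<dots> = - (\<Sum>b\<in>Basis. (LINT x|lebesgue_on \<Omega>. (R (norm x) * (x \<bullet> b)) *\<^sub>R wgrad \<Omega> u x) \<bullet> b)"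
    by (simp add: P(3) sum_negf)
  also have "\<dots> = - (LINT x|lebesgue_on \<Omega>. (\<Sum>b\<in>Basis. ((R (norm x) * (x \<bullet> b)) *\<^sub>R wgrad \<Omega> u x) \<bullet> b))"
  proof -
    have "(\<Sum>b\<in>Basis. (LINT x|lebesgue_on \<Omega>. (R (norm x) * (x \<bullet> b)) *\<^sub>R wgrad \<Omega> u x) \<bullet> b)
      = (\<Sum>b\<in>Basis. (LINT x|lebesgue_on \<Omega>. ((R (norm x) * (x \<bullet> b)) *\<^sub>R wgrad \<Omega> u x) \<bullet> b))"
      using P(2) by (intro sum.cong refl integral_inner_left[symmetric]) auto
    also have "\<dots> = (LINT x|lebesgue_on \<Omega>. (\<Sum>b\<in>Basis. ((R (norm x) * (x \<bullet> b)) *\<^sub>R wgrad \<Omega> u x) \<bullet> b))"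
      using P(2) by (intro Bochner_Integration.integral_sum[symmetric] integrable_inner_left) auto
    finally show ?thesis by simp
  qed
  also have "(\<lambda>x. \<Sum>b\<in>Basis. ((R (norm x) * (x \<bullet> b)) *\<^sub>R wgrad \<Omega> u x) \<bullet> b)
      = (\<lambda>x. q (norm x) / norm x ^ ?N * (x \<bullet> wgrad \<Omega> u x))"
    by (rule ext) (simp add: R_def euclidean_inner[of _ "wgrad \<Omega> u _"] sum_distrib_left divide_inverse mult_ac)
  finally show ?thesis .
qed

text \<open>Kernels concentrating at x, all supported in one compact subinterval. They turn
  orthogonality to test functions into pointwise identities.\<close>

definition approx_id :: "real \<Rightarrow> real \<Rightarrow> real \<Rightarrow> real \<Rightarrow> real \<Rightarrow> (nat \<Rightarrow> real \<Rightarrow> real) \<Rightarrow> bool" where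
  "approx_id c d x c' d' \<beta> \<longleftrightarrow> c < c' \<and> c' < d' \<and> d' < d \<and> (\<forall>n. continuous_on UNIV (\<beta> n)) \<and>
    (\<forall>n r. r \<notin> {c'<..<d'} \<longrightarrow> \<beta> n r = 0) \<and> (\<forall>n. integral {c..d} (\<beta> n) = 1) \<and>
    (\<forall>V. continuous_on {c..d} V \<longrightarrow> (\<lambda>n. integral {c..d} (\<lambda>r. V r * \<beta> n r)) \<longlonglongrightarrow> V x)"

lemma approx_idD:
  assumes "approx_id c d x c' d' \<beta>"
  shows "c < c'" "c' < d'" "d' < d" "\<And>n. continuous_on UNIV (\<beta> n)" "\<And>n r. r \<notin> {c'<..<d'} \<Longrightarrow> \<beta> n r = 0"
    "\<And>n. integral {c..d} (\<beta> n) = 1"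
    "\<And>V. continuous_on {c..d} V \<Longrightarrow> (\<lambda>n. integral {c..d} (\<lambda>r. V r * \<beta> n r)) \<longlonglongrightarrow> V x"
  using assms unfolding approx_id_def by blast+

lemma approx_id_exists:
  fixes c d x :: real
  assumes "c < x" "x < d"
  shows "\<exists>c' d' \<beta>. approx_id c d x c' d' \<beta>"
proof -
  define \<rho> where "\<rho> = min (x - c) (d - x) / 2"
  have \<rho>: "\<rho> > 0" "c < x - \<rho>" "x + \<rho> < d" using assms by (auto simp: \<rho>_def min_def field_simps)
  define \<delta> where "\<delta> n = \<rho> * inverse (real (Suc n))" for n
  have \<delta>: "\<delta> n > 0" "\<delta> n \<le> \<rho>" for n using \<rho>(1) by (auto simp: \<delta>_def field_simps)
  have \<delta>0: "\<delta> \<longlonglongrightarrow> 0" unfolding \<delta>_def by (intro tendsto_mult_right_zero LIMSEQ_inverse_real_of_nat)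
  \<comment> \<open>Tents of half-width \<open>\<delta> n\<close> around x, normalised by their mass
    \<open>M n\<close> below.\<close>
  define t where "t n r = max 0 (\<delta> n - \<bar>r - x\<bar>)" for n r
  define M where "M n = integral {c..d} (t n)" for n
  have ct: "continuous_on S (t n)" for S n unfolding t_def[abs_def] by (intro continuous_intros)
  have M: "M n > 0" for n
  proof -
    have "integral {c..d} (t n) \<noteq> 0"
    proof
      assume "integral {c..d} (t n) = 0"
      then have "\<forall>y\<in>{c..d}. t n y = 0"
        using integral_eq_0_iff[of c d "t n"] ct assms by (auto simp: t_def)
      then have "t n x = 0" using assms by auto
      then show False using \<delta>(1)[of n] by (simp add: t_def)
    qed
    moreover have "integral {c..d} (t n) \<ge> 0" using ct by (intro integral_nonneg integrable_continuous_real) (auto simp: t_def)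
    ultimately show ?thesis by (simp add: M_def)
  qed
  define \<beta> where "\<beta> n r = t n r / M n" for n r
  have "approx_id c d x (x - \<rho>) (x + \<rho>) \<beta>"
    unfolding approx_id_def
  proof (intro conjI allI impI)
    show cb: "continuous_on UNIV (\<beta> n)" for n
      unfolding \<beta>_def[abs_def] using M[of n] by (intro continuous_intros ct) auto
    have bz: "\<beta> n r = 0" if "\<delta> n \<le> \<bar>r - x\<bar>" for n r using that by (simp add: \<beta>_def t_def)
    show "\<beta> n r = 0" if "r \<notin> {x - \<rho><..<x + \<rho>}" for n r
      by (rule bz) (use that \<delta>(2)[of n] in \<open>auto simp: abs_if not_less\<close>)
    show b1: "integral {c..d} (\<beta> n) = 1" for n
      using M[of n] by (simp add: \<beta>_def[abs_def] M_def)
    have b0: "\<beta> n r \<ge> 0" for n r using M[of n] by (simp add: \<beta>_def t_def)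
    fix V :: "real \<Rightarrow> real" assume V: "continuous_on {c..d} V"
    show "(\<lambda>n. integral {c..d} (\<lambda>r. V r * \<beta> n r)) \<longlonglongrightarrow> V x"
    proof (rule LIMSEQ_I)
      fix e :: real assume e: "e > 0"
      have "x \<in> {c..d}" using assms by auto
      then obtain s where s: "s > 0" "\<And>r. r \<in> {c..d} \<Longrightarrow> \<bar>r - x\<bar> < s \<Longrightarrow> \<bar>V r - V x\<bar> < e / 2"
        using V[unfolded continuous_on_iff, rule_format, of x "e / 2"] e by (auto simp: dist_real_def)
      obtain n0 where n0: "\<And>n. n \<ge> n0 \<Longrightarrow> \<delta> n < s"
        using LIMSEQ_D[OF \<delta>0 s(1)] \<delta>(1) by (auto simp: abs_of_pos)
      have "norm (integral {c..d} (\<lambda>r. V r * \<beta> n r) - V x) < e" if n: "n \<ge> n0" for n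
      proof -
        have cb': "continuous_on {c..d} (\<beta> n)" using continuous_on_subset[OF cb] by auto
        have "integral {c..d} (\<lambda>r. V r * \<beta> n r) - V x = integral {c..d} (\<lambda>r. V r * \<beta> n r) - integral {c..d} (\<lambda>r. V x * \<beta> n r)"
          using b1[of n] by simp
        also have "\<dots> = integral {c..d} (\<lambda>r. (V r - V x) * \<beta> n r)"
          by (subst integral_diff[symmetric]) (auto intro!: integrable_continuous_real continuous_intros V cb' simp: left_diff_distrib)
        also have "norm \<dots> \<le> integral {c..d} (\<lambda>r. e / 2 * \<beta> n r)"
        proof (rule integral_norm_bound_integral)
          show "(\<lambda>r. (V r - V x) * \<beta> n r) integrable_on {c..d}" "(\<lambda>r. e / 2 * \<beta> n r) integrable_on {c..d}"
            by (intro integrable_continuous_real continuous_intros V cb')+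
          fix r assume r: "r \<in> {c..d}"
          show "norm ((V r - V x) * \<beta> n r) \<le> e / 2 * \<beta> n r"
          proof (cases "\<bar>r - x\<bar> < \<delta> n")
            case True
            then have "\<bar>V r - V x\<bar> \<le> e / 2" using s(2)[OF r] n0[OF n] by auto
            then show ?thesis using b0[of n r] mult_right_mono[of _ "e / 2" "\<beta> n r"] by (simp only: real_norm_def abs_mult abs_of_nonneg)
          next
            case False
            then show ?thesis using bz[of n r] by simp
          qed
        qed
        also have "\<dots> = e / 2" using b1[of n] by simp
        finally show ?thesis using e by simp
      qed
      then show "\<exists>no. \<forall>n\<ge>no. norm (integral {c..d} (\<lambda>r. V r * \<beta> n r) - V x) < e" by blast
    qed
  qed (use \<rho> in auto)
  then show ?thesis by blast
qed

text \<open>Ball and annulus are treated together: a = 0 stands for the ball, and then the centre is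
  an admissible radius.\<close>

locale radial_domain =
  fixes \<Omega> :: "'a::euclidean_space set" and a b :: real
  assumes a_nonneg: "0 \<le> a" and a_less_b: "a < b"
    and mem_iff: "x \<noteq> 0 \<Longrightarrow> x \<in> \<Omega> \<longleftrightarrow> a < norm x \<and> norm x < b"
    and zero_mem_iff: "0 \<in> \<Omega> \<longleftrightarrow> a = 0"
    and dim: "2 \<le> DIM('a)"
begin

definition radii :: "real set" where
  "radii = (if a = 0 then {0..<b} else {a<..<b})"

lemma mem_iff_radii: "x \<in> \<Omega> \<longleftrightarrow> norm x \<in> radii"
  using mem_iff[of x] zero_mem_iff a_nonneg a_less_b by (cases "x = 0") (auto simp: radii_def)

lemma radii_interior: "a < r \<Longrightarrow> r < b \<Longrightarrow> r \<in> radii"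
  using a_nonneg by (auto simp: radii_def)

lemma open_domain: "open \<Omega>"
proof -
  have "\<Omega> = (if a = 0 then norm -` {..<b} else norm -` {a<..<b})"
    unfolding set_eq_iff mem_iff_radii radii_def using a_nonneg by auto
  then show ?thesis by (auto intro!: open_vimage continuous_intros)
qed

lemma bounded_domain: "bounded \<Omega>"
proof (rule bounded_subset[OF bounded_ball])
  show "\<Omega> \<subseteq> ball 0 b" by (auto simp: mem_iff_radii radii_def split: if_splits)
qed

lemma lebesgue_domain: "\<Omega> \<in> sets lebesgue"
  using open_domain by (simp add: borel_open)

lemma polar_domain:
  fixes F :: "real \<Rightarrow> real"
  assumes "angular A C" "(\<lambda>r. F r * r ^ (DIM('a) - 1)) absolutely_integrable_on {a<..<b}"
  shows "integrable (lebesgue_on \<Omega>) (\<lambda>x. F (norm x) * A x)"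
    "(LINT x|lebesgue_on \<Omega>. F (norm x) * A x) = angular_mass A * integral {a<..<b} (\<lambda>r. F r * r ^ (DIM('a) - 1))"
proof -
  interpret angular A C by fact
  have S: "{a<..<b} \<subseteq> {0<..}" using a_nonneg by auto
  show "integrable (lebesgue_on \<Omega>) (\<lambda>x. F (norm x) * A x)"
    by (rule polar(1)[OF S assms(2) _ lebesgue_domain]) (auto simp: mem_iff)
  show "(LINT x|lebesgue_on \<Omega>. F (norm x) * A x) = angular_mass A * integral {a<..<b} (\<lambda>r. F r * r ^ (DIM('a) - 1))"
    by (rule polar(2)[OF S assms(2) _ lebesgue_domain]) (auto simp: mem_iff)
qed

end

section \<open>From the weak equation to the radial ODE\<close>

lemma angular_mass_one_pos: "angular_mass (\<lambda>x::'a::euclidean_space. 1) > 0"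
proof -
  have "0 < measure lborel (ball (0::'a) 1)" by (rule content_ball_pos) simp
  also have "\<dots> \<le> measure lborel (cball (0::'a) 1)"
    by (intro measure_mono_fmeasurable) (auto simp: fmeasurable_def intro!: emeasure_bounded_finite[unfolded infinity_ennreal_def])
  finally show ?thesis by (simp add: angular_mass_def)
qed

locale radial_solution = radial_domain \<Omega> a b for \<Omega> :: "'a::euclidean_space set" and a b +
  fixes \<alpha> :: real and f :: "real \<Rightarrow> real" and u :: "'a \<Rightarrow> real" and U :: "real \<Rightarrow> real"
  assumes \<alpha>_nonneg: "0 \<le> \<alpha>" and f_cont: "continuous_on UNIV f"
    and solution: "weak_solution \<Omega> \<alpha> f u"
    and u_radial: "x \<in> \<Omega> \<Longrightarrow> u x = U (norm x)"
    and U_cont: "continuous_on radii U"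
begin

definition \<sigma> :: real where "\<sigma> = \<alpha> + real DIM('a) - 1"

definition source :: "real \<Rightarrow> real" where "source r = r powr \<sigma> * f (U r)"

lemma \<sigma>_ge_1: "\<sigma> \<ge> 1" using \<alpha>_nonneg dim by (simp add: \<sigma>_def)

lemma powr_\<sigma>: "0 \<le> r \<Longrightarrow> r powr \<alpha> * r ^ (DIM('a) - 1) = r powr \<sigma>"
  using dim by (cases "r = 0") (auto simp: \<sigma>_def powr_realpow[symmetric] powr_add[symmetric] of_nat_diff algebra_simps)

text \<open>As \<sigma> \<ge> 1, the weight is continuous at the centre of a ball even for \<alpha>
  = 0, where \<open>0 powr \<alpha>\<close> is 0.\<close>

lemma source_cont: "continuous_on radii source"
proof -
  have "radii \<subseteq> {0..}" using a_nonneg by (auto simp: radii_def)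
  then have "continuous_on radii (\<lambda>r. r powr \<sigma>)"
    using \<sigma>_ge_1 by (intro continuous_on_powr' continuous_intros) auto
  moreover have "continuous_on radii (\<lambda>r. f (U r))"
    by (rule continuous_on_compose2[OF f_cont U_cont]) auto
  ultimately show ?thesis unfolding source_def[abs_def] by (rule continuous_on_mult)
qed

text \<open>In the ball the source is integrated from the origin, which singles out the regular solution.\<close>

definition base :: "real \<Rightarrow> real" where "base c = (if a = 0 then 0 else c)"

lemma base: "a < c \<Longrightarrow> base c \<le> c" "a < c \<Longrightarrow> c < b \<Longrightarrow> {base c..c} \<subseteq> radii" "0 \<le> c \<Longrightarrow> 0 \<le> base c"
  using a_nonneg by (auto simp: base_def radii_def)

lemma subset_radii: "a < c \<Longrightarrow> d < b \<Longrightarrow> {c..d} \<subseteq> radii" "a < c \<Longrightarrow> d < b \<Longrightarrow> {base c..d} \<subseteq> radii"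
  using a_nonneg by (auto simp: base_def radii_def)

text \<open>The equation is tested with K(|x|), where K' = q r^(1-N); the flux formula moves the
  derivative from \<open>u\<close> to \<open>q\<close>. On an annulus \<open>K\<close> must vanish
  near the inner boundary. On a ball it may be a nonzero constant near the centre, and this extra
  freedom selects the regular solution.\<close>

lemma weak_form:
  fixes q q' K :: "real \<Rightarrow> real"
  assumes cd: "a < c" "c < d" "d < b"
    and q: "\<And>r. (q has_real_derivative q' r) (at r)" and q'c: "continuous_on UNIV q'"
    and qz: "\<And>r. r \<le> c \<Longrightarrow> q r = 0" "\<And>r. d \<le> r \<Longrightarrow> q r = 0"
    and K: "\<And>r. (K has_real_derivative q r / r ^ (DIM('a) - 1)) (at r)"
    and Kz: "\<And>r. d \<le> r \<Longrightarrow> K r = 0" "\<And>r. a \<noteq> 0 \<Longrightarrow> r \<le> c \<Longrightarrow> K r = 0"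
  shows "integral {c..d} (\<lambda>r. U r * q' r) = - integral {base c..d} (\<lambda>r. source r * K r)"
proof -
  have c0: "c > 0" using cd a_nonneg by linarith
  have qc: "continuous_on S q" for S
    by (rule DERIV_continuous_on[OF has_field_derivative_at_within[OF q]])
  have Kc: "continuous_on S K" for S
    by (rule DERIV_continuous_on[OF has_field_derivative_at_within[OF K]])
  have q'z: "q' r = 0" if "r < c \<or> d < r" for r
    by (rule DERIV_eq_0_of_locally_0[OF q[of r], of "{..<c} \<union> {d<..}"]) (use that qz in auto)
  have K'c: "continuous_on UNIV (\<lambda>r. q r / r ^ (DIM('a) - 1))"
    by (rule continuous_on_UNIV_zero_left[OF c0]) (auto simp: qz intro!: continuous_intros qc)
  define \<phi> where "\<phi> x = K (norm x)" for x :: 'a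
  have C1: "is_C1 \<phi> (\<lambda>x. (q (norm x) / norm x ^ (DIM('a) - 1) / norm x) *\<^sub>R x)"
    unfolding \<phi>_def[abs_def] by (rule is_C1_radial[OF K K'c _ c0]) (simp add: qz)
  have \<phi>: "\<phi> \<in> C1_0 \<Omega>"
  proof (rule C1_0_I[OF C1])
    show "compact (if a = 0 then cball 0 d else cball 0 d - ball (0::'a) c)"
      by (auto intro: compact_diff)
    show "(if a = 0 then cball 0 d else cball 0 d - ball (0::'a) c) \<subseteq> \<Omega>"
      unfolding subset_eq mem_iff_radii radii_def using cd by auto
    show "\<phi> x = 0" if "x \<notin> (if a = 0 then cball 0 d else cball 0 d - ball (0::'a) c)" for x
      using that Kz[of "norm x"] by (auto simp: \<phi>_def split: if_splits)
  qed
  have g: "grad \<phi> x = (q (norm x) / norm x ^ (DIM('a) - 1) / norm x) *\<^sub>R x" for x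
    using is_C1_imp_grad[OF C1] by simp
  have pow: "r ^ DIM('a) = r ^ (DIM('a) - 1) * r" for r :: real using dim by (metis Suc_diff_1 DIM_positive power_Suc2)
  have e1: "wgrad \<Omega> u x \<bullet> grad \<phi> x = q (norm x) / norm x ^ DIM('a) * (x \<bullet> wgrad \<Omega> u x)" for x
    by (simp add: g pow inner_commute)
  have u: "u \<in> H1_0 \<Omega>" using solution by (simp add: weak_solution_def)
  have "(LINT x|lebesgue_on \<Omega>. norm x powr \<alpha> * f (u x) * \<phi> x) = (LINT x|lebesgue_on \<Omega>. wgrad \<Omega> u x \<bullet> grad \<phi> x)"
    using solution \<phi> by (simp add: weak_solution_def)
  also have "\<dots> = - (LINT x|lebesgue_on \<Omega>. u x * (q' (norm x) / norm x ^ (DIM('a) - 1)))"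
    unfolding e1 using H1_0_radial_flux[OF u open_domain bounded_domain q q'c qz(1) c0] by simp
  also have "(LINT x|lebesgue_on \<Omega>. u x * (q' (norm x) / norm x ^ (DIM('a) - 1)))
      = (LINT x|lebesgue_on \<Omega>. U (norm x) * (q' (norm x) / norm x ^ (DIM('a) - 1)) * 1)"
    by (rule Bochner_Integration.integral_cong) (auto simp: u_radial)
  also have "(LINT x|lebesgue_on \<Omega>. norm x powr \<alpha> * f (u x) * \<phi> x)
      = (LINT x|lebesgue_on \<Omega>. norm x powr \<alpha> * f (U (norm x)) * K (norm x) * 1)"
    by (rule Bochner_Integration.integral_cong) (auto simp: u_radial \<phi>_def)
  finally have main: "(LINT x|lebesgue_on \<Omega>. norm x powr \<alpha> * f (U (norm x)) * K (norm x) * 1)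
      = - (LINT x|lebesgue_on \<Omega>. U (norm x) * (q' (norm x) / norm x ^ (DIM('a) - 1)) * 1)" .
  have i1: "(\<lambda>r. U r * q' r) absolutely_integrable_on {a<..<b}"
      "integral {a<..<b} (\<lambda>r. U r * q' r) = integral {c..d} (\<lambda>r. U r * q' r)"
  proof -
    have "continuous_on {c..d} (\<lambda>r. U r * q' r)"
      using subset_radii(1)[OF cd(1,3)]
      by (intro continuous_intros continuous_on_subset[OF U_cont] continuous_on_subset[OF q'c]) auto
    moreover have "negligible ({c..d} - {a<..<b})"
      using cd by (simp add: Diff_eq_empty_iff[THEN iffD2] atLeastatMost_subset_iff subset_eq)
    ultimately show "(\<lambda>r. U r * q' r) absolutely_integrable_on {a<..<b}"
      "integral {a<..<b} (\<lambda>r. U r * q' r) = integral {c..d} (\<lambda>r. U r * q' r)"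
      using q'z by (auto intro!: absolutely_integrable_continuous_extend_zero)
  qed
  have i2: "(\<lambda>r. source r * K r) absolutely_integrable_on {a<..<b}"
      "integral {a<..<b} (\<lambda>r. source r * K r) = integral {base c..d} (\<lambda>r. source r * K r)"
  proof -
    have 1: "continuous_on {base c..d} (\<lambda>r. source r * K r)"
      using subset_radii(2)[OF cd(1,3)] by (intro continuous_intros continuous_on_subset[OF source_cont] Kc) auto
    have "{base c..d} - {a<..<b} \<subseteq> {0}" using cd a_nonneg by (auto simp: base_def split: if_splits)
    then have 2: "negligible ({base c..d} - {a<..<b})" by (rule negligible_subset[rotated]) simp
    have 3: "source r * K r = 0" if "r \<in> {a<..<b}" "r \<notin> {base c..d}" for r
      using that Kz[of r] a_nonneg by (auto simp: base_def split: if_splits)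
    show "(\<lambda>r. source r * K r) absolutely_integrable_on {a<..<b}"
      "integral {a<..<b} (\<lambda>r. source r * K r) = integral {base c..d} (\<lambda>r. source r * K r)"
      by (rule absolutely_integrable_continuous_extend_zero[OF 1 3 2]; assumption)+
  qed
  have r1: "U r * (q' r / r ^ (DIM('a) - 1)) * r ^ (DIM('a) - 1) = U r * q' r" if "r \<in> {a<..<b}" for r
    using that a_nonneg by simp
  have r2: "r powr \<alpha> * f (U r) * K r * r ^ (DIM('a) - 1) = source r * K r" if "r \<in> {a<..<b}" for r
    using that a_nonneg powr_\<sigma>[of r] by (simp add: source_def mult_ac)
  have a1: "(\<lambda>r. U r * (q' r / r ^ (DIM('a) - 1)) * r ^ (DIM('a) - 1)) absolutely_integrable_on {a<..<b}"
    by (rule absolutely_integrable_spike[OF i1(1) negligible_empty]) (use r1 in auto)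
  have a2: "(\<lambda>r. r powr \<alpha> * f (U r) * K r * r ^ (DIM('a) - 1)) absolutely_integrable_on {a<..<b}"
    by (rule absolutely_integrable_spike[OF i2(1) negligible_empty]) (use r2 in auto)
  have one: "angular (\<lambda>x::'a. 1) 1" by unfold_locales
  have "angular_mass (\<lambda>x::'a. 1) * integral {a<..<b} (\<lambda>r. r powr \<alpha> * f (U r) * K r * r ^ (DIM('a) - 1))
      = - (angular_mass (\<lambda>x::'a. 1) * integral {a<..<b} (\<lambda>r. U r * (q' r / r ^ (DIM('a) - 1)) * r ^ (DIM('a) - 1)))"
    using main polar_domain(2)[OF one a1] polar_domain(2)[OF one a2] by simp
  also have "integral {a<..<b} (\<lambda>r. r powr \<alpha> * f (U r) * K r * r ^ (DIM('a) - 1)) = integral {a<..<b} (\<lambda>r. source r * K r)"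
    by (rule integral_cong) (rule r2)
  also have "integral {a<..<b} (\<lambda>r. U r * (q' r / r ^ (DIM('a) - 1)) * r ^ (DIM('a) - 1)) = integral {a<..<b} (\<lambda>r. U r * q' r)"
    by (rule integral_cong) (rule r1)
  finally have "angular_mass (\<lambda>x::'a. 1) * (integral {c..d} (\<lambda>r. U r * q' r) + integral {base c..d} (\<lambda>r. source r * K r)) = 0"
    unfolding i1(2) i2(2) distrib_left by simp
  then show ?thesis using angular_mass_one_pos[where 'a='a] by (simp add: eq_neg_iff_add_eq_0)
qed

definition flux_integral :: "real \<Rightarrow> real \<Rightarrow> real" where
  "flux_integral c r = integral {base c..r} source"

lemma flux_integral_cont:
  assumes "a < c" "d < b" shows "continuous_on {base c..d} (flux_integral c)"
  unfolding flux_integral_def[abs_def] using subset_radii(2)[OF assms]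
  by (intro indefinite_integral_continuous_1 integrable_continuous_real continuous_on_subset[OF source_cont])

lemma flux_integral_DERIV:
  assumes "a < c" "d < b" "base c < r" "r < d"
  shows "(flux_integral c has_real_derivative source r) (at r)"
  unfolding flux_integral_def[abs_def] using subset_radii(2)[OF assms(1,2)] assms(3,4)
  by (intro integral_has_real_derivative_interior continuous_on_subset[OF source_cont]) auto

text \<open>Two integrations by parts express the weak form through \<beta> = q'. Mean zero makes
  \<open>q\<close> vanish to the right of the support of \<beta>; on an annulus the second condition
  makes \<open>K\<close> vanish to the left.\<close>

lemma weak_form_dual:
  fixes \<beta> :: "real \<Rightarrow> real"
  assumes cd: "a < c" "c < d" "d < b"
    and \<beta>: "continuous_on UNIV \<beta>" and cd': "c < c'" "c' < d'" "d' < d" and \<beta>z: "\<And>r. r \<notin> {c'<..<d'} \<Longrightarrow> \<beta> r = 0"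
    and \<beta>0: "integral {c..d} \<beta> = 0"
    and \<beta>1: "a \<noteq> 0 \<Longrightarrow> integral {c..d} (\<lambda>r. integral {c..r} (\<lambda>s. 1 / s ^ (DIM('a) - 1)) * \<beta> r) = 0"
  shows "integral {c..d} (\<lambda>r. (U r + integral {c..r} (\<lambda>s. flux_integral c s / s ^ (DIM('a) - 1))) * \<beta> r) = 0"
proof -
  have c0: "c > 0" using cd a_nonneg by linarith
  have bc: "base c \<le> c" using base(1)[OF cd(1)] .
  define q where "q r = integral {c'..r} \<beta>" for r
  have q: "(q has_real_derivative \<beta> r) (at r)" for r
    unfolding q_def[abs_def] by (rule integral_DERIV_zero_left[OF \<beta>]) (auto simp: \<beta>z)
  have qz1: "q r = 0" if "r \<le> c'" for r using that by (cases "r = c'") (auto simp: q_def)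
  have \<beta>c: "continuous_on S \<beta>" for S using continuous_on_subset[OF \<beta>] by auto
  have qz2: "q r = 0" if "d' \<le> r" for r
  proof -
    have "integral {c'..r} \<beta> = integral {c'..d'} \<beta>"
      by (rule absolutely_integrable_continuous_extend_zero(2)[OF \<beta>c]) (use that \<beta>z in auto)
    also have "\<dots> = integral {c..d} \<beta>"
      by (rule absolutely_integrable_continuous_extend_zero(2)[OF \<beta>c, symmetric]) (use cd' \<beta>z in \<open>auto simp: Diff_eq_empty_iff[THEN iffD2]\<close>)
    finally show ?thesis using \<beta>0 by (simp add: q_def)
  qed
  have qc: "continuous_on S q" for S
    by (rule DERIV_continuous_on[OF has_field_derivative_at_within[OF q]])
  define k where "k r = q r / r ^ (DIM('a) - 1)" for r
  have kc: "continuous_on UNIV k"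
    unfolding k_def by (rule continuous_on_UNIV_zero_left[OF c0]) (use cd' in \<open>auto simp: qz1 intro!: continuous_intros qc\<close>)
  have kc': "continuous_on S k" for S using continuous_on_subset[OF kc] by auto
  \<comment> \<open>The constant is chosen so that \<open>K\<close> vanishes from \<open>d\<close>
    on.\<close>
  define K where "K r = integral {c'..r} k - integral {c'..d} k" for r
  have K: "(K has_real_derivative q r / r ^ (DIM('a) - 1)) (at r)" for r
  proof -
    have "((\<lambda>r. integral {c'..r} k) has_real_derivative k r) (at r)"
      by (rule integral_DERIV_zero_left[OF kc]) (simp add: k_def qz1)
    then show ?thesis unfolding K_def[abs_def] k_def by (auto intro!: derivative_eq_intros)
  qed
  have Kz: "K r = 0" if "d \<le> r" for r
  proof -
    have "integral {c'..r} k = integral {c'..d} k"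
      by (rule absolutely_integrable_continuous_extend_zero(2)[OF kc']) (use that cd' qz2 in \<open>auto simp: k_def\<close>)
    then show ?thesis by (simp add: K_def)
  qed
  have Kz2: "K r = 0" if "a \<noteq> 0" "r \<le> c" for r
  proof -
    \<comment> \<open>\<open>W\<close> is a primitive of r^(1-N). By parts, the total integral of
      \<open>k\<close> is minus that of \<open>W * \<beta>\<close>, which is 0 by
      assumption.\<close>
    define W where "W r = integral {c..r} (\<lambda>s. 1 / s ^ (DIM('a) - 1))" for r
    have w: "continuous_on {c..d} (\<lambda>s. 1 / s ^ (DIM('a) - 1))" using c0 by (intro continuous_intros) auto
    have Wc: "continuous_on {c..d} W" unfolding W_def[abs_def]
      by (intro indefinite_integral_continuous_1 integrable_continuous_real w)
    have Wd: "(W has_real_derivative 1 / s ^ (DIM('a) - 1)) (at s)" if "s \<in> {c<..<d}" for s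
      unfolding W_def[abs_def] by (rule integral_has_real_derivative_interior[OF w]) (use that in auto)
    have "(\<lambda>s. 1 / s ^ (DIM('a) - 1) * q s) integrable_on {c..d}"
      by (intro integrable_continuous_real continuous_on_mult w qc)
    from integral_by_parts_real(2)[OF _ Wc qc Wd q this]
    have "integral {c..d} (\<lambda>s. W s * \<beta> s) = W d * q d - W c * q c - integral {c..d} (\<lambda>s. 1 / s ^ (DIM('a) - 1) * q s)"
      using cd by simp
    moreover have "q d = 0" using qz2[of d] cd' by simp
    moreover have "W c = 0" by (simp add: W_def)
    moreover have "(\<lambda>s. 1 / s ^ (DIM('a) - 1) * q s) = k" by (simp add: k_def fun_eq_iff)
    ultimately have "integral {c..d} k = 0" using \<beta>1[OF \<open>a \<noteq> 0\<close>] by (simp add: W_def)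
    moreover have "integral {c..d} k = integral {c'..d} k"
      by (rule absolutely_integrable_continuous_extend_zero(2)[OF kc']) (use cd' qz1 in \<open>auto simp: k_def Diff_eq_empty_iff[THEN iffD2]\<close>)
    ultimately show ?thesis using that cd' by (simp add: K_def)
  qed
  have wf: "integral {c..d} (\<lambda>r. U r * \<beta> r) = - integral {base c..d} (\<lambda>r. source r * K r)"
    by (rule weak_form[OF cd q \<beta> _ _ K Kz Kz2]) (use qz1 qz2 cd' in auto)
  have Kc: "continuous_on S K" for S
    by (rule DERIV_continuous_on[OF has_field_derivative_at_within[OF K]])
  have Gc: "continuous_on {base c..d} (flux_integral c)" by (rule flux_integral_cont[OF cd(1,3)])
  have ki: "(\<lambda>r. q r / r ^ (DIM('a) - 1) * flux_integral c r) integrable_on {base c..d}"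
    by (intro integrable_continuous_real continuous_on_mult Gc kc'[unfolded k_def])
  have "integral {base c..d} (\<lambda>r. K r * source r)
      = K d * flux_integral c d - K (base c) * flux_integral c (base c) - integral {base c..d} (\<lambda>r. q r / r ^ (DIM('a) - 1) * flux_integral c r)"
    by (rule integral_by_parts_real(2)[OF _ Kc Gc K flux_integral_DERIV[OF cd(1,3)] ki]) (use bc cd in auto)
  then have e1: "integral {base c..d} (\<lambda>r. source r * K r) = - integral {base c..d} (\<lambda>r. q r / r ^ (DIM('a) - 1) * flux_integral c r)"
    using Kz[of d] by (simp add: mult.commute flux_integral_def)
  have Gc': "continuous_on {c..d} (flux_integral c)" by (rule continuous_on_subset[OF Gc]) (use bc in auto)
  define h where "h s = flux_integral c s / s ^ (DIM('a) - 1)" for s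
  have hc: "continuous_on {c..d} h" unfolding h_def[abs_def] using c0 by (intro continuous_intros Gc') auto
  define H where "H r = integral {c..r} h" for r
  have Hc: "continuous_on {c..d} H" unfolding H_def[abs_def]
    by (intro indefinite_integral_continuous_1 integrable_continuous_real hc)
  have Hd: "(H has_real_derivative h s) (at s)" if "s \<in> {c<..<d}" for s
    unfolding H_def[abs_def] by (rule integral_has_real_derivative_interior[OF hc]) (use that in auto)
  have "integral {base c..d} (\<lambda>r. q r / r ^ (DIM('a) - 1) * flux_integral c r) = integral {c..d} (\<lambda>r. q r / r ^ (DIM('a) - 1) * flux_integral c r)"
    by (rule absolutely_integrable_continuous_extend_zero(2)[OF continuous_on_mult[OF kc'[unfolded k_def] Gc']])
      (use bc cd' qz1 in \<open>auto simp: Diff_eq_empty_iff[THEN iffD2]\<close>)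
  also have "\<dots> = integral {c..d} (\<lambda>r. q r * h r)" by (simp add: h_def)
  also have "\<dots> = q d * H d - q c * H c - integral {c..d} (\<lambda>r. \<beta> r * H r)"
    by (rule integral_by_parts_real(2)[OF _ qc Hc q Hd]) (use cd in \<open>auto intro!: integrable_continuous_real continuous_on_mult \<beta>c Hc\<close>)
  also have "\<dots> = - integral {c..d} (\<lambda>r. \<beta> r * H r)" using qz2[of d] qz1[of c] cd' by simp
  finally have "integral {c..d} (\<lambda>r. U r * \<beta> r) = - integral {c..d} (\<lambda>r. \<beta> r * H r)"
    using wf e1 by simp
  moreover have "continuous_on {c..d} U" by (rule continuous_on_subset[OF U_cont subset_radii(1)[OF cd(1,3)]])
  ultimately have "integral {c..d} (\<lambda>r. U r * \<beta> r + \<beta> r * H r) = 0"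
    using Hc by (subst integral_add) (auto intro!: integrable_continuous_real continuous_on_mult \<beta>c)
  then have "integral {c..d} (\<lambda>r. (U r + H r) * \<beta> r) = 0" by (simp add: algebra_simps)
  then show ?thesis by (simp add: H_def h_def[abs_def])
qed

text \<open>A du Bois-Reymond argument: V = U + H is orthogonal to every test function \<beta>
  orthogonal to 1 and, on an annulus, to W. Hence V is affine in W on an annulus, and constant on a
  ball, where therefore D = 0. Differentiating V = A + D W gives the ODE.\<close>

lemma local_ODE:
  assumes cd: "a < c" "c < d" "d < b"
  obtains D where "a = 0 \<Longrightarrow> D = 0"
    "\<And>r. c < r \<Longrightarrow> r < d \<Longrightarrow> (U has_real_derivative (D - flux_integral c r) / r ^ (DIM('a) - 1)) (at r)"
proof -
  have c0: "c > 0" using cd a_nonneg by linarith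
  have bc: "base c \<le> c" using base(1)[OF cd(1)] .
  define w where "w s = 1 / s ^ (DIM('a) - 1)" for s :: real
  define h where "h s = flux_integral c s / s ^ (DIM('a) - 1)" for s
  define W where "W r = integral {c..r} w" for r
  define H where "H r = integral {c..r} h" for r
  define V where "V r = U r + H r" for r
  have wc: "continuous_on {c..d} w" unfolding w_def[abs_def] using c0 by (intro continuous_intros) auto
  have "continuous_on {c..d} (flux_integral c)"
    by (rule continuous_on_subset[OF flux_integral_cont[OF cd(1,3)]]) (use bc in auto)
  then have hc: "continuous_on {c..d} h" unfolding h_def[abs_def] using c0 by (intro continuous_intros) auto
  have cont: "continuous_on {c..d} W" "continuous_on {c..d} H"
    unfolding W_def[abs_def] H_def[abs_def]
    by (intro indefinite_integral_continuous_1 integrable_continuous_real wc hc)+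
  have Uc: "continuous_on {c..d} U" by (rule continuous_on_subset[OF U_cont subset_radii(1)[OF cd(1,3)]])
  have Vc: "continuous_on {c..d} V" unfolding V_def[abs_def] by (intro continuous_intros Uc cont)
  have deriv: "(W has_real_derivative w s) (at s)" "(H has_real_derivative h s) (at s)" if "c < s" "s < d" for s
    unfolding W_def[abs_def] H_def[abs_def]
    by (rule integral_has_real_derivative_interior[OF wc that] integral_has_real_derivative_interior[OF hc that])+
  have dual: "integral {c..d} (\<lambda>r. V r * \<beta> r) = 0"
    if "continuous_on UNIV \<beta>" "c < c'" "c' < d'" "d' < d" "\<And>r. r \<notin> {c'<..<d'} \<Longrightarrow> \<beta> r = 0"
      "integral {c..d} \<beta> = 0" "a \<noteq> 0 \<Longrightarrow> integral {c..d} (\<lambda>r. W r * \<beta> r) = 0" for \<beta> c' d'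
    using weak_form_dual[OF cd that(1-6)] that(7)
    unfolding V_def H_def h_def[abs_def] W_def w_def[abs_def] by simp
  \<comment> \<open>The slope of V against W, read off at two fixed points. W is strictly
    increasing, so the denominator is nonzero.\<close>
  define D where "D = (if a = 0 then 0 else (V ((c + d) / 2) - V ((2 * c + d) / 3)) / (W ((c + d) / 2) - W ((2 * c + d) / 3)))"
  have "\<exists>A. \<forall>x. c < x \<and> x < d \<longrightarrow> V x = A + D * W x"
  proof -
    define y where "y = (2 * c + d) / 3"
    define z where "z = (c + d) / 2"
    have yz: "c < y" "y < z" "z < d" using cd by (auto simp: y_def z_def)
    have "W y < W z"
    proof (rule DERIV_pos_imp_increasing[OF yz(2)])
      fix x assume "y \<le> x" "x \<le> z"
      then show "\<exists>l. (W has_real_derivative l) (at x) \<and> 0 < l"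
        using deriv(1)[of x] yz c0 by (intro exI[of _ "w x"]) (auto simp: w_def)
    qed
    then have Wyz: "W z - W y \<noteq> 0" by simp
    obtain cy dy \<beta>y where "approx_id c d y cy dy \<beta>y"
      using approx_id_exists[OF yz(1) less_trans[OF yz(2,3)]] by blast
    note y = approx_idD[OF this]
    obtain cz dz \<beta>z where "approx_id c d z cz dz \<beta>z"
      using approx_id_exists[OF less_trans[OF yz(1,2)] yz(3)] by blast
    note z = approx_idD[OF this]
    have "V x = (V y - D * W y) + D * W x" if x: "c < x" "x < d" for x
    proof -
      obtain cx dx \<beta>x where "approx_id c d x cx dx \<beta>x"
        using approx_id_exists[OF x] by blast
      note x = approx_idD[OF this]
      define c' where "c' = min cx (min cy cz)"
      define d' where "d' = max dx (max dy dz)"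
      have c'd': "c < c'" "c' < d'" "d' < d" using x(1-3) y(1-3) z(1-3) by (auto simp: c'_def d'_def)
      have comb: "integral {c..d} (\<lambda>r. F r * (A * \<beta>x n r + B * \<beta>y n r + C * \<beta>z n r))
          = A * integral {c..d} (\<lambda>r. F r * \<beta>x n r) + B * integral {c..d} (\<lambda>r. F r * \<beta>y n r) + C * integral {c..d} (\<lambda>r. F r * \<beta>z n r)"
        if F: "continuous_on {c..d} F" for F A B C n
      proof -
        have i: "(\<lambda>r. F r * \<beta>x n r) integrable_on {c..d}" "(\<lambda>r. F r * \<beta>y n r) integrable_on {c..d}" "(\<lambda>r. F r * \<beta>z n r) integrable_on {c..d}"
          using continuous_on_subset[OF x(4)] continuous_on_subset[OF y(4)] continuous_on_subset[OF z(4)]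
          by (auto intro!: integrable_continuous_real continuous_on_mult F)
        have "((\<lambda>r. A * (F r * \<beta>x n r) + B * (F r * \<beta>y n r) + C * (F r * \<beta>z n r)) has_integral
            A * integral {c..d} (\<lambda>r. F r * \<beta>x n r) + B * integral {c..d} (\<lambda>r. F r * \<beta>y n r) + C * integral {c..d} (\<lambda>r. F r * \<beta>z n r)) {c..d}"
          by (intro has_integral_add has_integral_mult_right integrable_integral i)
        moreover have "(\<lambda>r. A * (F r * \<beta>x n r) + B * (F r * \<beta>y n r) + C * (F r * \<beta>z n r))
            = (\<lambda>r. F r * (A * \<beta>x n r + B * \<beta>y n r + C * \<beta>z n r))" by (simp add: fun_eq_iff algebra_simps)
        ultimately show ?thesis by (simp add: integral_unique)
      qed
      have comb1: "integral {c..d} (\<lambda>r. A * \<beta>x n r + B * \<beta>y n r + C * \<beta>z n r) = A + B + C" for A B C n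
        using comb[of "\<lambda>_. 1" A n B C] x(6) y(6) z(6) by simp
      have test: "A * integral {c..d} (\<lambda>r. V r * \<beta>x n r) + B * integral {c..d} (\<lambda>r. V r * \<beta>y n r) + C * integral {c..d} (\<lambda>r. V r * \<beta>z n r) = 0"
        if "A + B + C = 0" "a \<noteq> 0 \<Longrightarrow> A * integral {c..d} (\<lambda>r. W r * \<beta>x n r) + B * integral {c..d} (\<lambda>r. W r * \<beta>y n r) + C * integral {c..d} (\<lambda>r. W r * \<beta>z n r) = 0"
        for A B C n
        unfolding comb[OF Vc, symmetric]
      proof (rule dual[OF _ c'd'])
        show "continuous_on UNIV (\<lambda>r. A * \<beta>x n r + B * \<beta>y n r + C * \<beta>z n r)"
          by (intro continuous_intros x(4) y(4) z(4))
        show "A * \<beta>x n r + B * \<beta>y n r + C * \<beta>z n r = 0" if "r \<notin> {c'<..<d'}" for r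
        proof -
          have "r \<notin> {cx<..<dx}" "r \<notin> {cy<..<dy}" "r \<notin> {cz<..<dz}" using that by (auto simp: c'_def d'_def)
          then show ?thesis using x(5) y(5) z(5) by simp
        qed
      qed (use that comb1 comb[OF cont(1)] in auto)
      show ?thesis
      proof (cases "a = 0")
        case True
        have "integral {c..d} (\<lambda>r. V r * \<beta>x n r) - integral {c..d} (\<lambda>r. V r * \<beta>y n r) = 0" for n
          using test[of 1 "-1" 0 n] True by simp
        moreover have "(\<lambda>n. integral {c..d} (\<lambda>r. V r * \<beta>x n r) - integral {c..d} (\<lambda>r. V r * \<beta>y n r)) \<longlonglongrightarrow> V x - V y"
          by (intro tendsto_diff x(7) y(7) Vc)
        ultimately have "V x - V y = 0" by (simp add: LIMSEQ_const_iff)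
        then show ?thesis using True by (simp add: D_def)
      next
        case False
        let ?X = "\<lambda>F n. integral {c..d} (\<lambda>r. F r * \<beta>x n r)" and ?Y = "\<lambda>F n. integral {c..d} (\<lambda>r. F r * \<beta>y n r)"
          and ?Z = "\<lambda>F n. integral {c..d} (\<lambda>r. F r * \<beta>z n r)"
        \<comment> \<open>Coefficients as in a cross product: both their sum and their pairing with
          the mollified values of W vanish identically, so the combined kernel is admissible for
          every n, before passing to the limit.\<close>
        have "(?Y W n - ?Z W n) * ?X V n + (?Z W n - ?X W n) * ?Y V n + (?X W n - ?Y W n) * ?Z V n = 0" for n
          by (rule test) (simp_all add: algebra_simps)
        moreover have "(\<lambda>n. (?Y W n - ?Z W n) * ?X V n + (?Z W n - ?X W n) * ?Y V n + (?X W n - ?Y W n) * ?Z V n)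
            \<longlonglongrightarrow> (W y - W z) * V x + (W z - W x) * V y + (W x - W y) * V z"
          by (intro tendsto_intros x(7) y(7) z(7) Vc cont)
        ultimately have e: "(W y - W z) * V x + (W z - W x) * V y + (W x - W y) * V z = 0"
          by (simp add: LIMSEQ_const_iff)
        have "D * (W z - W y) = V z - V y" using False Wyz by (simp add: D_def y_def z_def)
        moreover have "(W z - W y) * ((V y - D * W y) + D * W x) = (W z - W y) * V y + (D * (W z - W y)) * (W x - W y)"
          by (simp add: algebra_simps)
        ultimately have "(W z - W y) * ((V y - D * W y) + D * W x) = (W z - W y) * V y + (V z - V y) * (W x - W y)"
          by simp
        also have "\<dots> = (W z - W y) * V x" using e by (simp add: algebra_simps)
        finally show ?thesis using Wyz by simp
      qed
    qed
    then show ?thesis by blast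
  qed
  then obtain A where A: "\<And>x. c < x \<Longrightarrow> x < d \<Longrightarrow> V x = A + D * W x" by blast
  show ?thesis
  proof (rule that[of D])
    show "a = 0 \<Longrightarrow> D = 0" by (simp add: D_def)
    fix r assume r: "c < r" "r < d"
    have "((\<lambda>s. A + D * W s - H s) has_real_derivative D * w r - h r) (at r)"
      using deriv[OF r] by (auto intro!: derivative_eq_intros)
    then have "(U has_real_derivative D * w r - h r) (at r)"
      by (rule has_field_derivative_transform_within_open[of _ _ _ "{c<..<d}"])
        (use r A in \<open>auto simp: V_def algebra_simps\<close>)
    then show "(U has_real_derivative (D - flux_integral c r) / r ^ (DIM('a) - 1)) (at r)"
      by (simp add: w_def h_def diff_divide_distrib)
  qed
qed

definition flux :: "real \<Rightarrow> real" where "flux r = r ^ (DIM('a) - 1) * deriv U r"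

lemma local_flux:
  assumes cd: "a < c" "c < d" "d < b"
  obtains D where "a = 0 \<Longrightarrow> D = 0" "\<And>r. c < r \<Longrightarrow> r < d \<Longrightarrow> flux r = D - flux_integral c r"
    "\<And>r. c < r \<Longrightarrow> r < d \<Longrightarrow> (U has_real_derivative flux r / r ^ (DIM('a) - 1)) (at r)"
proof (rule local_ODE[OF cd])
  fix D assume D: "a = 0 \<Longrightarrow> D = 0"
    "\<And>r. c < r \<Longrightarrow> r < d \<Longrightarrow> (U has_real_derivative (D - flux_integral c r) / r ^ (DIM('a) - 1)) (at r)"
  have e: "flux r = D - flux_integral c r" if "c < r" "r < d" for r
    using DERIV_imp_deriv[OF D(2)[OF that]] that cd a_nonneg by (simp add: flux_def)
  show thesis by (rule that[OF D(1) e]) (use D(2) e in auto)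
qed

lemma U_DERIV:
  assumes "a < r" "r < b" shows "(U has_real_derivative flux r / r ^ (DIM('a) - 1)) (at r)"
proof -
  obtain c where c: "a < c" "c < r" using dense[OF assms(1)] by blast
  obtain d where d: "r < d" "d < b" using dense[OF assms(2)] by blast
  show ?thesis
    by (rule local_flux[OF c(1) less_trans[OF c(2) d(1)] d(2)]) (use c d in blast)
qed

lemma flux_DERIV:
  assumes "a < r" "r < b" shows "(flux has_real_derivative - source r) (at r)"
proof -
  obtain c where c: "a < c" "c < r" using dense[OF assms(1)] by blast
  obtain d where d: "r < d" "d < b" using dense[OF assms(2)] by blast
  obtain D where D: "\<And>r. c < r \<Longrightarrow> r < d \<Longrightarrow> flux r = D - flux_integral c r"
    by (rule local_flux[OF c(1) less_trans[OF c(2) d(1)] d(2)]) blast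
  have "((\<lambda>r. D - flux_integral c r) has_real_derivative - source r) (at r)"
    using flux_integral_DERIV[OF c(1) d(2), of r] base(1)[OF c(1)] c d by (auto intro!: derivative_eq_intros)
  then show ?thesis
    by (rule has_field_derivative_transform_within_open[of _ _ _ "{c<..<d}"]) (use c d D in auto)
qed

text \<open>Since N \<ge> 2, this holds whatever \<open>deriv U 0\<close> is. It lets the centre of
  a ball count as a critical point.\<close>

lemma flux_0: "flux 0 = 0" using dim by (simp add: flux_def)

text \<open>Away from the centre \<open>flux\<close> is differentiable. At the centre of a ball, D =
  0 in the local equation makes flux(r) minus the integral of the source from 0 to r, which tends to
  0.\<close>

lemma flux_cont: "continuous_on radii flux"
proof (cases "a = 0")
  case False
  then have "radii = {a<..<b}" unfolding radii_def by simp
  show ?thesis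
  proof (rule DERIV_continuous_on)
    fix r assume "r \<in> radii"
    then show "(flux has_real_derivative - source r) (at r within radii)"
      using \<open>radii = {a<..<b}\<close> by (intro has_field_derivative_at_within[OF flux_DERIV]) auto
  qed
next
  case True
  have "continuous (at r within radii) flux" if r: "r \<in> radii" for r
  proof (cases "r = 0")
    case False
    then have "a < r" "r < b" using r True unfolding radii_def by auto
    from DERIV_isCont[OF flux_DERIV[OF this]] show ?thesis by (rule continuous_at_imp_continuous_within)
  next
    case r0: True
    define d where "d = b / 2"
    have d: "0 < d" "d < b" using a_less_b True by (auto simp: d_def)
    define G where "G r = integral {0..r} source" for r
    have Gc: "continuous_on {0..d} G"
    proof -
      have "{0..d} \<subseteq> radii" unfolding radii_def using True d by auto
      then show ?thesis unfolding G_def[abs_def]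
        by (intro indefinite_integral_continuous_1 integrable_continuous_real continuous_on_subset[OF source_cont])
    qed
    have fl: "flux r = - G r" if r: "0 \<le> r" "r < d" for r
    proof (cases "r = 0")
      case True
      then show ?thesis by (simp add: G_def flux_0)
    next
      case False
      then have "0 < r" using r by simp
      then obtain c where c: "0 < c" "c < r" using dense by blast
      have ac: "a < c" "c < d" using True c r by auto
      have "flux r = - flux_integral c r"
        by (rule local_flux[OF ac d(2)]) (use c r True in force)
      moreover have "flux_integral c r = G r"
        unfolding flux_integral_def base_def G_def using True by simp
      ultimately show ?thesis by simp
    qed
    have "((\<lambda>r. - G r) \<longlongrightarrow> - G 0) (at 0 within {0..d})"
      using Gc d by (intro tendsto_minus) (auto simp: continuous_on_def)
    then have "((\<lambda>r. - G r) \<longlongrightarrow> - G 0) (at 0 within radii)"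
    proof (rule Lim_transform_within_set)
      show "\<forall>\<^sub>F x in at 0. x \<in> {0..d} \<longleftrightarrow> x \<in> radii"
        unfolding eventually_at radii_def using d True by (intro exI[of _ d]) (auto simp: dist_real_def)
    qed
    then have "(flux \<longlongrightarrow> - G 0) (at 0 within radii)"
    proof (rule Lim_transform_within[OF _ d(1)])
      fix x assume "x \<in> radii" "0 < dist x 0" "dist x 0 < d"
      then show "- G x = flux x" using fl[of x] True unfolding radii_def by (auto simp: dist_real_def)
    qed
    then show ?thesis using r0 fl[of 0] d by (simp add: continuous_within)
  qed
  then show ?thesis by (simp add: continuous_on_eq_continuous_within)
qed

end

section \<open>Boundary values and critical points\<close>

context radial_solution
begin

text \<open>The boundary condition in integrated form. The flux formula rewrites the integral with
  the gradient of \<open>u\<close> and with \<open>q n\<close> itself, which tends to 0; as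
  \<open>q n\<close> vanishes near the origin, the gradient is a majorant up to a constant. The
  \<open>q n\<close> need not vanish at the boundary.\<close>

lemma boundary_limit:
  fixes q q' :: "nat \<Rightarrow> real \<Rightarrow> real"
  assumes q: "\<And>n r. (q n has_real_derivative q' n r) (at r)" and c: "\<And>n. continuous_on UNIV (q' n)"
    and z: "\<And>n r. r \<le> \<delta> \<Longrightarrow> q n r = 0" and \<delta>: "\<delta> > 0"
    and le: "\<And>n r. a < r \<Longrightarrow> r < b \<Longrightarrow> \<bar>q n r\<bar> \<le> 1"
    and lim: "\<And>r. a < r \<Longrightarrow> r < b \<Longrightarrow> (\<lambda>n. q n r) \<longlonglongrightarrow> 0"
  shows "(\<lambda>n. LINT x|lebesgue_on \<Omega>. u x * (q' n (norm x) / norm x ^ (DIM('a) - 1))) \<longlonglongrightarrow> 0"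
proof -
  let ?N = "DIM('a)"
  have u: "u \<in> H1_0 \<Omega>" using solution by (simp add: weak_solution_def)
  then have "in_L2 \<Omega> (wgrad \<Omega> u)" by (simp add: H1_0_def H1_def)
  then have wi: "integrable (lebesgue_on \<Omega>) (wgrad \<Omega> u)"
    by (rule in_L2_integrable[OF _ bounded_domain lebesgue_domain])
  have pow: "r ^ ?N = r * r ^ (?N - 1)" for r :: real using dim by (metis Suc_diff_1 DIM_positive power_Suc)
  have "(\<lambda>n. LINT x|lebesgue_on \<Omega>. q n (norm x) / norm x ^ ?N * (x \<bullet> wgrad \<Omega> u x)) \<longlonglongrightarrow> (LINT x|lebesgue_on \<Omega>. 0)"
  proof (rule integral_dominated_convergence[where w="\<lambda>x. norm (wgrad \<Omega> u x) / \<delta> ^ (?N - 1)"])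
    show "integrable (lebesgue_on \<Omega>) (\<lambda>x. norm (wgrad \<Omega> u x) / \<delta> ^ (?N - 1))" using wi by simp
    have bound: "norm (q n (norm x) / norm x ^ ?N * (x \<bullet> w)) \<le> norm w / \<delta> ^ (?N - 1)" if "x \<in> \<Omega>" for n and x w :: 'a
    proof (cases "norm x \<le> \<delta>")
      case True
      then show ?thesis using z[OF True, of n] \<delta> by simp
    next
      case False
      then have x: "norm x > \<delta>" "norm x > 0" "x \<noteq> 0" using \<delta> by auto
      have "\<bar>q n (norm x)\<bar> \<le> 1" using le mem_iff[OF x(3)] that by auto
      moreover have "\<bar>x \<bullet> w\<bar> \<le> norm x * norm w" by (rule Cauchy_Schwarz_ineq2)
      ultimately have "\<bar>q n (norm x)\<bar> * \<bar>x \<bullet> w\<bar> \<le> 1 * (norm x * norm w)" by (intro mult_mono) auto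
      then have "\<bar>q n (norm x)\<bar> * \<bar>x \<bullet> w\<bar> / norm x ^ ?N \<le> norm x * norm w / norm x ^ ?N"
        by (intro divide_right_mono) auto
      also have "\<dots> = norm w / norm x ^ (?N - 1)" using x by (simp add: pow)
      also have "\<dots> \<le> norm w / \<delta> ^ (?N - 1)"
        using x \<delta> by (intro divide_left_mono power_mono mult_pos_pos) auto
      finally show ?thesis by (simp add: abs_mult)
    qed
    then show "AE x in lebesgue_on \<Omega>. norm (q n (norm x) / norm x ^ ?N * (x \<bullet> wgrad \<Omega> u x)) \<le> norm (wgrad \<Omega> u x) / \<delta> ^ (?N - 1)" for n
      by (intro AE_I2) simp
    show "AE x in lebesgue_on \<Omega>. (\<lambda>n. q n (norm x) / norm x ^ ?N * (x \<bullet> wgrad \<Omega> u x)) \<longlonglongrightarrow> 0"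
    proof (rule AE_I2)
      fix x assume "x \<in> space (lebesgue_on \<Omega>)"
      then have x: "x \<in> \<Omega>" by simp
      have "(\<lambda>n. q n (norm x)) \<longlonglongrightarrow> 0"
      proof (cases "x = 0")
        case True
        then show ?thesis using z[of 0] \<delta> by simp
      next
        case False
        then show ?thesis using lim mem_iff x by auto
      qed
      then show "(\<lambda>n. q n (norm x) / norm x ^ ?N * (x \<bullet> wgrad \<Omega> u x)) \<longlonglongrightarrow> 0"
        unfolding divide_inverse by (intro tendsto_mult_left_zero)
    qed
    have qc: "continuous_on UNIV (\<lambda>x::'a. q n (norm x) / max (norm x) \<delta> ^ ?N)" for n
    proof -
      have "continuous_on UNIV (q n)" by (rule DERIV_continuous_on[OF has_field_derivative_at_within[OF q]])
      then have "continuous_on UNIV (\<lambda>x::'a. q n (norm x))"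
        by (rule continuous_on_compose2) (auto intro!: continuous_intros)
      then show ?thesis using \<delta> by (intro continuous_intros) (auto simp: max_def)
    qed
    \<comment> \<open>Replacing |x| by its maximum with \<delta> changes nothing where
      \<open>q n\<close> is nonzero and makes the factor continuous, hence measurable.\<close>
    have eq: "q n (norm x) / norm x ^ ?N * (x \<bullet> w) = q n (norm x) / max (norm x) \<delta> ^ ?N * (x \<bullet> w)" for n and x w :: 'a
      using z[of "norm x" n] by (cases "norm x \<le> \<delta>") (auto simp: max_def)
    have "(\<lambda>x. x \<bullet> wgrad \<Omega> u x) \<in> borel_measurable (lebesgue_on \<Omega>)"
      by (intro borel_measurable_inner borel_measurable_lebesgue_on_continuous continuous_intros borel_measurable_integrable[OF wi])
    then show "(\<lambda>x. q n (norm x) / norm x ^ ?N * (x \<bullet> wgrad \<Omega> u x)) \<in> borel_measurable (lebesgue_on \<Omega>)" for n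
      unfolding eq by (intro borel_measurable_times borel_measurable_lebesgue_on_continuous[OF qc])
  qed simp
  then have "(\<lambda>n. - (LINT x|lebesgue_on \<Omega>. q n (norm x) / norm x ^ ?N * (x \<bullet> wgrad \<Omega> u x))) \<longlonglongrightarrow> 0"
    using tendsto_minus by fastforce
  then show ?thesis
    using H1_0_radial_flux[OF u open_domain bounded_domain q c z \<delta>] by simp
qed

text \<open>If |U| \<ge> e near a boundary sphere, then U has one sign there, and derivatives
  \<open>q'\<close> of fixed sign and total mass 1 concentrated there keep the integrals of
  \<open>boundary_limit\<close> away from 0. It is applied with \<tau> = 1 at the outer and \<tau> =
  -1 at the inner boundary.\<close>

lemma boundary_contradiction:
  fixes q q' :: "nat \<Rightarrow> real \<Rightarrow> real"
  assumes q: "\<And>n r. (q n has_real_derivative q' n r) (at r)" and c: "\<And>n. continuous_on UNIV (q' n)"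
    and z: "\<And>n r. r \<le> \<delta> \<Longrightarrow> q n r = 0" and \<delta>: "\<delta> > 0"
    and le: "\<And>n r. a < r \<Longrightarrow> r < b \<Longrightarrow> \<bar>q n r\<bar> \<le> 1"
    and lim: "\<And>r. a < r \<Longrightarrow> r < b \<Longrightarrow> (\<lambda>n. q n r) \<longlonglongrightarrow> 0"
    and sgn: "\<And>n r. a < r \<Longrightarrow> r < b \<Longrightarrow> 0 \<le> \<tau> * q' n r" and jump: "\<And>n. \<tau> * (q n b - q n a) = 1"
    and S: "\<And>n r. a < r \<Longrightarrow> r < b \<Longrightarrow> q' n r \<noteq> 0 \<Longrightarrow> r \<in> S"
    and e: "e > 0" and U: "\<And>r. r \<in> S \<Longrightarrow> a < r \<Longrightarrow> r < b \<Longrightarrow> e \<le> \<bar>U r\<bar>" and "connected (S \<inter> {a<..<b})"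
  shows False
proof -
  let ?N = "DIM('a)"
  let ?S = "S \<inter> {a<..<b}"
  have "?S \<subseteq> radii" using radii_interior by auto
  then have "connected (U ` ?S)"
    by (intro connected_continuous_image continuous_on_subset[OF U_cont] assms)
  then have iv: "is_interval (U ` ?S)" by (simp add: is_interval_connected_1)
  have "\<exists>s. \<bar>s\<bar> = 1 \<and> (\<forall>r\<in>?S. e \<le> s * U r)"
  proof (rule ccontr)
    assume con: "\<not> ?thesis"
    from con have "\<not> (\<forall>r\<in>?S. e \<le> 1 * U r)" "\<not> (\<forall>r\<in>?S. e \<le> -1 * U r)" by (metis abs_1 abs_minus_cancel)+
    then obtain r1 r2 where r: "r1 \<in> ?S" "r2 \<in> ?S" "U r1 < e" "- U r2 < e" by force
    then have "U r1 \<le> 0" "0 \<le> U r2" using U[of r1] U[of r2] by auto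
    then have "0 \<in> U ` ?S" using iv r(1,2) unfolding is_interval_1 by (meson imageI)
    then show False using U e by force
  qed
  then obtain s where s: "\<bar>s\<bar> = 1" "\<And>r. r \<in> ?S \<Longrightarrow> e \<le> s * U r" by blast
  have q'z: "q' n r = 0" if "r < \<delta>" for n r
    by (rule DERIV_eq_0_of_locally_0[OF q[of n r], of "{..<\<delta>}"]) (use that z in auto)
  have kc: "continuous_on UNIV (\<lambda>r. q' n r / r ^ (?N - 1))" for n
  proof (rule continuous_on_UNIV_zero_left)
    show "\<delta> / 2 > 0" using \<delta> by simp
    show "q' n r / r ^ (?N - 1) = 0" if "r \<le> \<delta> / 2" for r using q'z[of r n] that \<delta> by simp
    show "continuous_on {0<..} (\<lambda>r. q' n r / r ^ (?N - 1))"
      by (intro continuous_intros continuous_on_subset[OF c]) auto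
  qed
  have kc': "continuous_on UNIV (\<lambda>x::'a. q' n (norm x) / norm x ^ (?N - 1))" for n
    by (rule continuous_on_compose2[OF kc]) (auto intro!: continuous_intros)
  have "in_L2 \<Omega> u" using solution by (simp add: weak_solution_def H1_0_def H1_def)
  then have ui: "integrable (lebesgue_on \<Omega>) u"
    by (rule in_L2_integrable[OF _ bounded_domain lebesgue_domain])
  have i1: "integrable (lebesgue_on \<Omega>) (\<lambda>x. u x * (q' n (norm x) / norm x ^ (?N - 1)))" for n
    using integrable_continuous_scaleR[OF ui kc' bounded_domain] by (simp add: mult.commute)
  have one: "angular (\<lambda>x::'a. 1) 1" by unfold_locales
  have qi: "(\<lambda>r. q' n r / r ^ (?N - 1) * r ^ (?N - 1)) absolutely_integrable_on {a<..<b}"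
    "integral {a<..<b} (\<lambda>r. q' n r / r ^ (?N - 1) * r ^ (?N - 1)) = q n b - q n a" for n
  proof -
    have "{a..b} - {a<..<b} \<subseteq> {a, b}" by auto
    then have "negligible ({a..b} - {a<..<b})" by (rule negligible_subset[rotated]) simp
    then have 1: "q' n absolutely_integrable_on {a<..<b}"
      by (intro absolutely_integrable_continuous_extend_zero(1)[OF continuous_on_subset[OF c]]) auto
    show "(\<lambda>r. q' n r / r ^ (?N - 1) * r ^ (?N - 1)) absolutely_integrable_on {a<..<b}"
      by (rule absolutely_integrable_spike[OF 1 negligible_empty]) (use a_nonneg in auto)
    have "integral {a<..<b} (\<lambda>r. q' n r / r ^ (?N - 1) * r ^ (?N - 1)) = integral {a<..<b} (q' n)"
      by (rule integral_cong) (use a_nonneg in auto)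
    also have "\<dots> = integral {a..b} (q' n)" by (rule integral_open_interval_real[symmetric])
    also have "\<dots> = q n b - q n a"
      by (rule integral_unique[OF fundamental_theorem_of_calculus])
        (use a_less_b q in \<open>auto simp: has_real_derivative_iff_has_vector_derivative[symmetric] has_field_derivative_at_within\<close>)
    finally show "integral {a<..<b} (\<lambda>r. q' n r / r ^ (?N - 1) * r ^ (?N - 1)) = q n b - q n a" .
  qed
  note pd = polar_domain[OF one qi(1)]
  have ge: "e * angular_mass (\<lambda>x::'a. 1) \<le> s * \<tau> * (LINT x|lebesgue_on \<Omega>. u x * (q' n (norm x) / norm x ^ (?N - 1)))" for n
  proof -
    have "e * angular_mass (\<lambda>x::'a. 1) = (LINT x|lebesgue_on \<Omega>. e * (\<tau> * (q' n (norm x) / norm x ^ (?N - 1) * 1)))"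
    proof -
      have "e * (\<tau> * (angular_mass (\<lambda>x::'a. 1) * (q n b - q n a))) = e * (angular_mass (\<lambda>x::'a. 1) * (\<tau> * (q n b - q n a)))"
        by (simp only: mult_ac)
      moreover have "(LINT x|lebesgue_on \<Omega>. q' n (norm x) / norm x ^ (?N - 1)) = angular_mass (\<lambda>x::'a. 1) * (q n b - q n a)"
        using pd(2)[of n] qi(2)[of n] by (simp only: mult_1_right)
      ultimately show ?thesis by (simp only: integral_mult_right_zero jump mult_1_right)
    qed
    also have "\<dots> \<le> (LINT x|lebesgue_on \<Omega>. s * \<tau> * (u x * (q' n (norm x) / norm x ^ (?N - 1))))"
    proof (rule integral_mono)
      show "integrable (lebesgue_on \<Omega>) (\<lambda>x. e * (\<tau> * (q' n (norm x) / norm x ^ (?N - 1) * 1)))"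
        using pd(1)[of n] by (intro integrable_mult_right)
      show "integrable (lebesgue_on \<Omega>) (\<lambda>x. s * \<tau> * (u x * (q' n (norm x) / norm x ^ (?N - 1))))"
        by (intro integrable_mult_right i1)
      fix x assume "x \<in> space (lebesgue_on \<Omega>)"
      then have x: "x \<in> \<Omega>" by simp
      show "e * (\<tau> * (q' n (norm x) / norm x ^ (?N - 1) * 1)) \<le> s * \<tau> * (u x * (q' n (norm x) / norm x ^ (?N - 1)))"
      proof (cases "q' n (norm x) = 0")
        case False
        then have "x \<noteq> 0" using q'z[of 0 n] \<delta> by auto
        then have r: "a < norm x" "norm x < b" using x mem_iff by auto
        then have "e \<le> s * u x" using s(2) S[OF r False] u_radial[OF x] by auto
        moreover have "0 \<le> \<tau> * (q' n (norm x) / norm x ^ (?N - 1))"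
          using sgn[OF r, of n] by (simp add: zero_le_divide_iff flip: times_divide_eq_right) (simp add: zero_le_divide_iff)
        ultimately have "e * (\<tau> * (q' n (norm x) / norm x ^ (?N - 1))) \<le> s * u x * (\<tau> * (q' n (norm x) / norm x ^ (?N - 1)))"
          by (rule mult_right_mono)
        then show ?thesis by (simp add: mult_ac)
      qed simp
    qed
    finally show ?thesis by (simp only: integral_mult_right_zero)
  qed
  have "(\<lambda>n. s * \<tau> * (LINT x|lebesgue_on \<Omega>. u x * (q' n (norm x) / norm x ^ (?N - 1)))) \<longlonglongrightarrow> s * \<tau> * 0"
    by (intro tendsto_mult_left boundary_limit[OF q c z \<delta> le lim])
  then have "e * angular_mass (\<lambda>x::'a. 1) \<le> s * \<tau> * 0"
    by (rule LIMSEQ_le_const) (use ge in blast)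
  then show False using e angular_mass_one_pos[where 'a='a] by (simp add: mult_le_0_iff)
qed

lemma small_near_outer_boundary:
  assumes "a \<le> r0" "r0 < b" "e > 0"
  shows "\<exists>r. r0 < r \<and> r < b \<and> \<bar>U r\<bar> < e"
proof (rule ccontr)
  assume con: "\<not> ?thesis"
  \<comment> \<open>Thickness of the boundary layer in which the cut-off rises from 0 to 1. The
    summand 2 keeps it within half the distance from \<open>r0\<close> to \<open>b\<close>.\<close>
  define h where "h n = (b - r0) / (real n + 2)" for n :: nat
  have h: "h n > 0" "h n \<le> (b - r0) / 2" for n
  proof -
    show "h n > 0" using assms by (simp add: h_def)
    show "h n \<le> (b - r0) / 2" unfolding h_def by (rule divide_left_mono) (use assms in auto)
  qed
  have h0: "h \<longlonglongrightarrow> 0" unfolding h_def by real_asymp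
  define q where "q n r = (max 0 ((r - (b - h n)) / h n))\<^sup>2" for n r
  define q' where "q' n r = 2 * max 0 ((r - (b - h n)) / h n) / h n" for n r
  have zero: "q n r = 0" "q' n r = 0" if "r \<le> b - h n" for n r
  proof -
    have "(r - (b - h n)) / h n \<le> 0" using that h(1)[of n] by (simp add: divide_le_0_iff)
    then show "q n r = 0" "q' n r = 0" by (simp_all add: q_def q'_def max_absorb1)
  qed
  show False
  proof (rule boundary_contradiction[of q q' "(b + r0) / 2" 1 "{r0<..}" e])
    show "(q n has_real_derivative q' n r) (at r)" for n r
    proof -
      have "((\<lambda>r. (r - (b - h n)) / h n) has_real_derivative 1 / h n) (at r)"
        using h(1)[of n] by (auto intro!: derivative_eq_intros)
      from DERIV_chain2[OF DERIV_pospart_square this] show ?thesis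
        by (simp add: q_def[abs_def] q'_def)
    qed
    show "continuous_on UNIV (q' n)" for n
      unfolding q'_def[abs_def] using h(1)[of n] by (intro continuous_intros) auto
    show "q n r = 0" if "r \<le> (b + r0) / 2" for n r
      by (rule zero) (use that h(2)[of n] in \<open>auto simp: field_simps\<close>)
    show "(b + r0) / 2 > 0" using assms a_nonneg by simp
    show "\<bar>q n r\<bar> \<le> 1" if "r < b" for n r
    proof -
      have "max 0 ((r - (b - h n)) / h n) \<le> 1" using that h(1)[of n] by (auto simp: field_simps)
      then show ?thesis by (simp add: q_def power_le_one)
    qed
    show "(\<lambda>n. q n r) \<longlonglongrightarrow> 0" if "r < b" for r
    proof (rule tendsto_eventually)
      have "eventually (\<lambda>n. h n < b - r) sequentially"
        using order_tendstoD(2)[OF h0, of "b - r"] that by simp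
      then show "\<forall>\<^sub>F n in sequentially. q n r = 0"
        by eventually_elim (rule zero, simp)
    qed
    show "0 \<le> 1 * q' n r" for n r using h(1)[of n] by (simp add: q'_def)
    show "1 * (q n b - q n a) = 1" for n
    proof -
      have "q n a = 0" by (rule zero) (use assms h(2)[of n] in \<open>auto simp: field_simps\<close>)
      moreover have "q n b = 1" using h(1)[of n] by (simp add: q_def)
      ultimately show ?thesis by simp
    qed
    show "r \<in> {r0<..}" if "q' n r \<noteq> 0" for n r
      using that zero(2)[of r n] h(2)[of n] assms by (cases "r \<le> b - h n") (auto simp: field_simps)
    show "e \<le> \<bar>U r\<bar>" if "r \<in> {r0<..}" "r < b" for r using con that by auto
    have "{r0<..} \<inter> {a<..<b} = {r0<..<b}" using assms by auto
    then show "connected ({r0<..} \<inter> {a<..<b})" by simp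
  qed (use assms in auto)
qed

lemma small_near_inner_boundary:
  assumes "0 < a" "a < r0" "r0 \<le> b" "e > 0"
  shows "\<exists>r. a < r \<and> r < r0 \<and> \<bar>U r\<bar> < e"
proof (rule ccontr)
  assume con: "\<not> ?thesis"
  define h where "h n = (r0 - a) / (real n + 2)" for n :: nat
  have h: "h n > 0" "h n \<le> (r0 - a) / 2" for n
  proof -
    show "h n > 0" using assms by (simp add: h_def)
    show "h n \<le> (r0 - a) / 2" unfolding h_def by (rule divide_left_mono) (use assms in auto)
  qed
  have h0: "h \<longlonglongrightarrow> 0" unfolding h_def by real_asymp
  \<comment> \<open>The decreasing ramp \<open>p n\<close> below is at least 1 all the way to the
    origin, near which \<open>q\<close> has to vanish. The factor \<open>cut\<close> is 1 from
    \<open>a\<close> outwards and 0 below a/2, so it changes nothing on the domain.\<close>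
  define cut where "cut r = (max 0 (1 - (max 0 (2 * (a - r) / a))\<^sup>2))\<^sup>2" for r
  define cut' where "cut' r = 2 * max 0 (1 - (max 0 (2 * (a - r) / a))\<^sup>2) * (- (2 * max 0 (2 * (a - r) / a) * (- 2 / a)))" for r
  have cut: "(cut has_real_derivative cut' r) (at r)" for r
  proof -
    have "((\<lambda>r. 2 * (a - r) / a) has_real_derivative - 2 / a) (at r)"
      using assms by (auto intro!: derivative_eq_intros)
    from DERIV_chain2[OF DERIV_pospart_square this]
    have "((\<lambda>r. 1 - (max 0 (2 * (a - r) / a))\<^sup>2) has_real_derivative - (2 * max 0 (2 * (a - r) / a) * (- 2 / a))) (at r)"
      using DERIV_diff[OF DERIV_const[of 1]] by fastforce
    from DERIV_chain2[OF DERIV_pospart_square this] show ?thesis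
      by (simp add: cut_def[abs_def] cut'_def)
  qed
  have cut1: "cut r = 1" "cut' r = 0" if "a \<le> r" for r
  proof -
    have "2 * (a - r) / a \<le> 0" using that assms by (simp add: divide_le_0_iff)
    then show "cut r = 1" "cut' r = 0" by (auto simp: cut_def cut'_def max_def)
  qed
  have cut0: "cut r = 0" if "r \<le> a / 2" for r
  proof -
    have "1 \<le> 2 * (a - r) / a" using that assms by (simp add: field_simps)
    then have "1 \<le> (max 0 (2 * (a - r) / a))\<^sup>2" by (simp add: one_le_power max_def)
    then show ?thesis by (simp add: cut_def max_def)
  qed
  define p where "p n r = (max 0 ((a + h n - r) / h n))\<^sup>2" for n r
  define p' where "p' n r = - (2 * max 0 ((a + h n - r) / h n) / h n)" for n r
  have p: "(p n has_real_derivative p' n r) (at r)" for n r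
  proof -
    have "((\<lambda>r. (a + h n - r) / h n) has_real_derivative - 1 / h n) (at r)"
      using h(1)[of n] by (auto intro!: derivative_eq_intros)
    from DERIV_chain2[OF DERIV_pospart_square this] show ?thesis
      by (simp add: p_def[abs_def] p'_def)
  qed
  have zero: "p n r = 0" "p' n r = 0" if "a + h n \<le> r" for n r
  proof -
    have "(a + h n - r) / h n \<le> 0" using that h(1)[of n] by (simp add: divide_le_0_iff)
    then show "p n r = 0" "p' n r = 0" by (simp_all add: p_def p'_def max_absorb1)
  qed
  define q where "q n r = cut r * p n r" for n r
  define q' where "q' n r = cut' r * p n r + cut r * p' n r" for n r
  have qp: "q n r = p n r" "q' n r = p' n r" if "a \<le> r" for n r using cut1[OF that] by (auto simp: q_def q'_def)
  show False
  proof (rule boundary_contradiction[of q q' "a / 2" "-1" "{..<r0}" e])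
    show "(q n has_real_derivative q' n r) (at r)" for n r
      unfolding q_def[abs_def] q'_def using DERIV_mult[OF cut[of r] p[of n r]] by (simp add: mult.commute)
    show "continuous_on UNIV (q' n)" for n
      unfolding q'_def[abs_def] cut'_def cut_def p'_def p_def using h(1)[of n] assms by (intro continuous_intros) auto
    show "q n r = 0" if "r \<le> a / 2" for n r using cut0[OF that] by (simp add: q_def)
    show "a / 2 > 0" using assms by simp
    show "\<bar>q n r\<bar> \<le> 1" if "a < r" for n r
    proof -
      have "max 0 ((a + h n - r) / h n) \<le> 1" using that h(1)[of n] by (auto simp: field_simps)
      then show ?thesis using that by (simp add: qp p_def power_le_one)
    qed
    show "(\<lambda>n. q n r) \<longlonglongrightarrow> 0" if "a < r" for r
    proof (rule tendsto_eventually)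
      have "eventually (\<lambda>n. h n < r - a) sequentially"
        using order_tendstoD(2)[OF h0, of "r - a"] that by simp
      then show "\<forall>\<^sub>F n in sequentially. q n r = 0"
        by eventually_elim (use that in \<open>simp add: qp zero\<close>)
    qed
    show "0 \<le> - 1 * q' n r" if "a < r" for n r using h(1)[of n] that by (simp add: qp p'_def)
    show "- 1 * (q n b - q n a) = 1" for n
    proof -
      have "p n b = 0" by (rule zero) (use assms h(2)[of n] in \<open>auto simp: field_simps\<close>)
      moreover have "p n a = 1" using h(1)[of n] by (simp add: p_def)
      ultimately show ?thesis using a_less_b by (simp add: qp)
    qed
    show "r \<in> {..<r0}" if "a < r" "q' n r \<noteq> 0" for n r
      using that zero(2)[of n r] h(2)[of n] assms by (cases "a + h n \<le> r") (auto simp: field_simps qp)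
    show "e \<le> \<bar>U r\<bar>" if "r \<in> {..<r0}" "a < r" for r using con that by auto
    have "{..<r0} \<inter> {a<..<b} = {a<..<r0}" using assms by auto
    then show "connected ({..<r0} \<inter> {a<..<b})" by simp
  qed (use assms in auto)
qed

section \<open>Critical points of the profile\<close>

lemma critical_point:
  assumes lr: "a \<le> l" "l < m" "m < r" "r < b" "l \<in> radii" and U: "\<bar>U l\<bar> < \<bar>U m\<bar>" "\<bar>U r\<bar> < \<bar>U m\<bar>"
  shows "\<exists>s. l < s \<and> s < r \<and> flux s = 0 \<and> U s \<noteq> 0"
proof -
  have sub: "{l..r} \<subseteq> radii" using lr by (auto simp: radii_def split: if_splits)
  have "continuous_on {l..r} (\<lambda>x. \<bar>U x\<bar>)" by (intro continuous_intros continuous_on_subset[OF U_cont sub])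
  then obtain s where s: "s \<in> {l..r}" "\<And>y. y \<in> {l..r} \<Longrightarrow> \<bar>U y\<bar> \<le> \<bar>U s\<bar>"
    using continuous_attains_sup[of "{l..r}" "\<lambda>x. \<bar>U x\<bar>"] lr by auto
  have ms: "\<bar>U m\<bar> \<le> \<bar>U s\<bar>" using s(2)[of m] lr by auto
  then have "s \<noteq> l" "s \<noteq> r" using U by auto
  then have s': "l < s" "s < r" using s(1) by auto
  have nz: "U s \<noteq> 0" using ms U by auto
  have as: "a < s" "s < b" using s' lr by auto
  \<comment> \<open>Squaring avoids distinguishing the sign of \<open>U s\<close> at the maximum of
    |U|.\<close>
  have "((\<lambda>x. (U x)\<^sup>2) has_real_derivative 2 * U s * (flux s / s ^ (DIM('a) - 1))) (at s)"
    using U_DERIV[OF as] by (auto intro!: derivative_eq_intros)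
  then have "2 * U s * (flux s / s ^ (DIM('a) - 1)) = 0"
  proof (rule DERIV_local_max)
    show "0 < min (s - l) (r - s)" using s' by simp
    show "\<forall>y. \<bar>s - y\<bar> < min (s - l) (r - s) \<longrightarrow> (U y)\<^sup>2 \<le> (U s)\<^sup>2"
    proof (intro allI impI)
      fix y assume "\<bar>s - y\<bar> < min (s - l) (r - s)"
      then have "y \<in> {l..r}" by (auto simp: abs_if split: if_splits)
      then show "(U y)\<^sup>2 \<le> (U s)\<^sup>2" using s(2)[of y] by (simp only: abs_le_square_iff)
    qed
  qed
  then show ?thesis using nz s' as a_nonneg by auto
qed

text \<open>The set where \<open>u\<close> is nonzero is the image of \<open>T\<close> times the
  unit sphere, and the sphere is connected as N \<ge> 2. A connected \<open>T\<close> would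
  therefore leave at most one nodal zone, so \<open>T\<close> has a gap.\<close>

lemma sign_change:
  assumes "card (nodal_zones \<Omega> u) \<ge> 2"
  obtains r1 z r2 where "r1 \<in> radii" "r2 \<in> radii" "r1 < z" "z < r2" "U r1 \<noteq> 0" "U z = 0" "U r2 \<noteq> 0"
proof -
  define T where "T = {r \<in> radii. U r \<noteq> 0}"
  let ?Z = "{x \<in> \<Omega>. u x \<noteq> 0}"
  have Z: "?Z = (\<lambda>(r, y). r *\<^sub>R y) ` (T \<times> sphere (0::'a) 1)"
  proof (intro set_eqI iffI)
    fix x assume "x \<in> ?Z"
    then have x: "norm x \<in> T" using u_radial[of x] by (auto simp: T_def mem_iff_radii)
    obtain e :: 'a where "norm e = 1" using vector_choose_size[of 1] by auto
    define y where "y = (if x = 0 then e else x /\<^sub>R norm x)"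
    have "y \<in> sphere 0 1" "x = norm x *\<^sub>R y" using \<open>norm e = 1\<close> by (auto simp: y_def)
    then show "x \<in> (\<lambda>(r, y). r *\<^sub>R y) ` (T \<times> sphere (0::'a) 1)" using x by (intro image_eqI[of _ _ "(norm x, y)"]) auto
  next
    fix x assume "x \<in> (\<lambda>(r, y). r *\<^sub>R y) ` (T \<times> sphere (0::'a) 1)"
    then obtain r y where ry: "x = r *\<^sub>R y" "r \<in> T" "norm y = 1" by auto
    have "r \<ge> 0" using ry(2) a_nonneg by (auto simp: T_def radii_def split: if_splits)
    then have "norm x = r" using ry by simp
    then show "x \<in> ?Z" using ry(2) u_radial[of x] by (auto simp: T_def mem_iff_radii)
  qed
  have "\<not> connected T"
  proof
    assume "connected T"
    moreover have "connected (sphere (0::'a) 1)" by (rule connected_sphere) (use dim in simp)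
    ultimately have "connected (T \<times> sphere (0::'a) 1)" by (rule connected_Times)
    then have conn: "connected ?Z" unfolding Z
      by (rule connected_continuous_image[rotated]) (auto intro!: continuous_intros simp: case_prod_beta)
    have "card (components ?Z) \<le> 1"
    proof (cases "?Z = {}")
      case False
      then have "components ?Z = {?Z}" by (rule components_eq_sing_iff[THEN iffD2, OF conjI[OF conn]])
      then show ?thesis by simp
    next
      case True
      then show ?thesis by (simp only: components_empty card.empty)
    qed
    then show False using assms by (simp add: nodal_zones_def)
  qed
  then have "\<not> is_interval T" by (simp add: is_interval_connected_1)
  then obtain r1 r2 z where r: "r1 \<in> T" "r2 \<in> T" "r1 \<le> z" "z \<le> r2" "z \<notin> T"
    unfolding is_interval_1 by blast
  then have "r1 < z" "z < r2" by (metis less_eq_real_def)+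
  moreover have "z \<in> radii" using r by (auto simp: T_def radii_def split: if_splits)
  ultimately show ?thesis using that[of r1 r2 z] r by (auto simp: T_def)
qed

text \<open>Right of the zero z, |U| rises and becomes small again at the outer boundary, so it has
  a maximum in between. The same happens on the left of z in an annulus, while in a ball the centre
  serves. These two critical points need not be consecutive, so the interval is shrunk.\<close>

lemma critical_interval:
  assumes "card (nodal_zones \<Omega> u) \<ge> 2"
  obtains s t where "s < t" "{s..t} \<subseteq> radii" "flux s = 0" "flux t = 0" "\<And>r. s < r \<Longrightarrow> r < t \<Longrightarrow> flux r \<noteq> 0"
proof -
  obtain r1 z r2 where r: "r1 \<in> radii" "r2 \<in> radii" "r1 < z" "z < r2" "U r1 \<noteq> 0" "U z = 0" "U r2 \<noteq> 0"
    by (rule sign_change[OF assms])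
  have ab: "a \<le> r1" "r2 < b" using r(1,2) by (auto simp: radii_def split: if_splits)
  have za: "a < z" "z < b" "z \<in> radii" using r ab radii_interior by auto
  obtain r3 where r3: "r2 < r3" "r3 < b" "\<bar>U r3\<bar> < \<bar>U r2\<bar>"
    using small_near_outer_boundary[of r2 "\<bar>U r2\<bar>"] r ab by auto
  obtain t where t: "z < t" "t < r3" "flux t = 0" "U t \<noteq> 0"
    using critical_point[of z r2 r3] za r r3 by auto
  have "\<exists>s\<in>radii. s < z \<and> flux s = 0"
  proof (cases "a = 0")
    case True
    then have "0 \<in> radii" "0 < z" unfolding radii_def using za by auto
    then show ?thesis using flux_0 by auto
  next
    case False
    then have a0: "0 < a" "a < r1" using a_nonneg r(1) by (auto simp: radii_def)
    obtain r0 where r0: "a < r0" "r0 < r1" "\<bar>U r0\<bar> < \<bar>U r1\<bar>"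
      using small_near_inner_boundary[of r1 "\<bar>U r1\<bar>"] a0 r za by auto
    obtain s where "r0 < s" "s < z" "flux s = 0"
      using critical_point[of r0 r1 z] r0 r za radii_interior[of r0] by auto
    then show ?thesis using r0 za radii_interior[of s] by auto
  qed
  then obtain s where s: "s \<in> radii" "s < z" "flux s = 0" by blast
  have as: "a \<le> s" using s(1) by (auto simp: radii_def split: if_splits)
  have tb: "t < b" using t r3 by simp
  have sub: "{s..t} \<subseteq> radii" using s(1) tb by (auto simp: radii_def split: if_splits)
  \<comment> \<open>U differs at z and t, so the flux is nonzero at some c between them; the zeros
    of the flux nearest to c on either side are consecutive.\<close>
  have "\<exists>c. z < c \<and> c < t \<and> flux c \<noteq> 0"
  proof -
    have "\<exists>c>z. c < t \<and> U t - U z = (t - z) * (flux c / c ^ (DIM('a) - 1))"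
      by (rule MVT2[OF t(1)]) (use za tb U_DERIV in auto)
    then show ?thesis using r(6) t by auto
  qed
  then obtain c where c: "z < c" "c < t" "flux c \<noteq> 0" by blast
  have fc: "continuous_on {s..t} flux" by (rule continuous_on_subset[OF flux_cont sub])
  have cp: "compact {r \<in> {x..y}. flux r = 0}" if "s \<le> x" "y \<le> t" for x y
  proof -
    have "continuous_on {x..y} flux" by (rule continuous_on_subset[OF fc]) (use that in auto)
    then have "closed {r \<in> {x..y}. flux r = 0}" by (intro continuous_closed_preimage_constant) auto
    then show ?thesis by (rule compact_eq_bounded_closed[THEN iffD2, OF conjI, rotated])
        (auto intro: bounded_subset[of "{x..y}"])
  qed
  have s': "s \<in> {r \<in> {s..c}. flux r = 0}" and t'': "t \<in> {r \<in> {c..t}. flux r = 0}" using s t c by auto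
  obtain s' where s': "s' \<in> {s..c}" "flux s' = 0" "\<And>r. r \<in> {s..c} \<Longrightarrow> flux r = 0 \<Longrightarrow> r \<le> s'"
    using compact_attains_sup[OF cp[of s c]] s' c by fastforce
  obtain t' where t': "t' \<in> {c..t}" "flux t' = 0" "\<And>r. r \<in> {c..t} \<Longrightarrow> flux r = 0 \<Longrightarrow> t' \<le> r"
    using compact_attains_inf[OF cp[of c t]] t'' s c by fastforce
  show ?thesis
  proof (rule that[of s' t'])
    have "s' \<noteq> c" using s'(2) c(3) by auto
    then show "s' < t'" using s'(1) t'(1) by auto
    show "{s'..t'} \<subseteq> radii" using sub s'(1) t'(1) by auto
    show "flux r \<noteq> 0" if "s' < r" "r < t'" for r
    proof
      assume "flux r = 0"
      then show False using s'(3)[of r] t'(3)[of r] s'(1) t'(1) that by (cases "r \<le> c") auto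
    qed
  qed (use s' t' in auto)
qed

end

section \<open>The radial factor of the test functions\<close>

context radial_solution
begin

text \<open>\<open>f'\<close> is only a weak derivative, so the chain rule is obtained by testing with \<open>K \<circ> U\<^sup>-\<^sup>1\<close>.\<close>

lemma weak_chain_rule:
  fixes K K' :: "real \<Rightarrow> real"
  assumes f': "has_weak_gradient UNIV f f'"
    and st: "a \<le> s" "s < t" "t < b" and nz: "\<And>r. s < r \<Longrightarrow> r < t \<Longrightarrow> flux r \<noteq> 0"
    and cd: "s < c" "c < d" "d < t"
    and K: "\<And>r. s < r \<Longrightarrow> r < t \<Longrightarrow> (K has_real_derivative K' r) (at r)" and K'c: "continuous_on {s<..<t} K'"
    and Kz: "\<And>r. r \<notin> {c..d} \<Longrightarrow> K r = 0" "\<And>r. r \<notin> {c..d} \<Longrightarrow> K' r = 0"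
  shows "(\<lambda>r. f' (U r) * (flux r / r ^ (DIM('a) - 1)) * K r) absolutely_integrable_on {s<..<t}"
    "integral {s<..<t} (\<lambda>r. f (U r) * K' r) = - integral {s<..<t} (\<lambda>r. f' (U r) * (flux r / r ^ (DIM('a) - 1)) * K r)"
proof -
  let ?S = "{s<..<t}"
  define v where "v r = flux r / r ^ (DIM('a) - 1)" for r
  have pos: "r > 0" if "r \<in> ?S" for r using that st a_nonneg by auto
  have Ud: "(U has_real_derivative v r) (at r)" if "r \<in> ?S" for r
    unfolding v_def by (rule U_DERIV) (use that st in auto)
  have vnz: "v r \<noteq> 0" if "r \<in> ?S" for r using nz that pos[OF that] by (auto simp: v_def)
  have Srad: "?S \<subseteq> radii" using radii_interior st by auto
  have Uc: "continuous_on ?S U" by (rule continuous_on_subset[OF U_cont Srad])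
  have vc: "continuous_on ?S v" unfolding v_def[abs_def]
    using pos by (intro continuous_intros continuous_on_subset[OF flux_cont Srad]) auto
  have inj: "inj_on U ?S"
  proof (rule linorder_inj_onI')
    fix x y assume xy: "x \<in> ?S" "y \<in> ?S" "x < y"
    have "\<exists>z>x. z < y \<and> U y - U x = (y - x) * v z"
      by (rule MVT2[OF xy(3)]) (use xy Ud in auto)
    then obtain z where "x < z" "z < y" "U y - U x = (y - x) * v z" by blast
    moreover have "v z \<noteq> 0" using vnz[of z] xy calculation by auto
    ultimately show "U x \<noteq> U y" using xy by auto
  qed
  \<comment> \<open>U' has constant sign \<epsilon> on the interval; it cancels against the absolute
    value in the change of variables.\<close>
  obtain \<epsilon> :: real where \<epsilon>: "\<bar>\<epsilon>\<bar> = 1" "\<And>r. r \<in> ?S \<Longrightarrow> \<bar>v r\<bar> = \<epsilon> * v r"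
  proof -
    have "connected (v ` ?S)" by (rule connected_continuous_image[OF vc]) simp
    then have iv: "is_interval (v ` ?S)" by (simp add: is_interval_connected_1)
    have 0: "0 \<notin> v ` ?S" using vnz by force
    show ?thesis
    proof (cases "\<exists>r\<in>?S. v r < 0")
      case True
      then obtain r0 where r0: "r0 \<in> ?S" "v r0 < 0" by blast
      have "v r < 0" if "r \<in> ?S" for r
      proof (rule ccontr)
        assume "\<not> v r < 0"
        then have "0 \<in> v ` ?S" using iv r0 that unfolding is_interval_1 by (meson imageI less_imp_le not_less)
        then show False using 0 by simp
      qed
      then show ?thesis using that[of "-1"] by force
    next
      case False
      then show ?thesis using that[of 1] by force
    qed
  qed
  define I where "I = U ` ?S"
  define g where "g = inv_into ?S U"
  have g: "g (U r) = r" if "r \<in> ?S" for r unfolding g_def by (rule inv_into_f_f[OF inj that])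
  have gI: "g y \<in> ?S" "U (g y) = y" if "y \<in> I" for y
    unfolding g_def using that[unfolded I_def] by (rule inv_into_into, rule f_inv_into_f)
  have openI: "open I" unfolding I_def by (rule invariance_of_domain[OF Uc _ inj]) simp
  have gd: "(g has_real_derivative inverse (v (g y))) (at y)" if "y \<in> I" for y
    unfolding has_field_derivative_def
  proof (rule has_derivative_inverse_strong_x[OF _ gI(1)[OF that] Uc g])
    show "(U has_derivative (*) (v (g y))) (at (g y))"
      using Ud[OF gI(1)[OF that]] by (simp add: has_field_derivative_def)
    show "(*) (v (g y)) \<circ> (*) (inverse (v (g y))) = id"
      using vnz[OF gI(1)[OF that]] by (auto simp: fun_eq_iff)
  qed (use gI(2)[OF that] in auto)
  have gc: "continuous_on I g"
    by (rule DERIV_continuous_on[OF has_field_derivative_at_within[OF gd]])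
  \<comment> \<open>\<open>K\<close> as a function of the value y = U(r). It is C^1 because U' does
    not vanish, and supported in the compact set U([c,d]), hence an admissible test function for the
    weak derivative of \<open>f\<close>.\<close>
  define \<phi> where "\<phi> y = (if y \<in> I then K (g y) else 0)" for y
  define \<phi>' where "\<phi>' y = (if y \<in> I then K' (g y) / v (g y) else 0)" for y
  define C where "C = U ` {c..d}"
  have cdS: "{c..d} \<subseteq> ?S" using cd by auto
  have C: "compact C" "C \<subseteq> I" unfolding C_def I_def
    using cdS by (auto intro!: compact_continuous_image continuous_on_subset[OF Uc])
  have zC: "K (g y) = 0" "K' (g y) = 0" if "y \<in> I" "y \<notin> C" for y
  proof -
    have "g y \<notin> {c..d}" using that gI(2)[OF that(1)] unfolding C_def by force
    then show "K (g y) = 0" "K' (g y) = 0" using Kz by auto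
  qed
  have \<phi>z: "\<phi> y = 0" "\<phi>' y = 0" if "y \<notin> C" for y using zC[of y] that by (auto simp: \<phi>_def \<phi>'_def)
  have \<phi>d: "(\<phi> has_real_derivative \<phi>' y) (at y)" for y
  proof (cases "y \<in> I")
    case True
    have "((\<lambda>y. K (g y)) has_real_derivative K' (g y) * inverse (v (g y))) (at y)"
      using DERIV_chain2[OF K gd[OF True]] gI(1)[OF True] by auto
    then have "((\<lambda>y. K (g y)) has_real_derivative \<phi>' y) (at y)" using True by (simp add: \<phi>'_def divide_inverse)
    then show ?thesis
      by (rule has_field_derivative_transform_within_open[OF _ openI True]) (simp add: \<phi>_def)
  next
    case False
    then have "y \<in> - C" using C by auto
    have "((\<lambda>y. 0) has_real_derivative \<phi>' y) (at y)" using False by (simp add: \<phi>'_def)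
    then show ?thesis
      by (rule has_field_derivative_transform_within_open[OF _ _ \<open>y \<in> - C\<close>])
        (use C \<phi>z in \<open>auto simp: compact_imp_closed open_Compl\<close>)
  qed
  have \<phi>'c: "continuous_on UNIV \<phi>'"
  proof -
    have "continuous_on I (\<lambda>y. K' (g y) / v (g y))"
      using gI(1) vnz by (intro continuous_intros continuous_on_compose2[OF K'c gc] continuous_on_compose2[OF vc gc]) auto
    then have "continuous_on I \<phi>'" by (rule continuous_on_cong[THEN iffD1, rotated 2]) (auto simp: \<phi>'_def)
    moreover have "continuous_on (- C) \<phi>'"
      by (rule continuous_on_cong[THEN iffD1, OF _ _ continuous_on_const[of _ 0]]) (auto simp: \<phi>z)
    ultimately have "continuous_on (I \<union> - C) \<phi>'"
      using openI C by (intro continuous_on_open_Un) (auto simp: compact_imp_closed open_Compl)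
    moreover have "I \<union> - C = UNIV" using C by auto
    ultimately show ?thesis by simp
  qed
  have C1: "is_C1 \<phi> \<phi>'" using \<phi>d \<phi>'c by (simp add: is_C1_def)
  have \<phi>: "\<phi> \<in> C1_0 UNIV" by (rule C1_0_I[OF C1 C(1)]) (auto simp: \<phi>z)
  have U: "(UNIV :: real set) \<in> sets lebesgue" by simp
  have li: "locally_integrable UNIV f" "locally_integrable UNIV f'" using f' by (auto simp: has_weak_gradient_def)
  have eq: "(LINT x|lebesgue. f x * \<phi>' x) = - (LINT x|lebesgue. \<phi> x * f' x)"
    using f' \<phi> by (auto simp: has_weak_gradient_def lebesgue_on_UNIV_eq is_C1_imp_grad[OF C1])
  have i1: "(\<lambda>x. f x * \<phi>' x) absolutely_integrable_on UNIV" and i2: "(\<lambda>x. \<phi> x * f' x) absolutely_integrable_on UNIV"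
    using integrable_C1_0_local(2)[OF \<phi> U li(1)] integrable_C1_0_local(1)[OF \<phi> U li(2)]
    by (auto simp: set_integrable_def lebesgue_on_UNIV_eq is_C1_imp_grad[OF C1])
  have restrict: "F absolutely_integrable_on I \<and> integral I F = (LINT x|lebesgue. F x)"
    if "F absolutely_integrable_on UNIV" "\<And>y. y \<notin> C \<Longrightarrow> F y = 0" for F :: "real \<Rightarrow> real"
  proof -
    have e: "(\<lambda>y. if y \<in> I then F y else 0) = F" using that(2) C(2) by (auto simp: fun_eq_iff)
    have "F absolutely_integrable_on I"
      using that(1) absolutely_integrable_restrict_UNIV[of I F] unfolding e by simp
    moreover have "integral I F = integral UNIV F"
      using integral_restrict_UNIV[of I F] unfolding e by simp
    moreover have "integral UNIV F = (LINT x|lebesgue. F x)"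
      using set_lebesgue_integral_eq_integral(2)[OF that(1)] by (simp add: set_lebesgue_integral_def)
    ultimately show ?thesis by simp
  qed
  \<comment> \<open>The substitution is applied to integrands containing the merely integrable
    \<open>f'\<close>, so absolute integrability has to be carried along with the value of the
    integral.\<close>
  have cv: "(\<lambda>r. \<bar>v r\<bar> * F (U r)) absolutely_integrable_on ?S \<and> integral ?S (\<lambda>r. \<bar>v r\<bar> * F (U r)) = (LINT x|lebesgue. F x)"
    if F: "F absolutely_integrable_on UNIV" "\<And>y. y \<notin> C \<Longrightarrow> F y = 0" for F :: "real \<Rightarrow> real"
  proof -
    have "((\<lambda>r. \<bar>v r\<bar> * F (U r)) absolutely_integrable_on ?S \<and> integral ?S (\<lambda>r. \<bar>v r\<bar> * F (U r)) = (LINT x|lebesgue. F x))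
        \<longleftrightarrow> (F absolutely_integrable_on (U ` ?S) \<and> integral (U ` ?S) F = (LINT x|lebesgue. F x))"
    proof (rule has_absolute_integral_change_of_variables_1'[OF _ _ inj])
      show "(U has_field_derivative v x) (at x within ?S)" if "x \<in> ?S" for x
        using Ud[OF that] by (rule has_field_derivative_at_within)
    qed simp
    then show ?thesis using restrict[OF F] by (simp add: I_def)
  qed
  have Ug: "\<phi> (U r) = K r" "\<phi>' (U r) = K' r / v r" if "r \<in> ?S" for r
    using g[OF that] that by (auto simp: \<phi>_def \<phi>'_def I_def)
  have A: "\<bar>v r\<bar> * (f (U r) * \<phi>' (U r)) = \<epsilon> * (f (U r) * K' r)" if "r \<in> ?S" for r
    using \<epsilon>(2)[OF that] Ug[OF that] vnz[OF that] by simp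
  have B: "\<bar>v r\<bar> * (\<phi> (U r) * f' (U r)) = \<epsilon> * (f' (U r) * v r * K r)" if "r \<in> ?S" for r
    using \<epsilon>(2)[OF that] Ug[OF that] by simp
  have 1: "(LINT x|lebesgue. f x * \<phi>' x) = integral ?S (\<lambda>r. \<epsilon> * (f (U r) * K' r))"
    using cv[of "\<lambda>y. f y * \<phi>' y", OF i1] \<phi>z integral_cong[of ?S, OF A] by simp
  have 2: "(LINT x|lebesgue. \<phi> x * f' x) = integral ?S (\<lambda>r. \<epsilon> * (f' (U r) * v r * K r))"
    using cv[of "\<lambda>y. \<phi> y * f' y", OF i2] \<phi>z integral_cong[of ?S, OF B] by simp
  have "(\<lambda>r. \<bar>v r\<bar> * (\<phi> (U r) * f' (U r))) absolutely_integrable_on ?S"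
    using cv[of "\<lambda>y. \<phi> y * f' y", OF i2] \<phi>z by simp
  then have "(\<lambda>r. \<epsilon> * (f' (U r) * v r * K r)) absolutely_integrable_on ?S"
    by (rule absolutely_integrable_spike[OF _ negligible_empty]) (simp only: Diff_empty B)
  then have "(\<lambda>r. \<epsilon> * (\<epsilon> * (f' (U r) * v r * K r))) absolutely_integrable_on ?S"
    by (rule set_integrable_mult_right[rotated]) 
  moreover have ee: "\<epsilon> * (\<epsilon> * x) = x" for x using \<epsilon>(1) by (auto simp: abs_if split: if_splits)
  ultimately show "(\<lambda>r. f' (U r) * (flux r / r ^ (DIM('a) - 1)) * K r) absolutely_integrable_on ?S"
    by (simp add: v_def)
  have "\<epsilon> * integral ?S (\<lambda>r. f (U r) * K' r) = - (\<epsilon> * integral ?S (\<lambda>r. f' (U r) * v r * K r))"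
    using eq unfolding 1 2 by simp
  then have "\<epsilon> * (\<epsilon> * integral ?S (\<lambda>r. f (U r) * K' r)) = - (\<epsilon> * (\<epsilon> * integral ?S (\<lambda>r. f' (U r) * v r * K r)))"
    by simp
  then show "integral ?S (\<lambda>r. f (U r) * K' r) = - integral ?S (\<lambda>r. f' (U r) * (flux r / r ^ (DIM('a) - 1)) * K r)"
    unfolding ee v_def .
qed

definition zeta :: "real \<Rightarrow> real" where
  "zeta r = flux r / (r powr (\<alpha> / 2) * r ^ (DIM('a) - 1))"

definition \<gamma> :: real where "\<gamma> = \<alpha> / 2 + real DIM('a) - 1"

text \<open>\<open>zeta\<close> is the flux times r^(-\<gamma>), and flux' = - source; this gives
  the formula, into which no derivative of \<open>f\<close> enters.\<close>

definition zeta' :: "real \<Rightarrow> real" where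
  "zeta' r = - \<gamma> * zeta r / r - r powr (\<alpha> / 2) * f (U r)"

text \<open>With \<open>j = 1 + \<alpha>/2\<close> this is \<open>j (j + N - 2)\<close>, for integers \<open>j\<close> an eigenvalue of the Laplacian on
  the sphere.\<close>

definition crit :: real where "crit = \<gamma> * (\<gamma> + 2 - real DIM('a))"

lemma powr_\<sigma>': "0 < r \<Longrightarrow> r powr \<sigma> = (r powr (\<alpha> / 2))\<^sup>2 * r ^ (DIM('a) - 1)"
  using powr_\<sigma>[of r] by (simp add: power2_eq_square powr_add[symmetric])

lemma pow_deriv:
  assumes "r > 0"
  shows "((\<lambda>r. r ^ (DIM('a) - 1)) has_real_derivative (real DIM('a) - 1) * r ^ (DIM('a) - 1) / r) (at r)"
proof -
  have "r ^ (DIM('a) - 1) = r * r ^ (DIM('a) - 1 - 1)"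
    using dim by (metis power_Suc Suc_diff_1 zero_less_diff less_le_trans one_less_numeral_iff semiring_norm(76))
  then show ?thesis using assms dim by (auto intro!: derivative_eq_intros simp: of_nat_diff)
qed

lemma zeta_DERIV:
  assumes "a < r" "r < b" shows "(zeta has_real_derivative zeta' r) (at r)"
proof -
  have r: "r > 0" using assms a_nonneg by simp
  define e where "e = r powr (\<alpha> / 2)"
  define w where "w = r ^ (DIM('a) - 1)"
  have ew: "e > 0" "w > 0" using r by (auto simp: e_def w_def)
  have e: "((\<lambda>r. r powr (\<alpha> / 2)) has_real_derivative \<alpha> / 2 * e / r) (at r)"
    using r by (auto intro!: derivative_eq_intros simp: e_def powr_diff)
  have w: "((\<lambda>r. r ^ (DIM('a) - 1)) has_real_derivative (real DIM('a) - 1) * w / r) (at r)"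
    unfolding w_def by (rule pow_deriv[OF r])
  have P: "(flux has_real_derivative - (e\<^sup>2 * w * f (U r))) (at r)"
    using flux_DERIV[OF assms] powr_\<sigma>'[OF r] by (simp add: source_def e_def w_def)
  have z: "zeta r = flux r / (e * w)" by (simp add: zeta_def e_def w_def)
  have "(zeta has_real_derivative (- (e\<^sup>2 * w * f (U r)) * (e * w) - flux r * ((\<alpha> / 2 * e / r) * w + (real DIM('a) - 1) * w / r * e)) / ((e * w) * (e * w))) (at r)"
    unfolding zeta_def[abs_def]
    using DERIV_divide[OF P DERIV_mult[OF e w]] ew by (simp add: e_def w_def)
  moreover have "(- (e\<^sup>2 * w * f (U r)) * (e * w) - flux r * ((\<alpha> / 2 * e / r) * w + (real DIM('a) - 1) * w / r * e)) / ((e * w) * (e * w)) = zeta' r"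
    unfolding zeta'_def z \<gamma>_def e_def[symmetric] using ew r by (simp add: field_simps power2_eq_square)
  ultimately show ?thesis by simp
qed

lemma zeta_cont: "continuous_on {a<..<b} zeta"
  by (rule DERIV_continuous_on[OF has_field_derivative_at_within[OF zeta_DERIV]]) auto

lemma zeta'_cont: "continuous_on {a<..<b} zeta'"
proof -
  have "continuous_on {a<..<b} (\<lambda>r. f (U r))"
    by (rule continuous_on_compose2[OF f_cont continuous_on_subset[OF U_cont]]) (use radii_interior in auto)
  then show ?thesis unfolding zeta'_def[abs_def]
    using a_nonneg by (intro continuous_intros zeta_cont) auto
qed

text \<open>A form of Picone's identity for the equation satisfied by \<open>zeta = r\<^sup>-\<^sup>\<alpha>\<^sup>/\<^sup>2 U'\<close>.\<close>

lemma picone: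
  fixes g g' :: "real \<Rightarrow> real"
  assumes f': "has_weak_gradient UNIV f f'"
    and st: "a \<le> s" "s < t" "t < b" and nz: "\<And>r. s < r \<Longrightarrow> r < t \<Longrightarrow> flux r \<noteq> 0"
    and cd: "s < c" "c < d" "d < t"
    and g: "\<And>r. (g has_real_derivative g' r) (at r)" and g'c: "continuous_on UNIV g'"
    and gz: "\<And>r. r \<notin> {c..d} \<Longrightarrow> g r = 0" "\<And>r. r \<notin> {c..d} \<Longrightarrow> g' r = 0"
  shows "(\<lambda>r. f' (U r) * r powr \<alpha> * (zeta r * g r)\<^sup>2 * r ^ (DIM('a) - 1)) absolutely_integrable_on {s<..<t}"
    "integral {s<..<t} (\<lambda>r. (zeta' r * g r + zeta r * g' r)\<^sup>2 * r ^ (DIM('a) - 1))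
      - integral {s<..<t} (\<lambda>r. f' (U r) * r powr \<alpha> * (zeta r * g r)\<^sup>2 * r ^ (DIM('a) - 1))
      + crit * integral {s<..<t} (\<lambda>r. (zeta r * g r / r)\<^sup>2 * r ^ (DIM('a) - 1))
      = integral {s<..<t} (\<lambda>r. (zeta r * g' r)\<^sup>2 * r ^ (DIM('a) - 1))"
proof -
  let ?S = "{s<..<t}"
  let ?w = "\<lambda>r::real. r ^ (DIM('a) - 1)"
  have pos: "r > 0" if "s < r" for r using that st a_nonneg by simp
  have cdab: "{c..d} \<subseteq> {a<..<b}" using st cd by auto
  have gc: "continuous_on A g" for A by (rule DERIV_continuous_on[OF has_field_derivative_at_within[OF g]])
  have g'c': "continuous_on A g'" for A using continuous_on_subset[OF g'c] by auto
  have abrad: "{a<..<b} \<subseteq> radii" using radii_interior by auto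
  have fUc: "continuous_on {a<..<b} (\<lambda>r. f (U r))"
    by (rule continuous_on_compose2[OF f_cont continuous_on_subset[OF U_cont abrad]]) auto
  have fluxc: "continuous_on {a<..<b} flux" by (rule continuous_on_subset[OF flux_cont abrad])
  have srcc: "continuous_on {a<..<b} source" by (rule continuous_on_subset[OF source_cont abrad])
  \<comment> \<open>With this \<open>K\<close>, the product of U' and \<open>K\<close> in the chain
    rule equals r^\<alpha> (zeta g)^2 r^(N-1), the weight of f'(U) in the energy.\<close>
  define K where "K r = flux r * (g r)\<^sup>2" for r
  define K' where "K' r = - source r * (g r)\<^sup>2 + flux r * (2 * g r * g' r)" for r
  have Kd: "(K has_real_derivative K' r) (at r)" if "s < r" "r < t" for r
  proof -
    have "a < r" "r < b" using that st by auto
    then show ?thesis unfolding K_def[abs_def] K'_def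
      using flux_DERIV[of r] g[of r] by (auto intro!: derivative_eq_intros simp: algebra_simps)
  qed
  have K'c: "continuous_on {s<..<t} K'"
    unfolding K'_def[abs_def] using st
    by (intro continuous_intros gc g'c' continuous_on_subset[OF fluxc] continuous_on_subset[OF srcc]) auto
  note chain = weak_chain_rule[OF f' st nz cd Kd K'c]
  have Kz: "K r = 0" "K' r = 0" if "r \<notin> {c..d}" for r using gz[OF that] by (auto simp: K_def K'_def)
  have id1: "f' (U r) * (flux r / ?w r) * K r = f' (U r) * r powr \<alpha> * (zeta r * g r)\<^sup>2 * ?w r" if "r \<in> ?S" for r
  proof -
    have r: "r > 0" using that pos by auto
    define e where "e = r powr (\<alpha> / 2)"
    define w where "w = ?w r"
    have ew: "e > 0" "w > 0" using r by (auto simp: e_def w_def)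
    have "r powr \<alpha> = e\<^sup>2" using r by (simp add: e_def power2_eq_square powr_add[symmetric])
    then show ?thesis
      unfolding K_def zeta_def e_def[symmetric] w_def[symmetric] using ew by (simp add: field_simps power2_eq_square)
  qed
  have ai: "(\<lambda>r. f' (U r) * (flux r / ?w r) * K r) absolutely_integrable_on ?S"
    by (rule chain(1)) (use Kz in auto)
  show "(\<lambda>r. f' (U r) * r powr \<alpha> * (zeta r * g r)\<^sup>2 * ?w r) absolutely_integrable_on ?S"
    by (rule absolutely_integrable_spike[OF ai negligible_empty]) (use id1 in auto)
  have "integral ?S (\<lambda>r. f' (U r) * r powr \<alpha> * (zeta r * g r)\<^sup>2 * ?w r) = integral ?S (\<lambda>r. f' (U r) * (flux r / ?w r) * K r)"
    by (rule integral_cong) (rule id1[symmetric])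
  also have "\<dots> = - integral ?S (\<lambda>r. f (U r) * K' r)"
    using chain(2) Kz by simp
  finally have e0: "integral ?S (\<lambda>r. f' (U r) * r powr \<alpha> * (zeta r * g r)\<^sup>2 * ?w r) = - integral ?S (\<lambda>r. f (U r) * K' r)" .
  have red: "integral ?S F = integral {c..d} F" if "continuous_on {a<..<b} F" "\<And>r. r \<notin> {c..d} \<Longrightarrow> F r = 0" for F :: "real \<Rightarrow> real"
  proof -
    have "{c..d} - ?S = {}" using cd by auto
    then show ?thesis
      using that by (intro absolutely_integrable_continuous_extend_zero(2) continuous_on_subset[OF that(1) cdab]) auto
  qed
  define F1 where "F1 r = (zeta' r * g r + zeta r * g' r)\<^sup>2 * ?w r" for r
  define F2 where "F2 r = f (U r) * K' r" for r
  define F3 where "F3 r = (zeta r * g r / r)\<^sup>2 * ?w r" for r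
  define F4 where "F4 r = (zeta r * g' r)\<^sup>2 * ?w r" for r
  have K'cab: "continuous_on {a<..<b} K'"
    unfolding K'_def[abs_def] by (intro continuous_intros gc g'c' fluxc srcc)
  have Fc: "continuous_on {a<..<b} F1" "continuous_on {a<..<b} F2" "continuous_on {a<..<b} F3" "continuous_on {a<..<b} F4"
    unfolding F1_def[abs_def] F2_def[abs_def] F3_def[abs_def] F4_def[abs_def]
    using a_nonneg by (auto intro!: continuous_intros zeta_cont zeta'_cont gc g'c' fUc K'cab)
  have Fr: "integral ?S F1 = integral {c..d} F1" "integral ?S F2 = integral {c..d} F2"
     "integral ?S F3 = integral {c..d} F3" "integral ?S F4 = integral {c..d} F4"
    by (rule red[OF Fc(1)] red[OF Fc(2)] red[OF Fc(3)] red[OF Fc(4)];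
        use gz Kz in \<open>simp add: F1_def F2_def F3_def F4_def\<close>)+
  have Fi: "F1 integrable_on {c..d}" "F2 integrable_on {c..d}" "F3 integrable_on {c..d}" "F4 integrable_on {c..d}"
    using Fc by (auto intro!: integrable_continuous_real continuous_on_subset[OF _ cdab])
  \<comment> \<open>Once the potential term is rewritten through f(U) K', the whole integrand is the
    derivative of \<open>H\<close>. Comparing the terms with zeta^2 g^2 / r^2 is what determines the
    value of \<open>crit\<close>.\<close>
  define H where "H r = - \<gamma> * (?w r * (zeta r)\<^sup>2 * (g r)\<^sup>2 / r)" for r
  have Hd: "(H has_real_derivative F1 r + F2 r + crit * F3 r - F4 r) (at r)" if "r \<in> {a<..<b}" for r
  proof -
    have r: "r > 0" using that a_nonneg by auto
    define e where "e = r powr (\<alpha> / 2)"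
    define w where "w = ?w r"
    have ew: "e > 0" "w > 0" using r by (auto simp: e_def w_def)
    have zd: "(zeta has_real_derivative zeta' r) (at r)" by (rule zeta_DERIV) (use that in auto)
    have P: "flux r = zeta r * (e * w)" using ew by (simp add: zeta_def e_def w_def)
    have S: "source r = e\<^sup>2 * w * f (U r)" using powr_\<sigma>'[OF r] by (simp add: source_def e_def w_def)
    have wd: "(?w has_real_derivative (real DIM('a) - 1) * w / r) (at r)" unfolding w_def by (rule pow_deriv[OF r])
    have d1: "((\<lambda>r. ?w r * (zeta r)\<^sup>2 * (g r)\<^sup>2) has_real_derivative
        (real DIM('a) - 1) * w / r * (zeta r)\<^sup>2 * (g r)\<^sup>2 + w * (2 * zeta r * zeta' r) * (g r)\<^sup>2 + w * (zeta r)\<^sup>2 * (2 * g r * g' r)) (at r)"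
      by (rule derivative_eq_intros wd zd g refl | simp add: w_def algebra_simps)+
    have "(H has_real_derivative - \<gamma> * ((((real DIM('a) - 1) * w / r * (zeta r)\<^sup>2 * (g r)\<^sup>2 + w * (2 * zeta r * zeta' r) * (g r)\<^sup>2 + w * (zeta r)\<^sup>2 * (2 * g r * g' r)) * r
        - w * (zeta r)\<^sup>2 * (g r)\<^sup>2 * 1) / (r * r))) (at r)"
      unfolding H_def[abs_def] using DERIV_cmult[OF DERIV_divide[OF d1 DERIV_ident], of "- \<gamma>"] r by (simp add: w_def)
    moreover have "- \<gamma> * ((((real DIM('a) - 1) * w / r * (zeta r)\<^sup>2 * (g r)\<^sup>2 + w * (2 * zeta r * zeta' r) * (g r)\<^sup>2 + w * (zeta r)\<^sup>2 * (2 * g r * g' r)) * r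
        - w * (zeta r)\<^sup>2 * (g r)\<^sup>2 * 1) / (r * r)) = F1 r + F2 r + crit * F3 r - F4 r"
    proof -
      define Z where "Z = zeta r"
      define y where "y = f (U r)"
      define n where "n = real DIM('a)"
      define x where "x = inverse r"
      have z': "zeta' r = - \<gamma> * Z * x - e * y"
        unfolding zeta'_def Z_def e_def y_def x_def by (simp only: divide_inverse)
      have quot: "(A * r - B * 1) * inverse (r * r) = A * x - B * x\<^sup>2" for A B
        using r by (simp add: x_def field_simps power2_eq_square)
      show ?thesis
        unfolding F1_def F2_def F3_def F4_def K'_def P S z' crit_def divide_inverse quot x_def[symmetric]
          Z_def[symmetric] y_def[symmetric] n_def[symmetric] w_def[symmetric]
        by algebra
    qed
    ultimately show ?thesis by simp
  qed
  have hi1: "((\<lambda>r. F1 r + F2 r + crit * F3 r - F4 r) has_integral H d - H c) {c..d}"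
  proof (rule fundamental_theorem_of_calculus)
    fix r assume "r \<in> {c..d}"
    then have "r \<in> {a<..<b}" using cdab by blast
    from has_field_derivative_at_within[OF Hd[OF this]]
    show "(H has_vector_derivative F1 r + F2 r + crit * F3 r - F4 r) (at r within {c..d})"
      by (simp only: has_real_derivative_iff_has_vector_derivative)
  qed (use cd in simp)
  \<comment> \<open>\<open>g\<close> is continuous and vanishes outside [c,d], hence also at the end
    points, so no boundary terms remain.\<close>
  have H0: "H d = 0" "H c = 0"
  proof -
    have lim: "(g \<longlongrightarrow> g r) (at r within A)" for r A
      using DERIV_isCont[OF g, of r] by (auto simp: isCont_def intro: tendsto_within_subset)
    have right: "\<forall>\<^sub>F r in at_right d. g r = 0"
      using eventually_at_right_less[of d] by eventually_elim (simp add: gz(1))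
    have left: "\<forall>\<^sub>F r in at_left c. g r = 0"
      unfolding eventually_at_left_field by (intro exI[of _ "c - 1"]) (auto intro!: gz(1))
    have "g d = 0"
      by (rule tendsto_unique[OF trivial_limit_at_right_real lim tendsto_eventually[OF right]])
    moreover have "g c = 0"
      by (rule tendsto_unique[OF trivial_limit_at_left_real lim tendsto_eventually[OF left]])
    ultimately show "H d = 0" "H c = 0" by (simp_all add: H_def)
  qed
  have hi2: "((\<lambda>r. F1 r + F2 r + crit * F3 r - F4 r) has_integral
      integral {c..d} F1 + integral {c..d} F2 + crit * integral {c..d} F3 - integral {c..d} F4) {c..d}"
    by (intro has_integral_add has_integral_diff has_integral_mult_right integrable_integral Fi)
  have "integral {c..d} F1 + integral {c..d} F2 + crit * integral {c..d} F3 - integral {c..d} F4 = 0"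
    using has_integral_unique[OF hi2 hi1] H0 by simp
  then have "integral ?S F1 + integral ?S F2 + crit * integral ?S F3 = integral ?S F4" using Fr by simp
  then show "integral {s<..<t} (\<lambda>r. (zeta' r * g r + zeta r * g' r)\<^sup>2 * r ^ (DIM('a) - 1))
      - integral {s<..<t} (\<lambda>r. f' (U r) * r powr \<alpha> * (zeta r * g r)\<^sup>2 * r ^ (DIM('a) - 1))
      + crit * integral {s<..<t} (\<lambda>r. (zeta r * g r / r)\<^sup>2 * r ^ (DIM('a) - 1))
      = integral {s<..<t} (\<lambda>r. (zeta r * g' r)\<^sup>2 * r ^ (DIM('a) - 1))"
    unfolding e0 F1_def[abs_def] F2_def[abs_def] F3_def[abs_def] F4_def[abs_def] by simp
qed

end

section \<open>Cut-off functions and the truncated profile\<close>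

definition smooth_step :: "real \<Rightarrow> real" where
  "smooth_step x = 1 - (max 0 (1 - (max 0 x)\<^sup>2))\<^sup>2"

definition smooth_step' :: "real \<Rightarrow> real" where
  "smooth_step' x = 4 * max 0 (1 - (max 0 x)\<^sup>2) * max 0 x"

lemma smooth_step_DERIV: "(smooth_step has_real_derivative smooth_step' x) (at x)"
proof -
  have "((\<lambda>x. 1 - (max 0 x)\<^sup>2) has_real_derivative - (2 * max 0 x)) (at x)"
    using DERIV_diff[OF DERIV_const[of 1] DERIV_pospart_square] by simp
  from DERIV_diff[OF DERIV_const[of 1] DERIV_chain2[OF DERIV_pospart_square this]]
  show ?thesis by (simp add: smooth_step_def[abs_def] smooth_step'_def mult.assoc)
qed

lemma smooth_step'_cont: "continuous_on S smooth_step'"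
  unfolding smooth_step'_def[abs_def] by (intro continuous_intros)

lemma smooth_step_0: "x \<le> 0 \<Longrightarrow> smooth_step x = 0" "x \<le> 0 \<Longrightarrow> smooth_step' x = 0"
  by (simp_all add: smooth_step_def smooth_step'_def max_absorb1)

lemma smooth_step_1: "1 \<le> x \<Longrightarrow> smooth_step x = 1" "1 \<le> x \<Longrightarrow> smooth_step' x = 0"
  using one_le_power[of x 2] by (simp_all add: smooth_step_def smooth_step'_def max_absorb1 max_absorb2)

lemma smooth_step_bounds: "0 \<le> smooth_step x" "smooth_step x \<le> 1" "0 \<le> smooth_step' x" "smooth_step' x \<le> 4"
proof -
  define m where "m = max 0 (1 - (max 0 x)\<^sup>2)"
  have m: "0 \<le> m" "m \<le> 1" by (auto simp: m_def)
  then show "0 \<le> smooth_step x" "smooth_step x \<le> 1"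
    by (auto simp: smooth_step_def m_def[symmetric] power_le_one)
  show "0 \<le> smooth_step' x" using m by (simp add: smooth_step'_def)
  show "smooth_step' x \<le> 4"
  proof (cases "x \<le> 1")
    case True
    have "m * max 0 x \<le> 1 * 1" using m True by (intro mult_mono) auto
    then show ?thesis by (simp add: smooth_step'_def m_def)
  next
    case False
    then show ?thesis using smooth_step_1(2)[of x] by simp
  qed
qed

lemma absolutely_integrable_extend:
  fixes F :: "real \<Rightarrow> real"
  assumes "F absolutely_integrable_on S" "S \<subseteq> T" "\<And>r. r \<in> T \<Longrightarrow> r \<notin> S \<Longrightarrow> F r = 0"
  shows "F absolutely_integrable_on T" "integral T F = integral S F"
proof -
  have e: "(\<lambda>r. if r \<in> T then F r else 0) = (\<lambda>r. if r \<in> S then F r else 0)"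
    using assms(2,3) by (auto simp: fun_eq_iff)
  have "(\<lambda>r. if r \<in> S then F r else 0) absolutely_integrable_on UNIV"
    using assms(1) by (simp only: absolutely_integrable_restrict_UNIV)
  then show "F absolutely_integrable_on T"
    unfolding e[symmetric] by (simp only: absolutely_integrable_restrict_UNIV)
  show "integral T F = integral S F"
    using integral_restrict_UNIV[of T F] integral_restrict_UNIV[of S F] unfolding e by simp
qed

lemma integral_pos:
  fixes F :: "real \<Rightarrow> real"
  assumes "x < y" "continuous_on {x..y} F" "\<And>r. r \<in> {x..y} \<Longrightarrow> 0 \<le> F r" "z \<in> {x..y}" "F z \<noteq> 0"
  shows "0 < integral {x..y} F"
proof -
  have "integral {x..y} F \<noteq> 0"
    using integral_eq_0_iff[of x y F] assms by auto
  moreover have "0 \<le> integral {x..y} F"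
    using assms by (intro integral_nonneg integrable_continuous_real) auto
  ultimately show ?thesis by simp
qed

context radial_solution
begin

text \<open>The flux vanishes at both ends and its derivative is bounded by M r^\<sigma>, so it
  decays at least linearly. Dividing by r^\<gamma> preserves this: near t because r is bounded
  below, near s because \<sigma> - \<gamma> = \<alpha>/2 \<ge> 0, even if s is the centre.\<close>

lemma zeta_bounds:
  assumes st: "s < t" "{s..t} \<subseteq> radii" "flux s = 0" "flux t = 0"
  obtains L where "L \<ge> 0" "\<And>r. s < r \<Longrightarrow> r < t \<Longrightarrow> \<bar>zeta r\<bar> \<le> L * (r - s)"
    "\<And>r. (s + t) / 2 \<le> r \<Longrightarrow> r < t \<Longrightarrow> \<bar>zeta r\<bar> \<le> L * (t - r)"
proof -
  have "s \<in> radii" "t \<in> radii" using st by auto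
  then have ab: "a \<le> s" "t < b" by (auto simp: radii_def split: if_splits)
  have s0: "0 \<le> s" using ab a_nonneg by simp
  have "compact ((\<lambda>r. f (U r)) ` {s..t})"
    by (intro compact_continuous_image continuous_on_compose2[OF f_cont continuous_on_subset[OF U_cont st(2)]]) auto
  from compact_imp_bounded[OF this]
  obtain M where M: "M > 0" "\<And>r. r \<in> {s..t} \<Longrightarrow> \<bar>f (U r)\<bar> \<le> M" by (auto simp: bounded_pos)
  have fc: "continuous_on {s..t} flux" by (rule continuous_on_subset[OF flux_cont st(2)])
  \<comment> \<open>The factor \<open>y powr \<sigma>\<close>, rather than its upper bound
    \<open>t powr \<sigma>\<close>, is what compensates the later division by powers of r when s =
    0.\<close>
  have step: "\<bar>flux y - flux x\<bar> \<le> (y - x) * (M * y powr \<sigma>)" if "s \<le> x" "x < y" "y \<le> t" for x y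
  proof -
    have "\<exists>l z. x < z \<and> z < y \<and> (flux has_real_derivative l) (at z) \<and> flux y - flux x = (y - x) * l"
    proof (rule MVT[OF that(2)])
      show "continuous_on {x..y} flux" by (rule continuous_on_subset[OF fc]) (use that in auto)
      show "flux differentiable (at z)" if "x < z" "z < y" for z
        using flux_DERIV[of z] that \<open>s \<le> x\<close> \<open>y \<le> t\<close> ab by (auto simp: real_differentiable_def)
    qed
    then obtain l z where z: "x < z" "z < y" "(flux has_real_derivative l) (at z)" "flux y - flux x = (y - x) * l"
      by blast
    have "l = - source z" using z(3) flux_DERIV[of z] DERIV_unique z that ab by fastforce
    then have "\<bar>l\<bar> = \<bar>f (U z)\<bar> * z powr \<sigma>" by (simp add: source_def abs_mult mult.commute)
    also have "\<dots> \<le> M * y powr \<sigma>"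
      using z that s0 M \<sigma>_ge_1 by (intro mult_mono powr_mono2) auto
    finally show ?thesis using z that by (simp add: abs_mult)
  qed
  have pz: "\<bar>zeta r\<bar> = \<bar>flux r\<bar> / (r powr (\<alpha> / 2) * r ^ (DIM('a) - 1))" if "r > 0" for r
    using that by (simp add: zeta_def abs_mult)
  define L1 where "L1 = M * t powr (\<alpha> / 2)"
  define m where "m = (s + t) / 2"
  have m: "0 < m" using st s0 by (simp add: m_def)
  define L2 where "L2 = M * t powr \<sigma> / (m powr (\<alpha> / 2) * m ^ (DIM('a) - 1))"
  have b1: "\<bar>zeta r\<bar> \<le> L1 * (r - s)" if "s < r" "r < t" for r
  proof -
    have r: "r > 0" using that s0 by simp
    define e where "e = r powr (\<alpha> / 2)"
    define w where "w = r ^ (DIM('a) - 1)"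
    have ew: "e > 0" "w > 0" using r by (auto simp: e_def w_def)
    have "\<bar>flux r\<bar> \<le> (r - s) * (M * (e\<^sup>2 * w))"
      using step[of s r] that st powr_\<sigma>'[OF r] by (simp add: e_def w_def)
    then have "\<bar>zeta r\<bar> \<le> (r - s) * (M * (e\<^sup>2 * w)) / (e * w)"
      unfolding pz[OF r] e_def[symmetric] w_def[symmetric] using ew by (intro divide_right_mono) auto
    also have "\<dots> = M * e * (r - s)" using ew by (simp add: field_simps power2_eq_square)
    also have "\<dots> \<le> L1 * (r - s)"
      unfolding L1_def e_def using M that r \<alpha>_nonneg by (intro mult_right_mono mult_left_mono powr_mono2) auto
    finally show ?thesis .
  qed
  have b2: "\<bar>zeta r\<bar> \<le> L2 * (t - r)" if "m \<le> r" "r < t" for r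
  proof -
    have r: "r > 0" "s \<le> r" using that m st by (auto simp: m_def)
    have "\<bar>flux r\<bar> \<le> (t - r) * (M * t powr \<sigma>)"
      using step[of r t] that r st by simp
    then have "\<bar>zeta r\<bar> \<le> (t - r) * (M * t powr \<sigma>) / (r powr (\<alpha> / 2) * r ^ (DIM('a) - 1))"
      unfolding pz[OF r(1)] using r by (intro divide_right_mono) auto
    also have "\<dots> \<le> (t - r) * (M * t powr \<sigma>) / (m powr (\<alpha> / 2) * m ^ (DIM('a) - 1))"
      using that m M r \<alpha>_nonneg by (intro divide_left_mono mult_mono powr_mono2 power_mono mult_pos_pos mult_nonneg_nonneg) auto
    finally show ?thesis by (simp add: L2_def mult_ac)
  qed
  have L: "0 \<le> L1" "0 \<le> L2" using M m by (auto simp: L1_def L2_def)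
  show ?thesis
  proof (rule that[of "max L1 L2"])
    show "\<bar>zeta r\<bar> \<le> max L1 L2 * (r - s)" if "s < r" "r < t" for r
      by (rule order_trans[OF b1[OF that]]) (use that in \<open>auto intro!: mult_right_mono\<close>)
    show "\<bar>zeta r\<bar> \<le> max L1 L2 * (t - r)" if "(s + t) / 2 \<le> r" "r < t" for r
      by (rule order_trans[OF b2]) (use that in \<open>auto simp: m_def intro!: mult_right_mono\<close>)
  qed (use L in auto)
qed

text \<open>Truncating \<open>zeta\<close> between two consecutive critical points of \<open>U\<close> costs arbitrarily little
  energy, because \<open>zeta\<close> vanishes linearly there.\<close>

lemma test_profile:
  assumes f': "has_weak_gradient UNIV f f'" and zones: "card (nodal_zones \<Omega> u) \<ge> 2" and \<Lambda>: "\<Lambda> + 1 \<le> crit"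
  obtains \<eta> \<eta>' c d where "a < c" "d < b"
    "\<And>r. (\<eta> has_real_derivative \<eta>' r) (at r)" "continuous_on UNIV \<eta>'"
    "\<And>r. r \<notin> {c..d} \<Longrightarrow> \<eta> r = 0" "\<exists>r. \<eta> r \<noteq> 0"
    "(\<lambda>r. ((\<eta>' r)\<^sup>2 - r powr \<alpha> * f' (U r) * (\<eta> r)\<^sup>2) * r ^ (DIM('a) - 1)) absolutely_integrable_on {a<..<b}"
    "(\<lambda>r. (\<eta> r / r)\<^sup>2 * r ^ (DIM('a) - 1)) absolutely_integrable_on {a<..<b}"
    "integral {a<..<b} (\<lambda>r. ((\<eta>' r)\<^sup>2 - r powr \<alpha> * f' (U r) * (\<eta> r)\<^sup>2) * r ^ (DIM('a) - 1))
      + \<Lambda> * integral {a<..<b} (\<lambda>r. (\<eta> r / r)\<^sup>2 * r ^ (DIM('a) - 1)) < 0"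
proof -
  obtain s t where st: "s < t" "{s..t} \<subseteq> radii" "flux s = 0" "flux t = 0"
    and nz: "\<And>r. s < r \<Longrightarrow> r < t \<Longrightarrow> flux r \<noteq> 0"
    by (rule critical_interval[OF zones]) blast
  have "s \<in> radii" "t \<in> radii" using st by auto
  then have ab: "a \<le> s" "t < b" by (auto simp: radii_def split: if_splits)
  obtain L where L: "L \<ge> 0" "\<And>r. s < r \<Longrightarrow> r < t \<Longrightarrow> \<bar>zeta r\<bar> \<le> L * (r - s)"
    "\<And>r. (s + t) / 2 \<le> r \<Longrightarrow> r < t \<Longrightarrow> \<bar>zeta r\<bar> \<le> L * (t - r)"
    by (rule zeta_bounds[OF st]) blast
  let ?S = "{s<..<t}" and ?w = "\<lambda>r::real. r ^ (DIM('a) - 1)"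
  have Sab: "?S \<subseteq> {a<..<b}" using ab by auto
  have pos: "r > 0" if "s < r" for r using that ab a_nonneg by simp
  \<comment> \<open>With the summand 8, twice \<open>h n\<close> is at most a quarter of t - s, so
    all cut-offs equal 1 on the middle half of the interval.\<close>
  define h where "h n = (t - s) / (real n + 8)" for n :: nat
  have h: "h n > 0" "h n \<le> (t - s) / 8" for n
  proof -
    show "h n > 0" using st by (simp add: h_def)
    show "h n \<le> (t - s) / 8" unfolding h_def by (rule divide_left_mono) (use st in auto)
  qed
  have h0: "h \<longlonglongrightarrow> 0" unfolding h_def by real_asymp
  define p where "p n r = smooth_step ((r - s) / h n - 1)" for n r
  define q where "q n r = smooth_step ((t - r) / h n - 1)" for n r
  define p' where "p' n r = smooth_step' ((r - s) / h n - 1) / h n" for n r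
  define q' where "q' n r = - smooth_step' ((t - r) / h n - 1) / h n" for n r
  have pd: "(p n has_real_derivative p' n r) (at r)" for n r
  proof -
    have "((\<lambda>r. (r - s) / h n - 1) has_real_derivative 1 / h n) (at r)"
      using h(1)[of n] by (auto intro!: derivative_eq_intros)
    from DERIV_chain2[OF smooth_step_DERIV this] show ?thesis by (simp add: p_def[abs_def] p'_def)
  qed
  have qd: "(q n has_real_derivative q' n r) (at r)" for n r
  proof -
    have "((\<lambda>r. (t - r) / h n - 1) has_real_derivative - 1 / h n) (at r)"
      using h(1)[of n] by (auto intro!: derivative_eq_intros)
    from DERIV_chain2[OF smooth_step_DERIV this] show ?thesis by (simp add: q_def[abs_def] q'_def)
  qed
  have p0: "p n r = 0" "p' n r = 0" if "r \<le> s + h n" for n r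
    using that h(1)[of n] by (auto simp: p_def p'_def field_simps intro!: smooth_step_0)
  have q0: "q n r = 0" "q' n r = 0" if "t - h n \<le> r" for n r
    using that h(1)[of n] by (auto simp: q_def q'_def field_simps intro!: smooth_step_0)
  have p1: "p n r = 1" "p' n r = 0" if "s + 2 * h n \<le> r" for n r
    using that h(1)[of n] by (auto simp: p_def p'_def field_simps intro!: smooth_step_1)
  have q1: "q n r = 1" "q' n r = 0" if "r \<le> t - 2 * h n" for n r
    using that h(1)[of n] by (auto simp: q_def q'_def field_simps intro!: smooth_step_1)
  have pb: "0 \<le> p n r" "p n r \<le> 1" "\<bar>p' n r\<bar> \<le> 4 / h n" and qb: "0 \<le> q n r" "q n r \<le> 1" "\<bar>q' n r\<bar> \<le> 4 / h n" for n r
    using h(1)[of n] smooth_step_bounds by (auto simp: p_def q_def p'_def q'_def abs_mult divide_right_mono)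
  have p'c: "continuous_on UNIV (p' n)" and q'c: "continuous_on UNIV (q' n)" for n
    unfolding p'_def[abs_def] q'_def[abs_def] using h(1)[of n]
    by (intro continuous_intros continuous_on_compose2[OF smooth_step'_cont[of UNIV]]; simp)+
  define g where "g n r = p n r * q n r" for n r
  define g' where "g' n r = p' n r * q n r + p n r * q' n r" for n r
  have gd: "(g n has_real_derivative g' n r) (at r)" for n r
    unfolding g_def[abs_def] g'_def using DERIV_mult[OF pd[of n r] qd[of n r]] by (simp add: mult.commute)
  have pc: "continuous_on UNIV (p n)" and qc: "continuous_on UNIV (q n)" and gc: "continuous_on UNIV (g n)" for n
    by (rule DERIV_continuous_on[OF has_field_derivative_at_within[OF pd]]
         DERIV_continuous_on[OF has_field_derivative_at_within[OF qd]]
         DERIV_continuous_on[OF has_field_derivative_at_within[OF gd]])+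
  have g'c: "continuous_on UNIV (g' n)" for n
    unfolding g'_def[abs_def] by (intro continuous_intros pc qc p'c q'c)
  have gz: "g n r = 0" "g' n r = 0" if "r \<notin> {s + h n..t - h n}" for n r
    using that p0[of r n] q0[of n r] by (auto simp: g_def g'_def not_le)
  have cd: "s < s + h n" "s + h n < t - h n" "t - h n < t" for n
    using h(1)[of n] h(2)[of n] st by (auto simp: field_simps)
  \<comment> \<open>The cost of truncation tends to 0. Where g' is nonzero, |zeta| is at most 2 L h
    and |g'| at most 8 / h, so their product stays below 16 L for every n, while at each fixed r the
    value of g' is eventually 0.\<close>
  have J: "(\<lambda>n. integral ?S (\<lambda>r. (zeta r * g' n r)\<^sup>2 * ?w r)) \<longlonglongrightarrow> integral ?S (\<lambda>r. 0)"
  proof (rule dominated_convergence(2)[where h="\<lambda>r. (16 * L)\<^sup>2 * ?w t"])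
    show "(\<lambda>r. (16 * L)\<^sup>2 * ?w t) integrable_on ?S"
      by (rule integrable_on_open_interval_real[THEN iffD2, OF integrable_const_ivl])
    have F4c: "continuous_on {a<..<b} (\<lambda>r. (zeta r * g' n r)\<^sup>2 * ?w r)" for n
      by (intro continuous_intros zeta_cont continuous_on_subset[OF g'c]) auto
    show "(\<lambda>r. (zeta r * g' n r)\<^sup>2 * ?w r) integrable_on ?S" for n
    proof -
      have "(\<lambda>r. (zeta r * g' n r)\<^sup>2 * ?w r) absolutely_integrable_on ?S"
      proof (rule absolutely_integrable_continuous_extend_zero(1))
        show "continuous_on {s + h n..t - h n} (\<lambda>r. (zeta r * g' n r)\<^sup>2 * ?w r)"
          by (rule continuous_on_subset[OF F4c]) (use cd[of n] ab in auto)
        have "{s + h n..t - h n} - ?S = {}" using cd[of n] by auto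
        then show "negligible ({s + h n..t - h n} - ?S)" by simp
      qed (simp add: gz)
      then show ?thesis by (rule set_lebesgue_integral_eq_integral(1))
    qed
    show "norm ((zeta r * g' n r)\<^sup>2 * ?w r) \<le> (16 * L)\<^sup>2 * ?w t" if r: "r \<in> ?S" for n r
    proof -
      have hn: "h n > 0" by (rule h(1))
      have "\<bar>g' n r\<bar> \<le> 8 / h n"
      proof -
        have "\<bar>g' n r\<bar> \<le> \<bar>p' n r\<bar> * q n r + p n r * \<bar>q' n r\<bar>"
          unfolding g'_def using abs_triangle_ineq[of "p' n r * q n r" "p n r * q' n r"] pb(1)[of n r] qb(1)[of n r]
          by (simp add: abs_mult)
        also have "\<dots> \<le> 4 / h n * 1 + 1 * (4 / h n)"
          using pb[where n=n and r=r] qb[where n=n and r=r] hn by (intro add_mono mult_mono) auto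
        finally show ?thesis by simp
      qed
      moreover have "\<bar>zeta r\<bar> \<le> L * (2 * h n)" if "g' n r \<noteq> 0"
      proof (cases "r < s + 2 * h n")
        case True
        have "\<bar>zeta r\<bar> \<le> L * (r - s)" using L(2) r by auto
        also have "\<dots> \<le> L * (2 * h n)" using True L(1) by (intro mult_left_mono) auto
        finally show ?thesis .
      next
        case False
        then have "\<not> r \<le> t - 2 * h n" using that p1[of n r] q1[of r n] by (auto simp: g'_def)
        then have "t - r \<le> 2 * h n" "(s + t) / 2 \<le> r" using h(2)[of n] st by (auto simp: field_simps)
        then have "\<bar>zeta r\<bar> \<le> L * (t - r)" "L * (t - r) \<le> L * (2 * h n)" using L(1,3) r by (auto intro!: mult_left_mono)
        then show ?thesis by simp
      qed
      ultimately have "\<bar>zeta r * g' n r\<bar> \<le> 16 * L"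
      proof (cases "g' n r = 0")
        case False
        assume g8: "\<bar>g' n r\<bar> \<le> 8 / h n" and z: "g' n r \<noteq> 0 \<Longrightarrow> \<bar>zeta r\<bar> \<le> L * (2 * h n)"
        have "\<bar>zeta r\<bar> * \<bar>g' n r\<bar> \<le> (L * (2 * h n)) * (8 / h n)"
          using g8 z[OF False] L(1) hn by (intro mult_mono) auto
        also have "\<dots> = 16 * L" using hn by simp
        finally show ?thesis by (simp add: abs_mult)
      qed (use L in simp)
      then have "(zeta r * g' n r)\<^sup>2 \<le> (16 * L)\<^sup>2"
        using power_mono[of "\<bar>zeta r * g' n r\<bar>" "16 * L" 2] by simp
      moreover have "?w r \<le> ?w t" using r pos[of r] by (intro power_mono) auto
      ultimately have "(zeta r * g' n r)\<^sup>2 * ?w r \<le> (16 * L)\<^sup>2 * ?w t"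
        using r pos[of r] by (intro mult_mono) auto
      then show ?thesis using r pos[of r] by (simp add: abs_mult)
    qed
    show "(\<lambda>n. (zeta r * g' n r)\<^sup>2 * ?w r) \<longlonglongrightarrow> 0" if r: "r \<in> ?S" for r
    proof (rule tendsto_eventually)
      have "min (r - s) (t - r) / 2 > 0" using r by auto
      from order_tendstoD(2)[OF h0 this]
      show "\<forall>\<^sub>F n in sequentially. (zeta r * g' n r)\<^sup>2 * ?w r = 0"
      proof eventually_elim
        case (elim n)
        then have "s + 2 * h n \<le> r" "r \<le> t - 2 * h n" by (auto simp: min_def split: if_splits)
        then show ?case using p1[of n r] q1[of r n] by (simp add: g'_def)
      qed
    qed
  qed
  define m1 where "m1 = s + (t - s) / 4"
  define m2 where "m2 = t - (t - s) / 4"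
  have m: "s < m1" "m1 < m2" "m2 < t" using st by (auto simp: m1_def m2_def field_simps)
  let ?I = "\<lambda>r. (zeta r / r)\<^sup>2 * ?w r"
  \<comment> \<open>A positive lower bound for the weighted mass of every truncation, fixed before
    the index \<open>n\<close> of the cut-off is chosen.\<close>
  define \<mu> where "\<mu> = integral {m1..m2} ?I"
  have Ic: "continuous_on {a<..<b} ?I" using a_nonneg by (intro continuous_intros zeta_cont) auto
  have Im: "continuous_on {m1..m2} ?I" by (rule continuous_on_subset[OF Ic]) (use m ab in auto)
  have "\<mu> > 0" unfolding \<mu>_def
  proof (rule integral_pos[OF m(2) Im, of m1])
    show "0 \<le> ?I r" if "r \<in> {m1..m2}" for r using pos[of r] that m by simp
    show "?I m1 \<noteq> 0" using pos[OF m(1)] nz[of m1] m by (simp add: zeta_def)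
  qed (use m in auto)
  then obtain n where n: "integral ?S (\<lambda>r. (zeta r * g' n r)\<^sup>2 * ?w r) < \<mu>"
    using order_tendstoD(2)[OF J, of \<mu>] by (auto simp: eventually_sequentially)
  define c where "c = s + h n"
  define d where "d = t - h n"
  have cd': "s < c" "c < d" "d < t" using cd[of n] by (auto simp: c_def d_def)
  have gz': "g n r = 0" "g' n r = 0" if "r \<notin> {c..d}" for r using gz[of r n] that by (auto simp: c_def d_def)
  note P = picone[OF f' ab(1) st(1) ab(2) nz cd' gd g'c gz']
  define \<eta> where "\<eta> r = zeta r * g n r" for r
  define \<eta>' where "\<eta>' r = zeta' r * g n r + zeta r * g' n r" for r
  have \<eta>z: "\<eta> r = 0" "\<eta>' r = 0" if "r \<notin> {c..d}" for r using gz'[OF that] by (auto simp: \<eta>_def \<eta>'_def)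
  have \<eta>'ab: "continuous_on {a<..<b} \<eta>'" unfolding \<eta>'_def[abs_def]
    by (intro continuous_intros zeta_cont zeta'_cont continuous_on_subset[OF gc] continuous_on_subset[OF g'c]) auto
  have \<eta>ab: "continuous_on {a<..<b} \<eta>" unfolding \<eta>_def[abs_def]
    by (intro continuous_intros zeta_cont continuous_on_subset[OF gc]) auto
  have cdab: "{c..d} \<subseteq> {a<..<b}" using cd' ab by auto
  have cdS: "{c..d} - ?S = {}" using cd' by auto
  have F2: "(\<lambda>r. (\<eta> r / r)\<^sup>2 * ?w r) absolutely_integrable_on ?S"
  proof (rule absolutely_integrable_continuous_extend_zero(1)[where c=c and d=d])
    have "continuous_on {a<..<b} (\<lambda>r. (\<eta> r / r)\<^sup>2 * ?w r)"
      using a_nonneg by (intro continuous_intros \<eta>ab) auto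
    then show "continuous_on {c..d} (\<lambda>r. (\<eta> r / r)\<^sup>2 * ?w r)" by (rule continuous_on_subset[OF _ cdab])
  qed (use cdS \<eta>z in simp_all)
  have F1: "(\<lambda>r. (\<eta>' r)\<^sup>2 * ?w r) absolutely_integrable_on ?S"
  proof (rule absolutely_integrable_continuous_extend_zero(1)[where c=c and d=d])
    have "continuous_on {a<..<b} (\<lambda>r. (\<eta>' r)\<^sup>2 * ?w r)"
      by (intro continuous_intros \<eta>'ab)
    then show "continuous_on {c..d} (\<lambda>r. (\<eta>' r)\<^sup>2 * ?w r)" by (rule continuous_on_subset[OF _ cdab])
  qed (use cdS \<eta>z in simp_all)
  have F3: "(\<lambda>r. f' (U r) * r powr \<alpha> * (\<eta> r)\<^sup>2 * ?w r) absolutely_integrable_on ?S"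
    using P(1) by (simp add: \<eta>_def)
  have F13e: "(\<lambda>r. ((\<eta>' r)\<^sup>2 - r powr \<alpha> * f' (U r) * (\<eta> r)\<^sup>2) * ?w r)
      = (\<lambda>r. (\<eta>' r)\<^sup>2 * ?w r - f' (U r) * r powr \<alpha> * (\<eta> r)\<^sup>2 * ?w r)"
    by (simp add: fun_eq_iff algebra_simps)
  have F13: "(\<lambda>r. ((\<eta>' r)\<^sup>2 - r powr \<alpha> * f' (U r) * (\<eta> r)\<^sup>2) * ?w r) absolutely_integrable_on ?S"
    unfolding F13e by (rule set_integral_diff(1)[OF F1 F3])
  have F13i: "integral ?S (\<lambda>r. ((\<eta>' r)\<^sup>2 - r powr \<alpha> * f' (U r) * (\<eta> r)\<^sup>2) * ?w r)
      = integral ?S (\<lambda>r. (\<eta>' r)\<^sup>2 * ?w r) - integral ?S (\<lambda>r. f' (U r) * r powr \<alpha> * (\<eta> r)\<^sup>2 * ?w r)"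
    unfolding F13e
    by (rule integral_diff[OF set_lebesgue_integral_eq_integral(1)[OF F1] set_lebesgue_integral_eq_integral(1)[OF F3]])
  have I2: "\<mu> \<le> integral ?S (\<lambda>r. (\<eta> r / r)\<^sup>2 * ?w r)"
  proof -
    have "\<mu> = integral {m1..m2} (\<lambda>r. (\<eta> r / r)\<^sup>2 * ?w r)"
      unfolding \<mu>_def
    proof (rule integral_cong)
      fix r assume "r \<in> {m1..m2}"
      then have "s + (t - s) / 4 \<le> r" "r \<le> t - (t - s) / 4" by (auto simp: m1_def m2_def)
      moreover have "2 * h n \<le> (t - s) / 4" using h(2)[of n] by simp
      ultimately have "s + 2 * h n \<le> r" "r \<le> t - 2 * h n" by linarith+
      then have "g n r = 1" using p1[of n r] q1[of r n] by (simp add: g_def)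
      then show "?I r = (\<eta> r / r)\<^sup>2 * ?w r" by (simp add: \<eta>_def)
    qed
    also have "\<dots> \<le> integral ?S (\<lambda>r. (\<eta> r / r)\<^sup>2 * ?w r)"
    proof (rule integral_subset_le)
      show sub: "{m1..m2} \<subseteq> ?S" using m by auto
      show "(\<lambda>r. (\<eta> r / r)\<^sup>2 * ?w r) integrable_on {m1..m2}"
      proof (rule integrable_continuous_real)
        have "continuous_on {a<..<b} (\<lambda>r. (\<eta> r / r)\<^sup>2 * ?w r)"
          using a_nonneg by (intro continuous_intros \<eta>ab) auto
        then show "continuous_on {m1..m2} (\<lambda>r. (\<eta> r / r)\<^sup>2 * ?w r)"
          by (rule continuous_on_subset) (use sub Sab in blast)
      qed
      show "(\<lambda>r. (\<eta> r / r)\<^sup>2 * ?w r) integrable_on ?S" by (rule set_lebesgue_integral_eq_integral(1)[OF F2])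
      show "\<forall>r\<in>?S. 0 \<le> (\<eta> r / r)\<^sup>2 * ?w r" using pos by (simp add: less_imp_le)
    qed
    finally show ?thesis .
  qed
  have main: "integral ?S (\<lambda>r. ((\<eta>' r)\<^sup>2 - r powr \<alpha> * f' (U r) * (\<eta> r)\<^sup>2) * ?w r)
      + \<Lambda> * integral ?S (\<lambda>r. (\<eta> r / r)\<^sup>2 * ?w r) < 0"
  proof -
    have "integral ?S (\<lambda>r. ((\<eta>' r)\<^sup>2 - r powr \<alpha> * f' (U r) * (\<eta> r)\<^sup>2) * ?w r)
      + crit * integral ?S (\<lambda>r. (\<eta> r / r)\<^sup>2 * ?w r) = integral ?S (\<lambda>r. (zeta r * g' n r)\<^sup>2 * ?w r)"
      unfolding F13i using P(2) by (simp add: \<eta>_def \<eta>'_def)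
    \<comment> \<open>The surplus 1 in the assumption on \<open>crit\<close> leaves one full
      weighted mass, at least \<mu>, and this exceeds the cost of truncation.\<close>
    moreover have "(\<Lambda> + 1) * integral ?S (\<lambda>r. (\<eta> r / r)\<^sup>2 * ?w r) \<le> crit * integral ?S (\<lambda>r. (\<eta> r / r)\<^sup>2 * ?w r)"
      using \<Lambda> I2 \<open>\<mu> > 0\<close> by (intro mult_right_mono) auto
    ultimately show ?thesis using n I2 by (simp add: distrib_right)
  qed
  have zo: "\<eta> r = 0" "\<eta>' r = 0" if "r \<notin> ?S" for r using \<eta>z[of r] that cd' by auto
  have X1: "(\<lambda>r. ((\<eta>' r)\<^sup>2 - r powr \<alpha> * f' (U r) * (\<eta> r)\<^sup>2) * ?w r) absolutely_integrable_on {a<..<b}"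
      "integral {a<..<b} (\<lambda>r. ((\<eta>' r)\<^sup>2 - r powr \<alpha> * f' (U r) * (\<eta> r)\<^sup>2) * ?w r)
        = integral ?S (\<lambda>r. ((\<eta>' r)\<^sup>2 - r powr \<alpha> * f' (U r) * (\<eta> r)\<^sup>2) * ?w r)"
    by (rule absolutely_integrable_extend[OF F13 Sab]; simp add: zo)+
  have X2: "(\<lambda>r. (\<eta> r / r)\<^sup>2 * ?w r) absolutely_integrable_on {a<..<b}"
      "integral {a<..<b} (\<lambda>r. (\<eta> r / r)\<^sup>2 * ?w r) = integral ?S (\<lambda>r. (\<eta> r / r)\<^sup>2 * ?w r)"
    by (rule absolutely_integrable_extend[OF F2 Sab]; simp add: zo)+
  show ?thesis
  proof (rule that[of c d \<eta> \<eta>'])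
    show "(\<eta> has_real_derivative \<eta>' r) (at r)" for r
    proof (cases "r \<in> {a<..<b}")
      case True
      then have "(zeta has_real_derivative zeta' r) (at r)" by (intro zeta_DERIV) auto
      then show ?thesis unfolding \<eta>_def[abs_def] \<eta>'_def
        using DERIV_mult[OF _ gd[of n r]] by (fastforce simp: mult.commute add.commute)
    next
      case False
      then have r: "r \<in> - {c..d}" using cdab by auto
      have "((\<lambda>r. 0) has_real_derivative \<eta>' r) (at r)" using \<eta>z[of r] r by simp
      then show ?thesis
        by (rule has_field_derivative_transform_within_open[OF _ _ r]) (use \<eta>z in auto)
    qed
    show "continuous_on UNIV \<eta>'"
    proof -
      have "continuous_on (- {c..d}) \<eta>'"
        by (rule continuous_on_cong[THEN iffD1, OF _ _ continuous_on_const[of _ 0]]) (auto simp: \<eta>z)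
      then have "continuous_on ({a<..<b} \<union> - {c..d}) \<eta>'" by (intro continuous_on_open_Un \<eta>'ab) auto
      moreover have "{a<..<b} \<union> - {c..d} = UNIV" using cdab by auto
      ultimately show ?thesis by simp
    qed
    show "\<exists>r. \<eta> r \<noteq> 0"
    proof (rule ccontr)
      assume "\<not> ?thesis"
      then have "integral ?S (\<lambda>r. (\<eta> r / r)\<^sup>2 * ?w r) = 0" by simp
      then show False using I2 \<open>\<mu> > 0\<close> by simp
    qed
  qed (use cd' ab \<eta>z main X1 X2 in simp_all)
qed

end

section \<open>The angular factors and the Morse index\<close>

text \<open>Cosine of the angle between x and the unit vector e. The convention for division makes
  it 0 at the origin, where all radial factors vanish.\<close>

definition dir_cos :: "'a::euclidean_space \<Rightarrow> 'a \<Rightarrow> real" where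
  "dir_cos e x = (x \<bullet> e) / norm x"

lemma dir_cos_bound: "norm e = 1 \<Longrightarrow> \<bar>dir_cos e x\<bar> \<le> 1"
  using Cauchy_Schwarz_ineq2[of x e] by (auto simp: dir_cos_def divide_le_eq_1)

lemma angular_dir_cos:
  fixes e :: "'a::euclidean_space"
  assumes "norm e = 1" "continuous_on UNIV \<phi>" "\<And>y. \<bar>y\<bar> \<le> 1 \<Longrightarrow> 0 \<le> \<phi> y"
  shows "\<exists>C. angular (\<lambda>x. \<phi> (dir_cos e x)) C"
proof -
  have "compact (\<phi> ` {-1..1})" by (intro compact_continuous_image continuous_on_subset[OF assms(2)]) auto
  from compact_imp_bounded[OF this] obtain C where C: "\<forall>y\<in>{-1..1}. \<bar>\<phi> y\<bar> \<le> C"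
    by (auto simp: bounded_iff)
  have in1: "dir_cos e x \<in> {-1..1}" for x using dir_cos_bound[OF assms(1), of x] by (auto simp: abs_le_iff)
  have "angular (\<lambda>x. \<phi> (dir_cos e x)) C"
  proof
    have [measurable]: "\<phi> \<in> borel_measurable borel" by (rule borel_measurable_continuous_onI[OF assms(2)])
    show "(\<lambda>x. \<phi> (dir_cos e x)) \<in> borel_measurable borel" unfolding dir_cos_def by measurable
    show "0 \<le> \<phi> (dir_cos e x)" for x by (rule assms(3)[OF dir_cos_bound[OF assms(1)]])
    show "\<phi> (dir_cos e x) \<le> C" for x using bspec[OF C in1[of x]] by simp
    show "\<phi> (dir_cos e (t *\<^sub>R x)) = \<phi> (dir_cos e x)" if "t > 0" for t x using that by (simp add: dir_cos_def)
  qed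
  then show ?thesis by blast
qed

text \<open>Since N \<ge> 2 there is a second basis vector, and every angle to e is realised in the
  plane of the two.\<close>

lemma dir_cos_surj:
  fixes e :: "'a::euclidean_space"
  assumes "2 \<le> DIM('a)" "e \<in> Basis" "\<bar>\<tau>\<bar> \<le> 1" "0 < r"
  obtains x where "norm x = r" "dir_cos e x = \<tau>"
proof -
  have "Basis \<noteq> {e}"
  proof
    assume "Basis = {e}"
    then have "DIM('a) = card {e}" by simp
    then show False using assms(1) by simp
  qed
  then obtain e' where e': "e' \<in> Basis" "e' \<noteq> e" using assms(2) by blast
  have ip: "e \<bullet> e = 1" "e' \<bullet> e' = 1" "e \<bullet> e' = 0" "e' \<bullet> e = 0"
    using e' assms(2) by (auto simp: inner_Basis)
  define y where "y = \<tau> *\<^sub>R e + sqrt (1 - \<tau>\<^sup>2) *\<^sub>R e'"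
  have "\<tau>\<^sup>2 \<le> 1" using assms(3) by (simp add: abs_square_le_1)
  then have "norm y = 1"
    by (simp add: y_def norm_eq_sqrt_inner inner_add_left inner_add_right ip power2_eq_square[symmetric])
  moreover have "y \<bullet> e = \<tau>" by (simp add: y_def inner_add_left ip)
  ultimately show ?thesis using assms(4) by (intro that[of "r *\<^sub>R y"]) (auto simp: dir_cos_def)
qed

text \<open>By continuity, a factor that is nonzero at one angle is nonzero on a nonempty open
  subset of the punctured ball, which is not negligible.\<close>

lemma angular_mass_pos:
  fixes e :: "'a::euclidean_space"
  assumes dim: "2 \<le> DIM('a)" and e: "e \<in> Basis" and \<phi>: "angular (\<lambda>x. \<phi> (dir_cos e x)) C" "continuous_on UNIV \<phi>"
    and \<tau>: "\<bar>\<tau>\<bar> \<le> 1" "\<phi> \<tau> \<noteq> 0"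
  shows "0 < angular_mass (\<lambda>x. \<phi> (dir_cos e x))"
proof -
  interpret angular "\<lambda>x. \<phi> (dir_cos e x)" C by fact
  have "(LINT x|lborel. indicator (cball 0 1) x * \<phi> (dir_cos e x)) \<noteq> 0"
  proof
    assume "(LINT x|lborel. indicator (cball 0 1) x * \<phi> (dir_cos e x)) = 0"
    then have "AE x in lborel. indicator (cball 0 1) x * \<phi> (dir_cos e x) = 0"
      using integral_nonneg_eq_0_iff_AE[OF integrable_unit_ball] A_nonneg by auto
    then have ae: "AE x in lebesgue. indicator (cball 0 1) x * \<phi> (dir_cos e x) = 0" by (rule AE_completion)
    define V where "V = {x \<in> ball 0 1 - {0}. \<phi> (dir_cos e x) \<noteq> 0}"
    have "continuous_on (ball 0 1 - {0}) (\<lambda>x. \<phi> (dir_cos e x))"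
      by (rule continuous_on_compose2[OF \<phi>(2)]) (auto simp: dir_cos_def intro!: continuous_intros)
    then have "openin (top_of_set (ball 0 1 - {0})) ((ball 0 1 - {0}) \<inter> (\<lambda>x. \<phi> (dir_cos e x)) -` (- {0}))"
      by (rule continuous_openin_preimage_gen) auto
    moreover have "(ball 0 1 - {0}) \<inter> (\<lambda>x. \<phi> (dir_cos e x)) -` (- {0}) = V" by (auto simp: V_def)
    moreover have "open (ball (0::'a) 1 - {0})" by (intro open_Diff) auto
    ultimately have "open V" using openin_open_eq by metis
    moreover have "V \<noteq> {}"
    proof -
      obtain x where "norm x = 1 / 2" "dir_cos e x = \<tau>" by (rule dir_cos_surj[OF dim e \<tau>(1), of "1/2"]) auto
      then have "x \<in> V" using \<tau>(2) by (auto simp: V_def)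
      then show ?thesis by blast
    qed
    ultimately have "\<not> negligible V" by (rule open_not_negligible)
    moreover have "negligible V"
    proof -
      have "AE x in lebesgue. x \<notin> V" using ae by eventually_elim (auto simp: V_def indicator_def)
      then show ?thesis unfolding negligible_iff_null_sets
        by (simp add: completion.null_sets_iff_AE)
    qed
    ultimately show False by simp
  qed
  then have "angular_mass (\<lambda>x. \<phi> (dir_cos e x)) \<noteq> 0" by (simp add: angular_mass_def)
  then show ?thesis using mass_nonneg by linarith
qed

lemma GDERIV_dir_cos:
  assumes "x \<noteq> 0"
  shows "GDERIV (dir_cos e) x :> (1 / norm x) *\<^sub>R (e - (dir_cos e x / norm x) *\<^sub>R x)"
proof -
  have "GDERIV (\<lambda>x. x \<bullet> e) x :> e" by (auto simp: gderiv_def intro!: derivative_eq_intros)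
  from GDERIV_mult[OF this GDERIV_inverse[OF GDERIV_norm[OF assms]]]
  have "GDERIV (\<lambda>x. (x \<bullet> e) * inverse (norm x)) x :> (x \<bullet> e) *\<^sub>R (- (inverse (norm x))\<^sup>2 *\<^sub>R sgn x) + inverse (norm x) *\<^sub>R e"
    using assms by simp
  moreover have "(x \<bullet> e) *\<^sub>R (- (inverse (norm x))\<^sup>2 *\<^sub>R sgn x) + inverse (norm x) *\<^sub>R e
      = (1 / norm x) *\<^sub>R (e - (dir_cos e x / norm x) *\<^sub>R x)"
    by (simp add: dir_cos_def sgn_div_norm scaleR_diff_right divide_inverse power2_eq_square mult_ac)
  ultimately show ?thesis by (simp add: dir_cos_def[abs_def] divide_inverse)
qed

text \<open>Pythagoras: the radial and tangential parts are orthogonal, and the tangential part of e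
  has squared length 1 minus the squared cosine.\<close>

lemma norm_product_gradient:
  assumes "norm e = 1" "x \<noteq> 0"
  shows "(norm ((A / norm x) *\<^sub>R x + (B / norm x) *\<^sub>R (e - (dir_cos e x / norm x) *\<^sub>R x)))\<^sup>2
    = A\<^sup>2 + (B / norm x)\<^sup>2 * (1 - (dir_cos e x)\<^sup>2)"
proof -
  define y where "y = x /\<^sub>R norm x"
  define \<tau> where "\<tau> = dir_cos e x"
  have y: "y \<bullet> y = 1" using assms(2) by (simp add: y_def dot_square_norm power2_eq_square)
  have e: "e \<bullet> e = 1" using assms(1) by (simp add: dot_square_norm)
  have ye: "y \<bullet> e = \<tau>" "e \<bullet> y = \<tau>" by (simp_all add: y_def \<tau>_def dir_cos_def divide_inverse inner_commute mult.commute)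
  have E: "(A / norm x) *\<^sub>R x + (B / norm x) *\<^sub>R (e - (dir_cos e x / norm x) *\<^sub>R x) = A *\<^sub>R y + (B / norm x) *\<^sub>R (e - \<tau> *\<^sub>R y)"
    by (simp add: y_def \<tau>_def divide_inverse)
  show ?thesis
    unfolding E power2_norm_eq_inner unfolding \<tau>_def[symmetric]
    by (simp add: inner_add_left inner_add_right inner_diff_left inner_diff_right y e ye power2_eq_square algebra_simps diff_divide_distrib)
qed

section \<open>Separation of variables in the quadratic form\<close>

context radial_domain
begin

text \<open>The gradient formula is singular at the origin, but the radial factor vanishes for |x| <
  c, and c > 0.\<close>

lemma is_C1_product:
  fixes \<eta> \<eta>' h h' :: "real \<Rightarrow> real"
  assumes c: "a < c"
    and \<eta>: "\<And>r. (\<eta> has_real_derivative \<eta>' r) (at r)" "continuous_on UNIV \<eta>'" "\<And>r. r \<notin> {c..d} \<Longrightarrow> \<eta> r = 0"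
    and h: "\<And>y. (h has_real_derivative h' y) (at y)" "continuous_on UNIV h'"
  shows "is_C1 (\<lambda>x::'a. \<eta> (norm x) * h (dir_cos e x))
      (\<lambda>x. (\<eta>' (norm x) * h (dir_cos e x) / norm x) *\<^sub>R x
        + (\<eta> (norm x) * h' (dir_cos e x) / norm x) *\<^sub>R (e - (dir_cos e x / norm x) *\<^sub>R x))" (is "is_C1 ?\<Psi> ?G")
proof -
  have c0: "0 < c" using c a_nonneg by simp
  have \<eta>z: "\<eta>' r = 0" if "r < c" for r
    by (rule DERIV_eq_0_of_locally_0[OF \<eta>(1)[of r], of "{..<c}"]) (use that \<eta>(3) in auto)
  have near0: "?\<Psi> x = 0" "?G x = 0" if "x \<in> ball 0 c" for x
    using that \<eta>z[of "norm x"] \<eta>(3)[of "norm x"] by auto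
  have hc: "continuous_on UNIV h" "continuous_on UNIV \<eta>"
    by (rule DERIV_continuous_on[OF has_field_derivative_at_within[OF h(1)]]
        DERIV_continuous_on[OF has_field_derivative_at_within[OF \<eta>(1)]])+
  have "GDERIV ?\<Psi> x :> ?G x" for x
  proof (cases "x = 0")
    case True
    have "GDERIV ?\<Psi> x :> 0"
      by (rule GDERIV_cong_open[OF GDERIV_const[of 0] open_ball[of 0 c]]) (use True c0 near0 in auto)
    then show ?thesis using True by simp
  next
    case False
    from GDERIV_mult[OF GDERIV_DERIV_compose[OF GDERIV_norm[OF False] \<eta>(1)] GDERIV_DERIV_compose[OF GDERIV_dir_cos[OF False, of e] h(1)]]
    show ?thesis by (rule GDERIV_subst) (simp add: sgn_div_norm divide_inverse mult_ac add.commute)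
  qed
  moreover have "continuous_on UNIV ?G"
  proof -
    have dc: "continuous_on (- {0}) (dir_cos e)" by (auto simp: dir_cos_def[abs_def] intro!: continuous_intros)
    have "continuous_on (- {0}) ?G"
      by (intro continuous_intros dc continuous_on_compose2[OF \<eta>(2)] continuous_on_compose2[OF h(2)]
          continuous_on_compose2[OF hc(1)] continuous_on_compose2[OF hc(2)]) auto
    moreover have "continuous_on (ball 0 c) ?G"
      by (rule continuous_on_cong[THEN iffD1, OF refl _ continuous_on_const[of _ 0]]) (use near0 in simp)
    ultimately have "continuous_on (- {0} \<union> ball 0 c) ?G" by (intro continuous_on_open_Un) auto
    moreover have "- {0} \<union> ball 0 c = (UNIV :: 'a set)" using c0 by auto
    ultimately show ?thesis by simp
  qed
  ultimately show ?thesis by (simp add: is_C1_def)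
qed

end

text \<open>The squared gradient splits orthogonally into two terms, each a radial function times a
  0-homogeneous one, so polar coordinates factor both integrals. The potential term joins the first
  of them.\<close>

lemma (in radial_solution) Qform_product:
  fixes \<eta> \<eta>' h h' :: "real \<Rightarrow> real"
  assumes e: "norm e = 1" and cd: "a < c" "d < b"
    and \<eta>: "\<And>r. (\<eta> has_real_derivative \<eta>' r) (at r)" "continuous_on UNIV \<eta>'" "\<And>r. r \<notin> {c..d} \<Longrightarrow> \<eta> r = 0"
    and h: "\<And>y. (h has_real_derivative h' y) (at y)" "continuous_on UNIV h'"
    and i1: "(\<lambda>r. ((\<eta>' r)\<^sup>2 - r powr \<alpha> * f' (U r) * (\<eta> r)\<^sup>2) * r ^ (DIM('a) - 1)) absolutely_integrable_on {a<..<b}"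
    and i2: "(\<lambda>r. (\<eta> r / r)\<^sup>2 * r ^ (DIM('a) - 1)) absolutely_integrable_on {a<..<b}"
  shows "(\<lambda>x. \<eta> (norm x) * h (dir_cos e x)) \<in> C1_0 \<Omega>"
    "Qform \<Omega> \<alpha> f' u (\<lambda>x. \<eta> (norm x) * h (dir_cos e x))
      = angular_mass (\<lambda>x. (h (dir_cos e x))\<^sup>2)
          * integral {a<..<b} (\<lambda>r. ((\<eta>' r)\<^sup>2 - r powr \<alpha> * f' (U r) * (\<eta> r)\<^sup>2) * r ^ (DIM('a) - 1))
        + angular_mass (\<lambda>x. (h' (dir_cos e x))\<^sup>2 * (1 - (dir_cos e x)\<^sup>2))
          * integral {a<..<b} (\<lambda>r. (\<eta> r / r)\<^sup>2 * r ^ (DIM('a) - 1))"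
proof -
  let ?\<Psi> = "\<lambda>x. \<eta> (norm x) * h (dir_cos e x)"
  note C1 = is_C1_product[OF cd(1) \<eta> h, where e=e]
  have gr: "grad ?\<Psi> x = (\<eta>' (norm x) * h (dir_cos e x) / norm x) *\<^sub>R x
        + (\<eta> (norm x) * h' (dir_cos e x) / norm x) *\<^sub>R (e - (dir_cos e x / norm x) *\<^sub>R x)" for x
    by (rule fun_cong[OF is_C1_imp_grad[OF C1]])
  have c0: "0 < c" using cd a_nonneg by simp
  show \<Psi>: "?\<Psi> \<in> C1_0 \<Omega>"
  proof (rule C1_0_I[OF C1])
    show "compact (cball 0 d - ball (0::'a) c)" by (intro compact_diff) auto
    show "cball 0 d - ball (0::'a) c \<subseteq> \<Omega>"
    proof
      fix x :: 'a assume x: "x \<in> cball 0 d - ball 0 c"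
      then have "x \<noteq> 0" using c0 by auto
      then show "x \<in> \<Omega>" using x cd mem_iff by auto
    qed
    show "?\<Psi> x = 0" if "x \<notin> cball 0 d - ball (0::'a) c" for x using that \<eta>(3)[of "norm x"] by auto
  qed
  have hc: "continuous_on UNIV h" by (rule DERIV_continuous_on[OF has_field_derivative_at_within[OF h(1)]])
  let ?F1 = "\<lambda>r. (\<eta>' r)\<^sup>2 - r powr \<alpha> * f' (U r) * (\<eta> r)\<^sup>2" and ?F2 = "\<lambda>r. (\<eta> r / r)\<^sup>2"
  let ?A = "\<lambda>x. (h (dir_cos e x))\<^sup>2" and ?B = "\<lambda>x. (h' (dir_cos e x))\<^sup>2 * (1 - (dir_cos e x)\<^sup>2)"
  obtain CA where A: "angular ?A CA"
    using angular_dir_cos[OF e, of "\<lambda>y. (h y)\<^sup>2"] hc by (auto intro!: continuous_intros)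
  obtain CB where B: "angular ?B CB"
  proof -
    have "\<exists>C. angular (\<lambda>x. (\<lambda>y. (h' y)\<^sup>2 * (1 - y\<^sup>2)) (dir_cos e x)) C"
      by (rule angular_dir_cos[OF e]) (use h(2) in \<open>auto intro!: continuous_intros simp: abs_square_le_1\<close>)
    then show ?thesis using that by blast
  qed
  note PA = polar_domain[OF A i1] and PB = polar_domain[OF B i2]
  have eq: "AE x in lebesgue_on \<Omega>. ?F1 (norm x) * ?A x + ?F2 (norm x) * ?B x
      = (norm (wgrad \<Omega> ?\<Psi> x))\<^sup>2 - norm x powr \<alpha> * f' (u x) * (?\<Psi> x)\<^sup>2"
  proof -
    have "AE x in lebesgue_on \<Omega>. x \<in> \<Omega>" using AE_space[of "lebesgue_on \<Omega>"] by simp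
    moreover have "AE x in lebesgue_on \<Omega>. x \<noteq> 0"
      using lebesgue_domain AE_completion[OF AE_lborel_singleton[of "0::'a"]]
      by (subst AE_restrict_space_iff) (auto elim: eventually_mono)
    ultimately show ?thesis using wgrad_C1_0_AE[OF \<Psi> open_domain]
    proof eventually_elim
      case (elim x)
      have "(norm (wgrad \<Omega> ?\<Psi> x))\<^sup>2 = (\<eta>' (norm x) * h (dir_cos e x))\<^sup>2 + (\<eta> (norm x) * h' (dir_cos e x) / norm x)\<^sup>2 * (1 - (dir_cos e x)\<^sup>2)"
        unfolding elim(3) gr by (rule norm_product_gradient[OF e elim(2)])
      then show ?case using u_radial[OF elim(1)] by (simp add: power_mult_distrib power_divide algebra_simps diff_divide_distrib)
    qed
  qed
  have i: "integrable (lebesgue_on \<Omega>) (\<lambda>x. ?F1 (norm x) * ?A x + ?F2 (norm x) * ?B x)"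
    by (rule Bochner_Integration.integrable_add[OF PA(1) PB(1)])
  have m: "(\<lambda>x. ?F1 (norm x) * ?A x + ?F2 (norm x) * ?B x) \<in> borel_measurable (lebesgue_on \<Omega>)"
    by (rule borel_measurable_integrable[OF i])
  have "Qform \<Omega> \<alpha> f' u ?\<Psi> = (LINT x|lebesgue_on \<Omega>. ?F1 (norm x) * ?A x + ?F2 (norm x) * ?B x)"
    unfolding Qform_def
    by (rule integral_cong_AE[OF m borel_measurable_lebesgue_on_AE[OF m eq lebesgue_domain] eq, symmetric])
  also have "\<dots> = (LINT x|lebesgue_on \<Omega>. ?F1 (norm x) * ?A x) + (LINT x|lebesgue_on \<Omega>. ?F2 (norm x) * ?B x)"
    by (rule Bochner_Integration.integral_add[OF PA(1) PB(1)])
  finally show "Qform \<Omega> \<alpha> f' u ?\<Psi> = angular_mass ?A * integral {a<..<b} (\<lambda>r. ?F1 r * r ^ (DIM('a) - 1))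
      + angular_mass ?B * integral {a<..<b} (\<lambda>r. ?F2 r * r ^ (DIM('a) - 1))"
    unfolding PA(2) PB(2) .
qed

text \<open>Supported on the i-th of k equal parts of [0,1]; evaluated at the cosine, the indices i
  < k give k disjoint zones of the sphere.\<close>

definition bump :: "nat \<Rightarrow> nat \<Rightarrow> real \<Rightarrow> real" where
  "bump k i y = (max 0 ((y - real i / real k) * (real (Suc i) / real k - y)))\<^sup>2"

definition bump' :: "nat \<Rightarrow> nat \<Rightarrow> real \<Rightarrow> real" where
  "bump' k i y = 2 * max 0 ((y - real i / real k) * (real (Suc i) / real k - y))
     * (real (Suc i) / real k + real i / real k - 2 * y)"

lemma bump_DERIV: "(bump k i has_real_derivative bump' k i y) (at y)"
proof -
  have "((\<lambda>y. (y - real i / real k) * (real (Suc i) / real k - y)) has_real_derivative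
      (real (Suc i) / real k + real i / real k - 2 * y)) (at y)"
    by (auto intro!: derivative_eq_intros)
  from DERIV_chain2[OF DERIV_pospart_square this] show ?thesis
    by (simp only: bump_def[abs_def] bump'_def)
qed

lemma bump'_cont: "continuous_on S (bump' k i)"
  unfolding bump'_def[abs_def] by (intro continuous_intros)

lemma bump_cont: "continuous_on S (bump k i)"
  unfolding bump_def[abs_def] by (intro continuous_intros)

lemma bump_nonzero_imp:
  assumes "bump k i y \<noteq> 0 \<or> bump' k i y \<noteq> 0"
  shows "real i / real k < y \<and> y < real (Suc i) / real k"
proof -
  have "max 0 ((y - real i / real k) * (real (Suc i) / real k - y)) \<noteq> 0"
    using assms unfolding bump_def bump'_def by (metis mult_zero_left mult_zero_right zero_power2)
  then have "(y - real i / real k) * (real (Suc i) / real k - y) > 0"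
    unfolding max_def by (metis less_eq_real_def)
  \<comment> \<open>With the end points in this order the two factors cannot both be negative, so a
    positive product makes both positive.\<close>
  moreover have "real i / real k \<le> real (Suc i) / real k" by (simp add: divide_right_mono)
  ultimately show ?thesis by (auto simp: zero_less_mult_iff)
qed

lemma bump_midpoint: "0 < k \<Longrightarrow> bump k i ((real i + 1 / 2) / real k) \<noteq> 0"
  by (simp add: bump_def field_simps max_def) 

lemma bump_disjoint:
  assumes "i \<noteq> j" shows "bump k i y * bump k j y = 0" "bump' k i y * bump' k j y = 0"
proof -
  have "\<not> ((real i / real k < y \<and> y < real (Suc i) / real k) \<and> (real j / real k < y \<and> y < real (Suc j) / real k))"
  \<comment> \<open>For k = 0 both end points are 0 by the convention for division, and the interval
    is empty.\<close>
  proof (cases "k = 0")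
    case False
    then have "(real i < y * real k \<and> y * real k < real (Suc i)) \<longleftrightarrow> (real i / real k < y \<and> y < real (Suc i) / real k)" for i
      by (simp add: field_simps)
    moreover have "\<not> ((real i < z \<and> z < real (Suc i)) \<and> (real j < z \<and> z < real (Suc j)))" for z
      using assms by linarith
    ultimately show ?thesis by blast
  qed simp
  then show "bump k i y * bump k j y = 0" "bump' k i y * bump' k j y = 0"
    using bump_nonzero_imp by (metis mult_eq_0_iff)+
qed

lemma sum_square_disjoint:
  fixes a :: "'i \<Rightarrow> real"
  assumes "finite I" "\<And>i j. i \<in> I \<Longrightarrow> j \<in> I \<Longrightarrow> i \<noteq> j \<Longrightarrow> a i * a j = 0"
  shows "(\<Sum>i\<in>I. a i)\<^sup>2 = (\<Sum>i\<in>I. (a i)\<^sup>2)"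
proof -
  have "(\<Sum>i\<in>I. a i)\<^sup>2 = (\<Sum>i\<in>I. \<Sum>j\<in>I. a i * a j)"
    by (simp add: power2_eq_square sum_product)
  also have "\<dots> = (\<Sum>i\<in>I. (a i)\<^sup>2)"
  proof (rule sum.cong[OF refl])
    fix i assume i: "i \<in> I"
    have "(\<Sum>j\<in>I. a i * a j) = (\<Sum>j\<in>I. if i = j then (a i)\<^sup>2 else 0)"
      by (rule sum.cong) (use assms(2) i in \<open>auto simp: power2_eq_square\<close>)
    then show "(\<Sum>j\<in>I. a i * a j) = (a i)\<^sup>2" using assms(1) i by simp
  qed
  finally show ?thesis .
qed

lemma angular_mass_sum:
  assumes "finite I" "\<And>i. i \<in> I \<Longrightarrow> \<exists>C. angular (A i) C"
  shows "angular_mass (\<lambda>x. \<Sum>i\<in>I. w i * A i x) = (\<Sum>i\<in>I. w i * angular_mass (A i))"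
proof -
  have i: "integrable lborel (\<lambda>x. indicator (cball 0 1) x * A i x)" if "i \<in> I" for i
    using assms(2)[OF that] angular.integrable_unit_ball by blast
  have "(\<lambda>x. indicator (cball 0 1) x * (\<Sum>i\<in>I. w i * A i x)) = (\<lambda>x. \<Sum>i\<in>I. w i * (indicator (cball 0 1) x * A i x))"
    by (simp add: sum_distrib_left mult_ac)
  moreover have "(LINT x|lborel. (\<Sum>i\<in>I. w i * (indicator (cball 0 1) x * A i x)))
      = (\<Sum>i\<in>I. w i * (LINT x|lborel. indicator (cball 0 1) x * A i x))"
    using i by (subst Bochner_Integration.integral_sum) auto
  ultimately show ?thesis by (simp add: angular_mass_def sum_distrib_left mult_ac)
qed

definition bump_mass :: "nat \<Rightarrow> 'a::euclidean_space \<Rightarrow> nat \<Rightarrow> real" where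
  "bump_mass k e i = angular_mass (\<lambda>x. (bump k i (dir_cos e x))\<^sup>2)"

definition bump_energy :: "nat \<Rightarrow> 'a::euclidean_space \<Rightarrow> nat \<Rightarrow> real" where
  "bump_energy k e i = angular_mass (\<lambda>x. (bump' k i (dir_cos e x))\<^sup>2 * (1 - (dir_cos e x)\<^sup>2))"

text \<open>A convenient upper bound for the largest Rayleigh quotient of the bumps; it depends only
  on k and e, hence is the same for every \<alpha>.\<close>

definition bump_quotient :: "nat \<Rightarrow> 'a::euclidean_space \<Rightarrow> real" where
  "bump_quotient k e = (\<Sum>i<k. bump_energy k e i / bump_mass k e i)"

lemma angular_bump:
  assumes "norm e = 1"
  shows "\<exists>C. angular (\<lambda>x. (bump k i (dir_cos e x))\<^sup>2) C"
    "\<exists>C. angular (\<lambda>x. (bump' k i (dir_cos e x))\<^sup>2 * (1 - (dir_cos e x)\<^sup>2)) C"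
proof -
  show "\<exists>C. angular (\<lambda>x. (bump k i (dir_cos e x))\<^sup>2) C"
    by (rule angular_dir_cos[OF assms, of "\<lambda>y. (bump k i y)\<^sup>2"]) (auto intro!: continuous_intros bump_cont)
  show "\<exists>C. angular (\<lambda>x. (bump' k i (dir_cos e x))\<^sup>2 * (1 - (dir_cos e x)\<^sup>2)) C"
    by (rule angular_dir_cos[OF assms, of "\<lambda>y. (bump' k i y)\<^sup>2 * (1 - y\<^sup>2)"])
      (auto intro!: continuous_intros bump'_cont simp: abs_square_le_1)
qed

lemma bump_mass_pos:
  fixes e :: "'a::euclidean_space"
  assumes "2 \<le> DIM('a)" "e \<in> Basis" "i < k"
  shows "0 < bump_mass k e i" "0 \<le> bump_energy k e i"
proof -
  have e: "norm e = 1" using assms(2) by simp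
  obtain C where C: "angular (\<lambda>x. (bump k i (dir_cos e x))\<^sup>2) C" using angular_bump(1)[OF e] by blast
  show "0 < bump_mass k e i" unfolding bump_mass_def
  proof (rule angular_mass_pos[OF assms(1,2), of "\<lambda>y. (bump k i y)\<^sup>2", OF C])
    show "continuous_on UNIV (\<lambda>y. (bump k i y)\<^sup>2)" by (intro continuous_intros bump_cont)
    show "\<bar>(real i + 1 / 2) / real k\<bar> \<le> 1" using assms(3) by (simp add: field_simps)
    show "(bump k i ((real i + 1 / 2) / real k))\<^sup>2 \<noteq> 0" using bump_midpoint[of k i] assms(3) by simp
  qed
  show "0 \<le> bump_energy k e i" unfolding bump_energy_def
    using angular_bump(2)[OF e, of k i] angular.mass_nonneg by blast
qed

lemma bump_energy_le:
  fixes e :: "'a::euclidean_space"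
  assumes "2 \<le> DIM('a)" "e \<in> Basis" "i < k"
  shows "bump_energy k e i \<le> bump_quotient k e * bump_mass k e i"
proof -
  have "bump_energy k e i / bump_mass k e i \<le> bump_quotient k e"
    unfolding bump_quotient_def
    by (rule member_le_sum) (use assms bump_mass_pos[OF assms(1,2)] in \<open>auto simp: less_imp_le\<close>)
  then show ?thesis using bump_mass_pos(1)[OF assms] by (simp add: divide_le_eq)
qed

text \<open>The bumps have disjoint supports, so the quadratic form is diagonal on the span of the products.\<close>

lemma (in radial_solution) morse_index_ge:
  fixes e :: 'a
  assumes f': "has_weak_gradient UNIV f f'" and zones: "card (nodal_zones \<Omega> u) \<ge> 2"
    and e: "e \<in> Basis" and crit: "bump_quotient k e + 1 \<le> crit"
  shows "enat k \<le> morse_index \<Omega> \<alpha> f' u"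
proof -
  have ne: "norm e = 1" using e by simp
  let ?\<Lambda> = "bump_quotient k e"
  obtain \<eta> \<eta>' c d where cd: "a < c" "d < b"
    and \<eta>: "\<And>r. (\<eta> has_real_derivative \<eta>' r) (at r)" "continuous_on UNIV \<eta>'"
      "\<And>r. r \<notin> {c..d} \<Longrightarrow> \<eta> r = 0" "\<exists>r. \<eta> r \<noteq> 0"
    and i1: "(\<lambda>r. ((\<eta>' r)\<^sup>2 - r powr \<alpha> * f' (U r) * (\<eta> r)\<^sup>2) * r ^ (DIM('a) - 1)) absolutely_integrable_on {a<..<b}"
    and i2: "(\<lambda>r. (\<eta> r / r)\<^sup>2 * r ^ (DIM('a) - 1)) absolutely_integrable_on {a<..<b}"
    and neg: "integral {a<..<b} (\<lambda>r. ((\<eta>' r)\<^sup>2 - r powr \<alpha> * f' (U r) * (\<eta> r)\<^sup>2) * r ^ (DIM('a) - 1))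
      + ?\<Lambda> * integral {a<..<b} (\<lambda>r. (\<eta> r / r)\<^sup>2 * r ^ (DIM('a) - 1)) < 0"
    by (rule test_profile[OF f' zones crit]) blast
  define I1 where "I1 = integral {a<..<b} (\<lambda>r. ((\<eta>' r)\<^sup>2 - r powr \<alpha> * f' (U r) * (\<eta> r)\<^sup>2) * r ^ (DIM('a) - 1))"
  define I2 where "I2 = integral {a<..<b} (\<lambda>r. (\<eta> r / r)\<^sup>2 * r ^ (DIM('a) - 1))"
  have I2: "I2 \<ge> 0" unfolding I2_def
    using a_nonneg by (intro integral_nonneg set_lebesgue_integral_eq_integral(1)[OF i2]) auto
  define \<Psi> where "\<Psi> i = (\<lambda>x::'a. \<eta> (norm x) * bump k i (dir_cos e x))" for i
  define comb where "comb w = (\<lambda>x. \<Sum>i<k. w i * \<Psi> i x)" for w :: "nat \<Rightarrow> real"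
  have comb: "comb w \<in> H1_0 \<Omega>" "Qform \<Omega> \<alpha> f' u (comb w) = (\<Sum>i<k. (w i)\<^sup>2 * (bump_mass k e i * I1 + bump_energy k e i * I2))" for w
  proof -
    \<comment> \<open>A linear combination of the test functions is again \<eta> times a single
      angular factor \<open>h\<close>, so the formula for products applies to it directly.\<close>
    define h where "h y = (\<Sum>i<k. w i * bump k i y)" for y
    define h' where "h' y = (\<Sum>i<k. w i * bump' k i y)" for y
    have hd: "(h has_real_derivative h' y) (at y)" for y
      unfolding h_def[abs_def] h'_def by (intro DERIV_sum DERIV_cmult bump_DERIV)
    have hc: "continuous_on UNIV h'"
      unfolding h'_def[abs_def] by (intro continuous_intros bump'_cont)
    have cw: "comb w = (\<lambda>x. \<eta> (norm x) * h (dir_cos e x))"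
      by (simp add: comb_def \<Psi>_def h_def sum_distrib_left mult_ac)
    note Q = Qform_product[OF ne cd \<eta>(1-3) hd hc i1 i2]
    show "comb w \<in> H1_0 \<Omega>" unfolding cw by (rule C1_0_subset_H1_0[OF Q(1) open_domain])
    have "(h y)\<^sup>2 = (\<Sum>i<k. (w i)\<^sup>2 * (bump k i y)\<^sup>2)" for y
      unfolding h_def using bump_disjoint(1)
      by (subst sum_square_disjoint) (auto simp: power_mult_distrib mult_ac)
    then have mA: "angular_mass (\<lambda>x. (h (dir_cos e x))\<^sup>2) = (\<Sum>i<k. (w i)\<^sup>2 * bump_mass k e i)"
      by (simp add: bump_mass_def angular_mass_sum angular_bump(1)[OF ne])
    have "(h' y)\<^sup>2 = (\<Sum>i<k. (w i)\<^sup>2 * (bump' k i y)\<^sup>2)" for y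
      unfolding h'_def using bump_disjoint(2)
      by (subst sum_square_disjoint) (auto simp: power_mult_distrib mult_ac)
    then have "(h' y)\<^sup>2 * (1 - y\<^sup>2) = (\<Sum>i<k. (w i)\<^sup>2 * ((bump' k i y)\<^sup>2 * (1 - y\<^sup>2)))" for y
      by (simp add: sum_distrib_right mult.assoc)
    then have mB: "angular_mass (\<lambda>x. (h' (dir_cos e x))\<^sup>2 * (1 - (dir_cos e x)\<^sup>2)) = (\<Sum>i<k. (w i)\<^sup>2 * bump_energy k e i)"
      by (simp add: bump_energy_def angular_mass_sum angular_bump(2)[OF ne])
    show "Qform \<Omega> \<alpha> f' u (comb w) = (\<Sum>i<k. (w i)\<^sup>2 * (bump_mass k e i * I1 + bump_energy k e i * I2))"
    proof -
      have "Qform \<Omega> \<alpha> f' u (comb w) = (\<Sum>i<k. (w i)\<^sup>2 * bump_mass k e i) * I1 + (\<Sum>i<k. (w i)\<^sup>2 * bump_energy k e i) * I2"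
        unfolding cw I1_def I2_def mA[symmetric] mB[symmetric] by (rule Q(2))
      then show ?thesis by (simp add: sum_distrib_right sum.distrib distrib_left mult.assoc)
    qed
  qed
  \<comment> \<open>Bounding the angular energy by \<open>bump_quotient\<close> times the mass
    leaves a positive multiple of the radial quantity that is negative by the choice of
    \<eta>.\<close>
  have term_neg: "bump_mass k e i * I1 + bump_energy k e i * I2 < 0" if "i < k" for i
  proof -
    have "bump_mass k e i * I1 + bump_energy k e i * I2 \<le> bump_mass k e i * I1 + (?\<Lambda> * bump_mass k e i) * I2"
      using bump_energy_le[OF dim e that] I2 by (intro add_left_mono mult_right_mono)
    also have "\<dots> = bump_mass k e i * (I1 + ?\<Lambda> * I2)" by (simp add: algebra_simps)
    also have "\<dots> < 0"
      using bump_mass_pos(1)[OF dim e that] neg by (simp add: mult_less_0_iff I1_def I2_def)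
    finally show ?thesis .
  qed
  obtain r0 where r0: "\<eta> r0 \<noteq> 0" using \<eta>(4) by blast
  then have "c \<le> r0" using \<eta>(3)[of r0] by force
  then have r0pos: "0 < r0" using cd a_nonneg by simp
  have "\<exists>x. norm x = r0 \<and> dir_cos e x = (real i + 1 / 2) / real k" if "i < k" for i
    by (rule dir_cos_surj[OF dim e _ r0pos, of "(real i + 1 / 2) / real k"]) (use that in \<open>auto simp: field_simps\<close>)
  \<comment> \<open>Sample points at the bump centres: of the k products exactly one is nonzero at
    each of them, which yields injectivity and linear independence.\<close>
  then obtain X where X: "\<And>i. i < k \<Longrightarrow> norm (X i) = r0" "\<And>i. i < k \<Longrightarrow> dir_cos e (X i) = (real i + 1 / 2) / real k"
    by metis
  have X1: "\<Psi> i (X i) \<noteq> 0" if "i < k" for i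
    using bump_midpoint[of k i] that r0 by (simp add: \<Psi>_def X)
  have X0: "\<Psi> j (X i) = 0" if "i < k" "j \<noteq> i" for i j
    using bump_disjoint(1)[OF that(2), of k "(real i + 1 / 2) / real k"] bump_midpoint[of k i] that by (simp add: \<Psi>_def X)
  define B where "B = \<Psi> ` {..<k}"
  have inj: "inj_on \<Psi> {..<k}"
  proof (rule inj_onI)
    fix i j assume "i \<in> {..<k}" "j \<in> {..<k}" "\<Psi> i = \<Psi> j"
    then show "i = j" using X1[of i] X0[of i j] by auto
  qed
  have cardB: "card B = k" "finite B" unfolding B_def by (simp_all add: card_image inj)
  have ind: "\<not> fun_vs.dependent B"
  proof
    assume "fun_vs.dependent B"
    then obtain v where v: "v \<in> B" "v \<in> fun_vs.span (B - {v})" by (auto simp: fun_vs.dependent_def)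
    then obtain i where i: "i < k" "v = \<Psi> i" by (auto simp: B_def)
    have "fun_vs.span (B - {v}) \<subseteq> {\<psi>. \<psi> (X i) = 0}"
    proof (rule fun_vs.span_minimal)
      show "B - {v} \<subseteq> {\<psi>. \<psi> (X i) = 0}"
      proof
        fix \<psi> assume "\<psi> \<in> B - {v}"
        then obtain j where "\<psi> = \<Psi> j" "j \<noteq> i" using i(2) by (auto simp: B_def)
        then show "\<psi> \<in> {\<psi>. \<psi> (X i) = 0}" using X0[OF i(1)] by simp
      qed
      show "fun_vs.subspace {\<psi>. \<psi> (X i) = 0}"
        by (rule fun_vs.subspaceI) (auto simp: fun_scale_def)
    qed
    then show False using v(2) X1[OF i(1)] i(2) by auto
  qed
  have span: "\<exists>w. \<psi> = comb w" if "\<psi> \<in> fun_vs.span B" for \<psi>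
  proof -
    have "fun_vs.span B \<subseteq> range comb"
    proof (rule fun_vs.span_minimal)
      show "B \<subseteq> range comb"
      proof
        fix v assume "v \<in> B"
        then obtain i where "i < k" "v = \<Psi> i" by (auto simp: B_def)
        then have "v = comb (\<lambda>j. if j = i then 1 else 0)"
          by (simp add: comb_def if_distrib[of "\<lambda>x. x * _"] cong: if_cong)
        then show "v \<in> range comb" by blast
      qed
      show "fun_vs.subspace (range comb)"
      proof (rule fun_vs.subspaceI)
        show "0 \<in> range comb" by (rule image_eqI[of _ _ "\<lambda>_. 0"]) (auto simp: comb_def zero_fun_def)
        show "x + y \<in> range comb" if xy: "x \<in> range comb" "y \<in> range comb" for x y
        proof -
          obtain v w where "x = comb v" "y = comb w" using xy by blast
          then have "x + y = comb (\<lambda>i. v i + w i)"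
            by (simp add: comb_def plus_fun_def distrib_right sum.distrib)
          then show ?thesis by blast
        qed
        show "fun_scale r x \<in> range comb" if xr: "x \<in> range comb" for r x
        proof -
          obtain v where "x = comb v" using xr by blast
          then have "fun_scale r x = comb (\<lambda>i. r * v i)"
            by (simp add: comb_def fun_scale_def sum_distrib_left mult_ac)
          then show ?thesis by blast
        qed
      qed
    qed
    then show ?thesis using that by blast
  qed
  have "enat (fun_vs.dim (fun_vs.span B)) \<le> morse_index \<Omega> \<alpha> f' u"
    unfolding morse_index_def
  proof (rule Sup_upper, rule CollectI, rule exI[of _ "fun_vs.span B"], intro conjI refl)
    show "fun_vs.subspace (fun_vs.span B)" by (rule fun_vs.subspace_span)
    show "\<exists>Ba. finite Ba \<and> fun_vs.span Ba = fun_vs.span B" using cardB(2) by blast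
    show "fun_vs.span B \<subseteq> H1_0 \<Omega>" using span comb(1) by blast
    show "\<forall>\<psi>\<in>fun_vs.span B. \<psi> \<noteq> 0 \<longrightarrow> Qform \<Omega> \<alpha> f' u \<psi> < 0"
    proof (intro ballI impI)
      fix \<psi> assume "\<psi> \<in> fun_vs.span B" "\<psi> \<noteq> 0"
      then obtain w where w: "\<psi> = comb w" using span by blast
      have "\<exists>i<k. w i \<noteq> 0"
      proof (rule ccontr)
        assume "\<not> ?thesis"
        then have "comb w = 0" by (auto simp: comb_def zero_fun_def)
        then show False using w \<open>\<psi> \<noteq> 0\<close> by simp
      qed
      then obtain i where i: "i < k" "w i \<noteq> 0" by blast
      have "(\<Sum>i<k. (w i)\<^sup>2 * (bump_mass k e i * I1 + bump_energy k e i * I2)) < (\<Sum>i<k. 0)"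
      proof (rule sum_strict_mono_ex1)
        show "\<forall>i\<in>{..<k}. (w i)\<^sup>2 * (bump_mass k e i * I1 + bump_energy k e i * I2) \<le> 0"
          using term_neg by (auto simp: mult_le_0_iff less_imp_le)
        show "\<exists>i\<in>{..<k}. (w i)\<^sup>2 * (bump_mass k e i * I1 + bump_energy k e i * I2) < 0"
          using i term_neg[OF i(1)] by (intro bexI[of _ i]) (auto simp: mult_less_0_iff)
      qed simp
      then show "Qform \<Omega> \<alpha> f' u \<psi> < 0" unfolding w comb(2) by simp
    qed
  qed
  moreover have "fun_vs.dim (fun_vs.span B) = k"
    using fun_vs.dim_span_eq_card_independent[OF ind] cardB by simp
  ultimately show ?thesis by simp
qed

text \<open>The growth is in fact quadratic, at least (\<alpha>/2 + 1)^2; a linear bound is enough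
  for the limit.\<close>

lemma (in radial_solution) crit_ge: "\<alpha> / 2 \<le> crit"
proof -
  have "\<gamma> \<ge> \<alpha> / 2 + 1" using dim by (simp add: \<gamma>_def)
  moreover have "\<gamma> + 2 - real DIM('a) = \<alpha> / 2 + 1" by (simp add: \<gamma>_def)
  ultimately have "(\<alpha> / 2 + 1) * (\<alpha> / 2 + 1) \<le> crit"
    unfolding crit_def using \<alpha>_nonneg by (simp only:) (rule mult_right_mono, simp_all)
  moreover have "\<alpha> / 2 \<le> (\<alpha> / 2 + 1) * (\<alpha> / 2 + 1)" using \<alpha>_nonneg by (simp add: algebra_simps)
  ultimately show ?thesis by simp
qed

section \<open>The limit along a sequence of exponents\<close>

lemma bounded_radial_domain_imp:
  fixes \<Omega> :: "'a::euclidean_space set"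
  assumes "bounded_radial_domain \<Omega>" "2 \<le> DIM('a)"
  obtains a b where "radial_domain \<Omega> a b"
proof (cases "\<exists>R>0. \<Omega> = ball 0 R")
  case True
  then obtain R where R: "R > 0" "\<Omega> = ball 0 R" by blast
  have "radial_domain \<Omega> 0 R" by unfold_locales (use R assms(2) in auto)
  then show ?thesis by (rule that)
next
  case False
  then obtain a b where ab: "0 < a" "a < b" "\<Omega> = {x. a < norm x \<and> norm x < b}"
    using assms(1) by (auto simp: bounded_radial_domain_def)
  have "radial_domain \<Omega> a b" by unfold_locales (use ab assms(2) in auto)
  then show ?thesis by (rule that)
qed

theorem corollary1p2:
  fixes \<Omega> :: "'a::euclidean_space set" and f f' :: "real \<Rightarrow> real"
    and \<alpha> :: "nat \<Rightarrow> real" and u :: "nat \<Rightarrow> 'a \<Rightarrow> real"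
  assumes "DIM('a) \<ge> 2"
    and "bounded_radial_domain \<Omega>"
    and "continuous_on UNIV f" and "has_weak_gradient UNIV f f'"
    and "\<And>n. \<alpha> n \<ge> 0" and "filterlim \<alpha> at_top sequentially"
    and "\<And>n. weak_solution \<Omega> (\<alpha> n) f (u n)"
    and "\<And>n. continuous_on \<Omega> (u n)" and "\<And>n. radial_on \<Omega> (u n)"
    and "\<And>n. finite (nodal_zones \<Omega> (u n)) \<and> card (nodal_zones \<Omega> (u n)) \<ge> 2"
    and "\<And>n. in_Linfty \<Omega> (\<lambda>x. f' (u n x))"
  shows "(\<lambda>n. morse_index \<Omega> (\<alpha> n) f' (u n)) \<longlonglongrightarrow> \<infinity>"
proof -
  obtain e :: 'a where e: "e \<in> Basis" using nonempty_Basis by blast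
  obtain a b where "radial_domain \<Omega> a b" by (rule bounded_radial_domain_imp[OF assms(2,1)])
  then interpret radial_domain \<Omega> a b .
  \<comment> \<open>The profile is read off along the fixed ray through \<open>e\<close>, to which
    the radial symmetry and continuity of \<open>u n\<close> transfer.\<close>
  have sol: "radial_solution \<Omega> a b (\<alpha> n) f (u n) (\<lambda>r. u n (r *\<^sub>R e))" for n
  proof unfold_locales
    have mem: "r *\<^sub>R e \<in> \<Omega>" if "r \<in> radii" for r
      using that e a_nonneg by (auto simp: mem_iff_radii radii_def split: if_splits)
    show "u n x = u n (norm x *\<^sub>R e)" if "x \<in> \<Omega>" for x
      proof -
      have "norm x *\<^sub>R e \<in> \<Omega>" using that mem[of "norm x"] by (simp add: mem_iff_radii)
      moreover have "norm x = norm (norm x *\<^sub>R e)" using e by simp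
      ultimately show ?thesis using assms(9)[of n] that unfolding radial_on_def by blast
    qed
    show "continuous_on radii (\<lambda>r. u n (r *\<^sub>R e))"
      by (rule continuous_on_compose2[OF assms(8)]) (use mem in \<open>auto intro!: continuous_intros\<close>)
  qed (use assms in auto)
  show ?thesis
  proof (rule order_tendstoI)
    fix x :: enat assume "x < \<infinity>"
    then obtain k where k: "x = enat k" by auto
    \<comment> \<open>By \<open>crit_ge\<close>, an exponent of this size makes \<open>crit\<close>
      at least \<open>bump_quotient (Suc k) e + 1\<close>. The successor is there because the index
      has to exceed k strictly.\<close>
    let ?M = "2 * (bump_quotient (Suc k) e + 1)"
    have "eventually (\<lambda>n. ?M \<le> \<alpha> n) sequentially"
      using assms(6) by (simp add: filterlim_at_top)
    then show "eventually (\<lambda>n. x < morse_index \<Omega> (\<alpha> n) f' (u n)) sequentially"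
    proof eventually_elim
      case (elim n)
      interpret radial_solution \<Omega> a b "\<alpha> n" f "u n" "\<lambda>r. u n (r *\<^sub>R e)" by (rule sol)
      have "enat (Suc k) \<le> morse_index \<Omega> (\<alpha> n) f' (u n)"
        by (rule morse_index_ge[OF assms(4) _ e]) (use assms(10) crit_ge elim in auto)
      then show ?case unfolding k by (rule less_le_trans[rotated]) simp
    qed
  qed simp
qed

end
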